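(* Assume the density $\rho=\rho(N)$ follows one of the regimes (SubConst1), (Sub1), (SubConst2), (Sub2), (Sub3), and $L=(N/\rho)^{1/d}$. Let $r_N\in(0,1)$ be the unique solution of $rG_L'(r)=N$ and $a_N:=r_NG_L'(r_N)+r_N^2G_L''(r_N)$. Let $(j_N)$ be integers with $1\le j_N\le N$ and $j_N^2=o(a_N)$. Then $$H_{N-j}(L)\sim\frac{e^{G_L(r_N)}}{r_N^{N-j}\sqrt{2\pi a_N}}\qquad(N\to\infty),$$ uniformly in $0\le j\le j_N$.
   Context: Fix an integer $d\ge1$ and a real $\theta>0$. $X$ is a random vector in $\mathbb R^d$ with density $\varphi$, a Schwartz function, with $\mathbb E X=0$ and covariance $\operatorname{Cov}(X)$; $\varphi^{*j}$ is the $j$-fold convolution. $W_{L,j}:=\theta L^d\sum_{k\in\mathbb Z^d}\varphi^{*j}(Lk)$; $G_L(z):=\sum_{j\ge1}W_{L,j}z^j/j$ for $|z|<1$; $H_n(L)$ is defined by $\sum_{n\ge0}H_n(L)z^n=e^{G_L(z)}$ (equivalently $H_n(L)=\frac1{n!}\sum_{\sigma\in\mathcal S_n}\prod_jW_{L,j}^{C_j(\sigma)}$, $C_j(\sigma)$ the number of $j$-cycles). $\alpha_c:=\frac{\theta}{2\pi\sqrt{\det\operatorname{Cov}(X)}}$, $\rho_c:=\theta\sum_{j\ge1}\varphi^{*j}(0)$. Regimes: (SubConst1) $d=1$, $\rho\to\rho_*\in(0,\infty)$; (Sub1) $d=1$, $\rho\to\infty$, $\rho=o(\sqrt N)$; (SubConst2)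 $d=2$, $\rho\to\rho_*\in(0,\infty)$; (Sub2) $d=2$, $\rho\to\infty$, $\rho/\log N\to\alpha\in[0,\alpha_c)$; (Sub3) $d\ge3$, $\rho\to\rho_*\in(0,\rho_c)$. *)

theory Defs
  imports "HOL-Analysis.Analysis" "HOL-Library.Landau_Symbols"
    "HOL-Computational_Algebra.Formal_Power_Series"
begin

section \<open>Schwartz functions on R^d\<close>

text \<open>All iterated partial derivatives of f (partial derivatives along the
coordinate axes, taken as Frechet derivatives applied to basis vectors).\<close>
inductive_set partials_of :: "(real^'d \<Rightarrow> real) \<Rightarrow> (real^'d \<Rightarrow> real) set"
  for f :: "real^'d \<Rightarrow> real" where
  self: "f \<in> partials_of f"
| step: "g \<in> partials_of f \<Longrightarrow>
          (\<lambda>x. frechet_derivative g (at x) (axis i 1)) \<in> partials_of f"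

text \<open>Schwartz: smooth (every iterated partial derivative is differentiable)
and every iterated partial derivative decays faster than any power of |x|.\<close>
definition schwartz :: "(real^'d \<Rightarrow> real) \<Rightarrow> bool" where
  "schwartz f \<longleftrightarrow>
     (\<forall>g\<in>partials_of f. (\<forall>x. g differentiable (at x)) \<and>
        (\<forall>n::nat. bounded (range (\<lambda>x. norm x ^ n * g x))))"

section \<open>Mean, covariance, convolution powers\<close>

definition mean_vec :: "(real^'d \<Rightarrow> real) \<Rightarrow> real^'d" where
  "mean_vec \<phi> = (\<integral>x. \<phi> x *\<^sub>R x \<partial>lborel)"

definition cov_mat :: "(real^'d \<Rightarrow> real) \<Rightarrow> real^'d^'d" where
  "cov_mat \<phi> = (\<chi> i k. \<integral>x. (x$i - mean_vec \<phi> $ i) * (x$k - mean_vec \<phi> $ k) * \<phi> x \<partial>lborel)"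

definition conv :: "(real^'d \<Rightarrow> real) \<Rightarrow> (real^'d \<Rightarrow> real) \<Rightarrow> real^'d \<Rightarrow> real" where
  "conv f g x = (\<integral>y. f y * g (x - y) \<partial>lborel)"

text \<open>conv_power f j is the j-fold convolution f^{*j} (j \<ge> 1); value at 0 unused.\<close>
fun conv_power :: "(real^'d \<Rightarrow> real) \<Rightarrow> nat \<Rightarrow> real^'d \<Rightarrow> real" where
  "conv_power f 0 = (\<lambda>_. 0)"
| "conv_power f (Suc 0) = f"
| "conv_power f (Suc (Suc n)) = conv f (conv_power f (Suc n))"

definition int_lattice :: "(real^'d) set" where
  "int_lattice = {k. \<forall>i. k $ i \<in> \<int>}"

section \<open>The quantities W, G, H\<close>

definition W :: "real \<Rightarrow> (real^'d \<Rightarrow> real) \<Rightarrow> real \<Rightarrow> nat \<Rightarrow> real" where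
  "W \<theta> \<phi> L j = \<theta> * L ^ CARD('d) * infsum (\<lambda>k. conv_power \<phi> j (L *\<^sub>R k)) int_lattice"

definition G :: "real \<Rightarrow> (real^'d \<Rightarrow> real) \<Rightarrow> real \<Rightarrow> real \<Rightarrow> real" where
  "G \<theta> \<phi> L z = (\<Sum>j. W \<theta> \<phi> L (Suc j) * z ^ Suc j / real (Suc j))"

text \<open>H_n(L): n-th coefficient of exp(G_L(z)) as a formal power series.\<close>
definition H :: "real \<Rightarrow> (real^'d \<Rightarrow> real) \<Rightarrow> real \<Rightarrow> nat \<Rightarrow> real" where
  "H \<theta> \<phi> L n = fps_nth (fps_compose (fps_exp 1)
        (Abs_fps (\<lambda>j. if j = 0 then 0 else W \<theta> \<phi> L j / real j))) n"

definition alpha_c :: "real \<Rightarrow> (real^'d \<Rightarrow> real) \<Rightarrow> real" where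
  "alpha_c \<theta> \<phi> = \<theta> / (2 * pi * sqrt (det (cov_mat \<phi>)))"

definition rho_c :: "real \<Rightarrow> (real^'d \<Rightarrow> real) \<Rightarrow> real" where
  "rho_c \<theta> \<phi> = \<theta> * (\<Sum>j. conv_power \<phi> (Suc j) 0)"

section \<open>Regimes, L, r_N, a_N\<close>

definition regime :: "real \<Rightarrow> (real^'d \<Rightarrow> real) \<Rightarrow> (nat \<Rightarrow> real) \<Rightarrow> bool" where
  "regime \<theta> \<phi> \<rho> \<longleftrightarrow>
     (CARD('d) = 1 \<and> (\<exists>\<rho>s. 0 < \<rho>s \<and> \<rho> \<longlonglongrightarrow> \<rho>s))
   \<or> (CARD('d) = 1 \<and> filterlim \<rho> at_top sequentially \<and> \<rho> \<in> o(\<lambda>N. sqrt (real N)))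
   \<or> (CARD('d) = 2 \<and> (\<exists>\<rho>s. 0 < \<rho>s \<and> \<rho> \<longlonglongrightarrow> \<rho>s))
   \<or> (CARD('d) = 2 \<and> filterlim \<rho> at_top sequentially \<and>
        (\<exists>\<alpha>. 0 \<le> \<alpha> \<and> \<alpha> < alpha_c \<theta> \<phi> \<and> (\<lambda>N. \<rho> N / ln (real N)) \<longlonglongrightarrow> \<alpha>))
   \<or> (CARD('d) \<ge> 3 \<and> (\<exists>\<rho>s. 0 < \<rho>s \<and> \<rho>s < rho_c \<theta> \<phi> \<and> \<rho> \<longlonglongrightarrow> \<rho>s))"

text \<open>L = (N/rho)^(1/d).\<close>
definition Lsize :: "(real^'d \<Rightarrow> real) \<Rightarrow> (nat \<Rightarrow> real) \<Rightarrow> nat \<Rightarrow> real" where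
  "Lsize \<phi> \<rho> N = (real N / \<rho> N) powr (1 / real CARD('d))"

text \<open>r_N: the unique solution in (0,1) of r G_L'(r) = N.\<close>
definition r_sol :: "real \<Rightarrow> (real^'d \<Rightarrow> real) \<Rightarrow> real \<Rightarrow> nat \<Rightarrow> real" where
  "r_sol \<theta> \<phi> L N = (THE r. 0 < r \<and> r < 1 \<and> r * deriv (G \<theta> \<phi> L) r = real N)"

definition a_var :: "real \<Rightarrow> (real^'d \<Rightarrow> real) \<Rightarrow> real \<Rightarrow> real \<Rightarrow> real" where
  "a_var \<theta> \<phi> L r = r * deriv (G \<theta> \<phi> L) r + r^2 * deriv (deriv (G \<theta> \<phi> L)) r"

end

(* Since H_n = [z^n] exp(G), the quantity H_{N-j} r^(N-j) exp(-G(r)) is the (N-j)-th Fourier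
   coefficient of exp(G(r e^(it)) - G(r)).  At the saddle point r = r_N the exponent is
   i N t - a_N t^2 / 2 up to an error bounded by the third moment, so after the scaling
   t = u / sqrt a_N dominated convergence gives the Gaussian limit as soon as
     (1) the third moment is o(a_N^(3/2)), and
     (2) the oscillation sum_j W_j r^j (1 - cos (j t)) / j is at least c (sqrt a_N |t|)^(1/2) - C
         on [-pi, pi].
   Uniformity in j comes for free by applying this to a worst index for each N.

   Both conditions only need two-sided bounds on W_j.  Nonnegativity gives
   W_j >= theta L^d phi^{*j}(0), and phi^{*j}(0) is asymptotic to a constant times j^(-d/2) by
   the local limit theorem.  Conversely W_j <= C (1 + L / sqrt j)^d, because the L-periodisation
   of phi is dominated by a product of Poisson kernels, which replaces Poisson summation by a
   finite trigonometric sum.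

   With M = 1 / (1 - r): if rho converges, r stays away from 1 and all moments are of
   order L^d.  When rho tends to infinity (d = 1, 2), the regime forces M = o(L^2); then
   a_N is of order V M^2 and the third moment at most of order V M^3 with V = (L / sqrt M)^d
   tending to infinity. *)

theory Submission
  imports Defs "HOL-Probability.Probability" "HOL-Complex_Analysis.Complex_Analysis"
    "HOL-Real_Asymp.Real_Asymp"
begin

no_notation fps_nth (infixl "$" 75)

section \<open>Gaussian integrals in coordinates\<close>

text \<open>Bounds on \<open>W\<close> up to constants suffice almost everywhere, since
  \<open>G\<close> and a_N enter the final formula exactly. Two thresholds are sharp.
  \<open>rho_c\<close> is the sum of the k = 0 terms themselves, so the trivial lower bound on
  \<open>W\<close> already reaches every density below it. \<open>alpha_c\<close> comes from the
  constant of the local limit theorem: for d = 2 the k = 0 terms behave like a multiple of 1/j,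
  their sum forces \<rho> \<ge> q (log M - O(1)) for every q < \<open>alpha_c\<close>, and \<alpha>
  < \<open>alpha_c\<close> then leaves M smaller than L^2 by a power of N.

  The square root in (2) is dictated by frequencies |t| > 1/M. There the indices j of order 1/|t|
  yield the lower bound V (M |t|)^(d/2); for d = 1 this grows like a square root, while sqrt a_N |t|
  is of order sqrt V M |t|. The majorant exp (C - c sqrt |u|) is still integrable.

  M = o(L^2) means that up to the effective cutoff j of order M the spread sqrt j of the walk stays
  far below L, so the other lattice points change the k = 0 term by at most a constant
  factor.\<close>

lemma
  fixes f :: "'d::finite \<Rightarrow> real \<Rightarrow> 'b::{real_normed_field,banach,second_countable_topology}"
  assumes f: "\<And>i. integrable lborel (f i)"
  shows integrable_prod_coords: "integrable lborel (\<lambda>x::real^'d. \<Prod>i\<in>UNIV. f i (x $ i))"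
    and integral_prod_coords:
      "(\<integral>x. (\<Prod>i\<in>UNIV. f i ((x::real^'d) $ i)) \<partial>lborel) = (\<Prod>i\<in>UNIV. \<integral>t. f i t \<partial>lborel)"
proof -
  interpret product_sigma_finite "\<lambda>_::real^'d. lborel :: real measure"
    by standard
  have inj: "inj (\<lambda>i::'d. axis i (1::real))"
    by (auto simp: inj_on_def axis_eq_axis)
  \<comment> \<open>\<open>lborel\<close> is a pushforward of a product indexed by the set
    \<open>Basis\<close>, so the family indexed by coordinates is transported along the injection
    \<open>\<lambda>i. axis i 1\<close>.\<close>
  define F where "F b = f (inv (\<lambda>i. axis i (1::real)) b)" for b :: "real^'d"
  have F_axis: "F (axis i 1) = f i" for i
    unfolding F_def using inv_f_f[OF inj] by simp
  have Basis: "(Basis :: (real^'d) set) = range (\<lambda>i. axis i 1)"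
    by (auto simp: Basis_vec_def)
  have prod_eq: "(\<Prod>b\<in>Basis. h b) = (\<Prod>i\<in>UNIV. h (axis i 1))" for h :: "real^'d \<Rightarrow> 'b"
    unfolding Basis by (subst prod.reindex[OF inj]) simp
  have comp: "(\<Prod>i\<in>UNIV. f i ((\<Sum>b\<in>Basis. x b *\<^sub>R b) $ i)) = (\<Prod>b\<in>Basis. F b (x b))"
    for x :: "real^'d \<Rightarrow> real"
  proof -
    have "(\<Sum>b\<in>Basis. x b *\<^sub>R b) $ i = x (axis i 1)" for i
    proof -
      have "(\<Sum>b\<in>Basis. x b *\<^sub>R b) $ i = (\<Sum>b\<in>Basis. x b *\<^sub>R b) \<bullet> axis i 1"
        by (simp add: inner_axis)
      also have "\<dots> = x (axis i 1)"
        by (rule inner_sum_left_Basis) (auto simp: Basis)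
      finally show ?thesis .
    qed
    thus ?thesis by (simp add: prod_eq F_axis del: sum_component)
  qed
  have Fint: "integrable lborel (F b)" for b
    unfolding F_def by (rule f)
  have [measurable]: "f i \<in> borel_measurable borel" for i
    using f[of i] by auto
  have [measurable]: "(\<lambda>x::real^'d. \<Prod>i\<in>UNIV. f i (x $ i)) \<in> borel_measurable borel"
    by measurable
  have mT [measurable]: "(\<lambda>f. \<Sum>b\<in>Basis. f b *\<^sub>R b) \<in> (\<Pi>\<^sub>M b\<in>(Basis :: (real^'d) set). lborel) \<rightarrow>\<^sub>M borel"
    by measurable
  show "integrable lborel (\<lambda>x::real^'d. \<Prod>i\<in>UNIV. f i (x $ i))"
    by (subst lborel_eq, subst integrable_distr_eq)
       (auto simp: comp simp del: sum_component intro!: product_integrable_prod Fint)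
  show "(\<integral>x. (\<Prod>i\<in>UNIV. f i ((x::real^'d) $ i)) \<partial>lborel) = (\<Prod>i\<in>UNIV. \<integral>t. f i t \<partial>lborel)"
  proof -
    have "(\<integral>x. (\<Prod>i\<in>UNIV. f i ((x::real^'d) $ i)) \<partial>lborel) = (\<Prod>b\<in>Basis. \<integral>t. F b t \<partial>lborel)"
      by (subst lborel_eq, subst integral_distr)
         (auto simp: comp product_integral_prod Fint simp del: sum_component)
    thus ?thesis by (simp add: prod_eq F_axis)
  qed
qed

lemma borel_measurable_cis [measurable]:
  "f \<in> borel_measurable M \<Longrightarrow> (\<lambda>x. cis (f x)) \<in> borel_measurable M"
  by (rule borel_measurable_continuous_on[OF _ , of cis]) (auto intro!: continuous_intros)

text \<open>For s = 1 this is the characteristic function of the standard normal distribution;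
  general s follows by the substitution t to s t.\<close>

lemma integrable_gauss_1d: "s > 0 \<Longrightarrow> integrable lborel (\<lambda>t::real. exp (- (s * t)\<^sup>2 / 2))"
  and integral_gauss_cis_1d: "s > 0 \<Longrightarrow>
    (\<integral>t. of_real (exp (- (s * t)\<^sup>2 / 2)) * cis (x * t) \<partial>lborel)
      = complex_of_real (sqrt (2 * pi) / s * exp (- (x / s)\<^sup>2 / 2))"
proof -
  have eq: "exp (- t\<^sup>2 / 2) = sqrt (2 * pi) * std_normal_density t" for t
    by (simp add: std_normal_density_def real_sqrt_mult)
  assume s: "s > 0"
  have i1: "integrable lborel (\<lambda>t::real. exp (- t\<^sup>2 / 2))"
    unfolding eq by simp
  show "integrable lborel (\<lambda>t::real. exp (- (s * t)\<^sup>2 / 2))"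
    using lborel_integrable_real_affine[OF i1, of s 0] s by simp
  have "(\<integral>t. of_real (exp (- t\<^sup>2 / 2)) * cis (y * t) \<partial>lborel)
          = complex_of_real (sqrt (2 * pi) * exp (- y\<^sup>2 / 2))" for y
  proof -
    have "complex_of_real (exp (- y\<^sup>2 / 2)) = char std_normal_distribution y"
      by (simp add: char_std_normal_distribution)
    also have "\<dots> = (\<integral>t. std_normal_density t *\<^sub>R iexp (y * t) \<partial>lborel)"
      unfolding char_def by (subst integral_density) (auto simp: normal_density_nonneg)
    finally have *: "complex_of_real (exp (- y\<^sup>2 / 2)) = \<dots>" .
    show ?thesis
      unfolding of_real_mult * integral_mult_right_zero[symmetric]
      by (intro Bochner_Integration.integral_cong) (auto simp: std_normal_density_def cis_conv_exp scaleR_conv_of_real real_sqrt_mult)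
  qed
  from this[of "x / s"]
  have "(\<integral>t. of_real (exp (- t\<^sup>2 / 2)) * cis (x / s * t) \<partial>lborel)
          = complex_of_real (sqrt (2 * pi) * exp (- (x / s)\<^sup>2 / 2))" .
  also have "(\<integral>t. of_real (exp (- t\<^sup>2 / 2)) * cis (x / s * t) \<partial>lborel)
     = s * (\<integral>t. of_real (exp (- (s * t)\<^sup>2 / 2)) * cis (x * t) \<partial>lborel)"
    using s by (subst lborel_integral_real_affine[where c = s and t = 0]) (auto simp: scaleR_conv_of_real)
  finally show "(\<integral>t. of_real (exp (- (s * t)\<^sup>2 / 2)) * cis (x * t) \<partial>lborel)
      = complex_of_real (sqrt (2 * pi) / s * exp (- (x / s)\<^sup>2 / 2))"
    using s by (simp add: field_simps)
qed

lemma norm_vec_power2: "(norm (x::real^'d))\<^sup>2 = (\<Sum>i\<in>UNIV. (x $ i)\<^sup>2)"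
  unfolding power2_norm_eq_inner inner_vec_def by (simp add: power2_eq_square)

lemma cis_sum: "cis (\<Sum>i\<in>A. f i) = (\<Prod>i\<in>A. cis (f i))"
  by (induction A rule: infinite_finite_induct) (auto simp: cis_mult[symmetric])

lemma
  fixes x :: "real^'d"
  assumes s: "s > 0"
  shows integrable_gauss: "integrable lborel (\<lambda>\<xi>::real^'d. exp (- (s * norm \<xi>)\<^sup>2 / 2))"
    and integral_gauss_cis: "(\<integral>\<xi>. of_real (exp (- (s * norm \<xi>)\<^sup>2 / 2)) * cis (x \<bullet> \<xi>) \<partial>lborel)
      = complex_of_real ((sqrt (2 * pi) / s) ^ CARD('d) * exp (- (norm x / s)\<^sup>2 / 2))"
proof -
  have e: "exp (- (s * norm \<xi>)\<^sup>2 / 2) = (\<Prod>i\<in>UNIV. exp (- (s * \<xi> $ i)\<^sup>2 / 2))" for \<xi> :: "real^'d" and s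
    by (simp add: exp_sum[symmetric] power_mult_distrib norm_vec_power2 sum_distrib_left sum_negf sum_divide_distrib)
  show "integrable lborel (\<lambda>\<xi>::real^'d. exp (- (s * norm \<xi>)\<^sup>2 / 2))"
    unfolding e by (intro integrable_prod_coords integrable_gauss_1d s)
  have int: "integrable lborel (\<lambda>t. complex_of_real (exp (- (s * t)\<^sup>2 / 2)) * cis (y * t))" for y
    by (rule Bochner_Integration.integrable_bound[OF integrable_gauss_1d[OF s]])
       (auto simp: norm_mult)
  have "(\<integral>\<xi>. of_real (exp (- (s * norm \<xi>)\<^sup>2 / 2)) * cis (x \<bullet> \<xi>) \<partial>lborel)
     = (\<integral>\<xi>. (\<Prod>i\<in>UNIV. of_real (exp (- (s * (\<xi>::real^'d) $ i)\<^sup>2 / 2)) * cis (x $ i * \<xi> $ i)) \<partial>lborel)"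
    by (intro Bochner_Integration.integral_cong refl) (simp only: e inner_vec_def cis_sum prod.distrib of_real_prod inner_real_def)
  also have "\<dots> = (\<Prod>i\<in>UNIV. \<integral>t. of_real (exp (- (s * t)\<^sup>2 / 2)) * cis (x $ i * t) \<partial>lborel)"
    by (rule integral_prod_coords) (rule int)
  also have "\<dots> = (\<Prod>i\<in>(UNIV::'d set). complex_of_real (sqrt (2 * pi) / s * exp (- (x $ i / s)\<^sup>2 / 2)))"
    by (simp only: integral_gauss_cis_1d[OF s])
  also have "\<dots> = complex_of_real ((sqrt (2 * pi) / s) ^ CARD('d) * exp (- (norm x / s)\<^sup>2 / 2))"
    unfolding of_real_prod[symmetric] prod.distrib prod_constant using e[of "1/s" x] by simp
  finally show "(\<integral>\<xi>. of_real (exp (- (s * norm \<xi>)\<^sup>2 / 2)) * cis (x \<bullet> \<xi>) \<partial>lborel)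
      = complex_of_real ((sqrt (2 * pi) / s) ^ CARD('d) * exp (- (norm x / s)\<^sup>2 / 2))" .
qed

section \<open>Fourier transforms of densities\<close>

lemma
  fixes f :: "'a::euclidean_space \<Rightarrow> 'b::{banach,second_countable_topology}"
  assumes [measurable]: "f \<in> borel_measurable borel"
  shows integrable_shift_iff: "integrable lborel (\<lambda>x. f (x - y)) \<longleftrightarrow> integrable lborel f"
    and integral_shift: "(\<integral>x. f (x - y) \<partial>lborel) = integral\<^sup>L lborel f"
proof -
  have eq: "(lborel :: 'a measure) = distr lborel borel ((+) (- y))"
    by (simp add: lborel_distr_plus)
  show "integrable lborel (\<lambda>x. f (x - y)) \<longleftrightarrow> integrable lborel f"
    by (subst (2) eq, subst integrable_distr_eq) auto
  show "(\<integral>x. f (x - y) \<partial>lborel) = integral\<^sup>L lborel f"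
    by (subst (2) eq, subst integral_distr) auto
qed

lemma
  fixes f :: "'a::euclidean_space \<Rightarrow> 'b::{banach,second_countable_topology}"
  assumes [measurable]: "f \<in> borel_measurable borel" and c: "c \<noteq> 0"
  shows integrable_scale_iff: "integrable lborel (\<lambda>x. f (c *\<^sub>R x)) \<longleftrightarrow> integrable lborel f"
    and integral_scale: "\<bar>c\<bar> ^ DIM('a) *\<^sub>R (\<integral>x. f (c *\<^sub>R x) \<partial>lborel) = integral\<^sup>L lborel f"
proof -
  have eq: "(lborel :: 'a measure) = density (distr lborel borel (\<lambda>x. 0 + c *\<^sub>R x)) (\<lambda>_. \<bar>c\<bar> ^ DIM('a))"
    by (rule lborel_affine) (rule c)
  have eq': "(lborel :: 'a measure) = density (distr lborel borel (\<lambda>x. c *\<^sub>R x)) (\<lambda>_. ennreal (\<bar>c\<bar> ^ DIM('a)))"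
    by (subst eq) simp
  have "integrable lborel f \<longleftrightarrow> integrable lborel (\<lambda>x. \<bar>c\<bar> ^ DIM('a) *\<^sub>R f (c *\<^sub>R x))"
    by (subst eq', subst integrable_density, (auto simp: c integrable_distr_eq)[3])
       (auto simp: c integrable_distr_eq)
  also have "\<dots> \<longleftrightarrow> integrable lborel (\<lambda>x. f (c *\<^sub>R x))"
    using integrable_scaleR_right[of "1 / \<bar>c\<bar> ^ DIM('a)" lborel "\<lambda>x. \<bar>c\<bar> ^ DIM('a) *\<^sub>R f (c *\<^sub>R x)"] c
    by auto
  finally show "integrable lborel (\<lambda>x. f (c *\<^sub>R x)) \<longleftrightarrow> integrable lborel f" ..
  show "\<bar>c\<bar> ^ DIM('a) *\<^sub>R (\<integral>x. f (c *\<^sub>R x) \<partial>lborel) = integral\<^sup>L lborel f"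
    by (subst (2) eq', subst integral_density, (auto simp: c integral_distr)[3])
       (auto simp: c integral_distr)
qed

lemma integrable_pair_mult:
  fixes f :: "'a::euclidean_space \<Rightarrow> 'c::{real_normed_field,banach,second_countable_topology}"
    and g :: "'b::euclidean_space \<Rightarrow> 'c"
  assumes f: "integrable lborel f" and g: "integrable lborel g"
  shows "integrable (lborel \<Otimes>\<^sub>M lborel) (\<lambda>(x, y). f x * g y)"
proof -
  have [measurable]: "f \<in> borel_measurable borel" "g \<in> borel_measurable borel"
    using f g by auto
  show ?thesis
    by (rule lborel_pair.Fubini_integrable)
       (use f g in \<open>auto simp: norm_mult intro!: integrable_mult_left\<close>)
qed

text \<open>The class is closed under convolution and reflection. Continuity together with
  boundedness is what makes the Gaussian-regularised inversion integral converge to the value at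
  0.\<close>

definition nice_density :: "(real^'d \<Rightarrow> real) \<Rightarrow> bool" where
  "nice_density f \<longleftrightarrow> (\<forall>x. 0 \<le> f x) \<and> continuous_on UNIV f \<and> bounded (range f) \<and>
     integrable lborel f \<and> (\<integral>x. f x \<partial>lborel) = 1"

text \<open>The characteristic function of the density: there is no 2 pi in the exponent, so a
  factor (2 pi)^d appears in the inversion formula.\<close>

definition ft :: "(real^'d \<Rightarrow> real) \<Rightarrow> real^'d \<Rightarrow> complex" where
  "ft f \<xi> = (\<integral>x. of_real (f x) * cis (\<xi> \<bullet> x) \<partial>lborel)"

lemma nice_densityD:
  assumes "nice_density f"
  shows "0 \<le> f x" "continuous_on UNIV f" "integrable lborel f" "(\<integral>x. f x \<partial>lborel) = 1"
    "f \<in> borel_measurable borel"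
  using assms by (auto simp: nice_density_def intro: borel_measurable_continuous_onI)

lemma nice_density_bound:
  assumes "nice_density f"
  obtains B where "B > 0" "\<And>x. f x \<le> B"
proof -
  from assms obtain B where B: "B > 0" "\<And>x. norm (f x) \<le> B"
    unfolding nice_density_def bounded_pos by auto
  show ?thesis by (rule that[of B]) (use B in \<open>auto intro: order_trans[OF abs_ge_self]\<close>)
qed

lemma integrable_ft_integrand:
  assumes "integrable lborel f"
  shows "integrable lborel (\<lambda>x. complex_of_real (f x) * cis (\<xi> \<bullet> x))"
proof -
  have [measurable]: "f \<in> borel_measurable borel" using assms by auto
  show ?thesis
    by (rule Bochner_Integration.integrable_bound[OF assms]) (auto simp: norm_mult)
qed

lemma measurable_ft [measurable]:
  assumes [measurable]: "f \<in> borel_measurable borel"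
  shows "ft f \<in> borel_measurable borel"
  unfolding ft_def by measurable

lemma norm_ft_le:
  assumes "nice_density f"
  shows "norm (ft f \<xi>) \<le> 1"
proof -
  have "norm (ft f \<xi>) \<le> (\<integral>x. norm (complex_of_real (f x) * cis (\<xi> \<bullet> x)) \<partial>lborel)"
    unfolding ft_def by (rule integral_norm_bound)
  also have "\<dots> = 1"
    using nice_densityD[OF assms] by (simp add: norm_mult)
  finally show ?thesis .
qed

section \<open>Convolution of densities and its Fourier transform\<close>

lemma integrable_conv_integrand:
  assumes f: "nice_density f" and g: "nice_density g"
  shows "integrable (lborel \<Otimes>\<^sub>M lborel) (\<lambda>(y, x). f y * g (x - y))"
proof -
  note [measurable] = nice_densityD(5)[OF f] nice_densityD(5)[OF g]
  show ?thesis
  proof (rule lborel_pair.Fubini_integrable)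
    show "integrable lborel (\<lambda>y. \<integral>x. norm (case (y, x) of (y, x) \<Rightarrow> f y * g (x - y)) \<partial>lborel)"
      using nice_densityD[OF f] nice_densityD[OF g]
      by (simp add: abs_mult integral_shift[where f = g])
    show "AE y in lborel. integrable lborel (\<lambda>x. case (y, x) of (y, x) \<Rightarrow> f y * g (x - y))"
      using nice_densityD[OF g]
      by (auto simp: integrable_shift_iff[where f = g] intro!: integrable_mult_right)
  qed measurable
qed

text \<open>Fubini followed by the translation x = y + z. With h = 1 it gives the total mass of a
  convolution, with h a character its Fourier transform.\<close>

lemma integral_conv_mult:
  fixes h :: "real^'d \<Rightarrow> complex"
  assumes f: "nice_density f" and g: "nice_density g"
    and [measurable]: "h \<in> borel_measurable borel" and h: "\<And>x. norm (h x) \<le> B"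
  shows "integrable lborel (\<lambda>x. of_real (conv f g x) * h x)"
    and "(\<integral>x. of_real (conv f g x) * h x \<partial>lborel)
      = (\<integral>y. of_real (f y) * (\<integral>z. of_real (g z) * h (y + z) \<partial>lborel) \<partial>lborel)"
proof -
  note [measurable] = nice_densityD(5)[OF f] nice_densityD(5)[OF g]
  have int: "integrable (lborel \<Otimes>\<^sub>M lborel) (\<lambda>(y, x). of_real (f y * g (x - y)) * h x)"
    by (rule Bochner_Integration.integrable_bound[OF integrable_mult_right[OF integrable_conv_integrand[OF f g], of B]])
       (use h nice_densityD(1)[OF f] nice_densityD(1)[OF g] in
          \<open>auto simp: norm_mult abs_mult mult.commute[of _ "norm _"] intro!: AE_I2 mult_right_mono mult_nonneg_nonneg order_trans[OF h abs_ge_self]\<close>)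
  have eq: "(\<integral>y. of_real (f y * g (x - y)) * h x \<partial>lborel) = of_real (conv f g x) * h x" for x
    by (simp only: integral_mult_left_zero integral_complex_of_real conv_def)
  show "integrable lborel (\<lambda>x. of_real (conv f g x) * h x)"
    using lborel_pair.integrable_snd[OF int] by (simp only: eq prod.case)
  have "(\<integral>x. of_real (conv f g x) * h x \<partial>lborel)
      = (\<integral>x. (\<integral>y. of_real (f y * g (x - y)) * h x \<partial>lborel) \<partial>lborel)"
    by (simp only: eq)
  also have "\<dots> = (\<integral>y. (\<integral>x. of_real (f y * g (x - y)) * h x \<partial>lborel) \<partial>lborel)"
    by (rule lborel_pair.Fubini_integral) (rule int)
  also have "\<dots> = (\<integral>y. of_real (f y) * (\<integral>z. of_real (g z) * h (y + z) \<partial>lborel) \<partial>lborel)"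
  proof (rule Bochner_Integration.integral_cong[OF refl])
    fix y
    have "(\<integral>x. of_real (f y * g (x - y)) * h x \<partial>lborel)
        = of_real (f y) * (\<integral>x. of_real (g (x - y)) * h (y + (x - y)) \<partial>lborel)"
      by (simp add: mult.assoc)
    also have "(\<integral>x. of_real (g (x - y)) * h (y + (x - y)) \<partial>lborel) = (\<integral>z. of_real (g z) * h (y + z) \<partial>lborel)"
      by (rule integral_shift) measurable
    finally show "(\<integral>x. of_real (f y * g (x - y)) * h x \<partial>lborel)
        = of_real (f y) * (\<integral>z. of_real (g z) * h (y + z) \<partial>lborel)" .
  qed
  finally show "(\<integral>x. of_real (conv f g x) * h x \<partial>lborel)
      = (\<integral>y. of_real (f y) * (\<integral>z. of_real (g z) * h (y + z) \<partial>lborel) \<partial>lborel)" .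
qed

lemma nice_density_conv:
  assumes f: "nice_density f" and g: "nice_density g"
  shows "nice_density (conv f g)"
proof -
  note [measurable] = nice_densityD(5)[OF f] nice_densityD(5)[OF g]
  note F = nice_densityD[OF f] and G = nice_densityD[OF g]
  obtain B where B: "B > 0" "\<And>x. g x \<le> B" using nice_density_bound[OF g] by blast
  have int: "integrable lborel (\<lambda>y. f y * g (x - y))" for x
    by (rule Bochner_Integration.integrable_bound[OF integrable_mult_left[OF F(3), of B]])
       (use B F(1) G(1) in \<open>auto simp: abs_mult intro!: AE_I2 mult_left_mono\<close>)
  have nonneg: "0 \<le> conv f g x" for x
    unfolding conv_def using F(1) G(1) by (auto intro!: Bochner_Integration.integral_nonneg)
  have le: "conv f g x \<le> B" for x
  proof -
    have "conv f g x \<le> (\<integral>y. f y * B \<partial>lborel)"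
      unfolding conv_def using F G B by (intro integral_mono int) (auto intro!: mult_left_mono)
    thus ?thesis using F by simp
  qed
  have cont: "continuous_on UNIV (conv f g)"
  proof (rule continuous_on_sequentiallyI)
    fix u a assume u: "u \<longlonglongrightarrow> (a :: real^'a)"
    have "(\<lambda>n. \<integral>y. f y * g (u n - y) \<partial>lborel) \<longlonglongrightarrow> (\<integral>y. f y * g (a - y) \<partial>lborel)"
    proof (rule integral_dominated_convergence[where w = "\<lambda>y. f y * B"])
      show "AE y in lborel. (\<lambda>n. f y * g (u n - y)) \<longlonglongrightarrow> f y * g (a - y)"
      proof (intro AE_I2 tendsto_mult tendsto_const)
        fix y
        have "isCont g (a - y)" using G(2) by (simp add: continuous_on_eq_continuous_at)
        moreover have "(\<lambda>n. u n - y) \<longlonglongrightarrow> a - y" by (intro tendsto_intros u)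
        ultimately show "(\<lambda>n. g (u n - y)) \<longlonglongrightarrow> g (a - y)" by (rule isCont_tendsto_compose)
      qed
    qed (use F G B in \<open>auto simp: abs_mult intro!: mult_left_mono\<close>)
    thus "(\<lambda>n. conv f g (u n)) \<longlonglongrightarrow> conv f g a" by (simp add: conv_def)
  qed
  have i: "integrable lborel (conv f g)"
    using integral_conv_mult(1)[OF f g, of "\<lambda>_. 1" 1] by (simp add: complex_of_real_integrable_eq)
  have "complex_of_real (\<integral>x. conv f g x \<partial>lborel) = 1"
    using integral_conv_mult(2)[OF f g, of "\<lambda>_. 1" 1] F(4) G(4) by simp
  hence "(\<integral>x. conv f g x \<partial>lborel) = 1" by (simp only: of_real_eq_1_iff)
  thus ?thesis
    unfolding nice_density_def using nonneg le cont i
    by (auto intro!: boundedI[where B = B])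
qed

lemma ft_conv:
  assumes f: "nice_density f" and g: "nice_density g"
  shows "ft (conv f g) \<xi> = ft f \<xi> * ft g \<xi>"
proof -
  have "ft (conv f g) \<xi> = (\<integral>y. of_real (f y) * (\<integral>z. of_real (g z) * cis (\<xi> \<bullet> (y + z)) \<partial>lborel) \<partial>lborel)"
    unfolding ft_def by (rule integral_conv_mult(2)[OF f g, where B = 1]) auto
  also have "\<dots> = (\<integral>y. (of_real (f y) * cis (\<xi> \<bullet> y)) * ft g \<xi> \<partial>lborel)"
  proof (rule Bochner_Integration.integral_cong[OF refl])
    fix y
    have "(\<integral>z. of_real (g z) * cis (\<xi> \<bullet> (y + z)) \<partial>lborel) = (\<integral>z. cis (\<xi> \<bullet> y) * (of_real (g z) * cis (\<xi> \<bullet> z)) \<partial>lborel)"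
      by (simp add: inner_add_right cis_mult[symmetric] mult_ac)
    also have "\<dots> = cis (\<xi> \<bullet> y) * ft g \<xi>" unfolding ft_def by simp
    finally show "of_real (f y) * (\<integral>z. of_real (g z) * cis (\<xi> \<bullet> (y + z)) \<partial>lborel)
       = (of_real (f y) * cis (\<xi> \<bullet> y)) * ft g \<xi>" by simp
  qed
  also have "\<dots> = ft f \<xi> * ft g \<xi>"
    unfolding ft_def[of f] by simp
  finally show ?thesis .
qed

lemma
  assumes f: "nice_density f"
  shows nice_density_conv_power: "nice_density (conv_power f (Suc n))"
    and ft_conv_power: "ft (conv_power f (Suc n)) \<xi> = ft f \<xi> ^ Suc n"
proof (induction n)
  case 0
  { case 1 show ?case using f by simp }
  { case 2 show ?case by simp }
next
  case (Suc n)
  { case 1 show ?case using nice_density_conv[OF f Suc(1)] by simp }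
  { case 2 show ?case using ft_conv[OF f Suc(1)] Suc(2) by simp }
qed

text \<open>Fubini moves the Fourier transform from f onto the Gaussian, where it is explicit. The
  substitution x = s z then shows f only near the origin when s is small.\<close>

lemma integral_gauss_ft:
  fixes f :: "real^'d \<Rightarrow> real"
  assumes f: "nice_density f" and s: "s > 0"
  shows "integrable lborel (\<lambda>\<xi>. of_real (exp (- (s * norm \<xi>)\<^sup>2 / 2)) * ft f \<xi>)"
    and "(\<integral>\<xi>. of_real (exp (- (s * norm \<xi>)\<^sup>2 / 2)) * ft f \<xi> \<partial>lborel)
      = of_real (sqrt (2 * pi) ^ CARD('d) * (\<integral>z. f (s *\<^sub>R z) * exp (- (norm z)\<^sup>2 / 2) \<partial>lborel))"
proof -
  note [measurable] = nice_densityD(5)[OF f]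
  note F = nice_densityD[OF f]
  define g where "g = (\<lambda>\<xi>::real^'d. exp (- (s * norm \<xi>)\<^sup>2 / 2))"
  have [measurable]: "g \<in> borel_measurable borel" unfolding g_def by measurable
  have g: "integrable lborel g" unfolding g_def by (rule integrable_gauss[OF s])
  have int: "integrable (lborel \<Otimes>\<^sub>M lborel) (\<lambda>(\<xi>, x). of_real (g \<xi>) * (of_real (f x) * cis (\<xi> \<bullet> x)))"
    by (rule Bochner_Integration.integrable_bound[OF integrable_pair_mult[OF g F(3)]])
       (auto simp: norm_mult)
  have eq1: "(\<integral>x. of_real (g \<xi>) * (of_real (f x) * cis (\<xi> \<bullet> x)) \<partial>lborel) = of_real (g \<xi>) * ft f \<xi>" for \<xi>
    unfolding ft_def by simp
  have "integrable lborel (\<lambda>\<xi>. of_real (g \<xi>) * ft f \<xi>)"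
    using lborel_pair.integrable_fst[OF int] by (simp only: eq1 prod.case)
  thus "integrable lborel (\<lambda>\<xi>. of_real (exp (- (s * norm \<xi>)\<^sup>2 / 2)) * ft f \<xi>)"
    by (simp add: g_def)
  have eq2: "(\<integral>\<xi>. of_real (g \<xi>) * (of_real (f x) * cis (\<xi> \<bullet> x)) \<partial>lborel)
     = of_real (f x * ((sqrt (2 * pi) / s) ^ CARD('d) * exp (- (norm x / s)\<^sup>2 / 2)))" for x
  proof -
    have "(\<integral>\<xi>. of_real (g \<xi>) * (of_real (f x) * cis (\<xi> \<bullet> x)) \<partial>lborel)
       = (\<integral>\<xi>. of_real (f x) * (of_real (g \<xi>) * cis (x \<bullet> \<xi>)) \<partial>lborel)"
      by (intro Bochner_Integration.integral_cong) (auto simp: inner_commute)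
    also have "\<dots> = of_real (f x) * (\<integral>\<xi>. of_real (g \<xi>) * cis (x \<bullet> \<xi>) \<partial>lborel)"
      by simp
    also have "(\<integral>\<xi>. of_real (g \<xi>) * cis (x \<bullet> \<xi>) \<partial>lborel) =
        complex_of_real ((sqrt (2 * pi) / s) ^ CARD('d) * exp (- (norm x / s)\<^sup>2 / 2))"
      unfolding g_def by (rule integral_gauss_cis[OF s])
    finally show ?thesis by simp
  qed
  have "(\<integral>\<xi>. of_real (g \<xi>) * ft f \<xi> \<partial>lborel)
      = (\<integral>\<xi>. \<integral>x. of_real (g \<xi>) * (of_real (f x) * cis (\<xi> \<bullet> x)) \<partial>lborel \<partial>lborel)"
    by (simp only: eq1)
  also have "\<dots> = (\<integral>x. \<integral>\<xi>. of_real (g \<xi>) * (of_real (f x) * cis (\<xi> \<bullet> x)) \<partial>lborel \<partial>lborel)"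
    by (rule lborel_pair.Fubini_integral[OF int, symmetric])
  also have "\<dots> = (\<integral>x. complex_of_real (f x * ((sqrt (2 * pi) / s) ^ CARD('d) * exp (- (norm x / s)\<^sup>2 / 2))) \<partial>lborel)"
    by (simp only: eq2)
  also have "\<dots> = of_real (\<integral>x. (sqrt (2 * pi) / s) ^ CARD('d) * (f x * exp (- (norm x / s)\<^sup>2 / 2)) \<partial>lborel)"
    by (subst integral_complex_of_real) (simp add: mult_ac)
  also have "(\<integral>x. (sqrt (2 * pi) / s) ^ CARD('d) * (f x * exp (- (norm x / s)\<^sup>2 / 2)) \<partial>lborel)
      = (sqrt (2 * pi) / s) ^ CARD('d) * (\<integral>x. f x * exp (- (norm x / s)\<^sup>2 / 2) \<partial>lborel)"
    by (rule integral_mult_right_zero)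
  also have "(\<integral>x. f x * exp (- (norm x / s)\<^sup>2 / 2) \<partial>lborel)
      = \<bar>s\<bar> ^ DIM(real^'d) *\<^sub>R (\<integral>z. f (s *\<^sub>R z) * exp (- (norm (s *\<^sub>R z) / s)\<^sup>2 / 2) \<partial>lborel)"
    by (rule integral_scale[symmetric]) (use s in auto)
  also have "(sqrt (2 * pi) / s) ^ CARD('d) * (\<bar>s\<bar> ^ DIM(real^'d) *\<^sub>R (\<integral>z. f (s *\<^sub>R z) * exp (- (norm (s *\<^sub>R z) / s)\<^sup>2 / 2) \<partial>lborel))
      = sqrt (2 * pi) ^ CARD('d) * (\<integral>z. f (s *\<^sub>R z) * exp (- (norm z)\<^sup>2 / 2) \<partial>lborel)"
    using s by (simp add: power_divide)
  finally show "(\<integral>\<xi>. of_real (exp (- (s * norm \<xi>)\<^sup>2 / 2)) * ft f \<xi> \<partial>lborel)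
      = of_real (sqrt (2 * pi) ^ CARD('d) * (\<integral>z. f (s *\<^sub>R z) * exp (- (norm z)\<^sup>2 / 2) \<partial>lborel))"
    by (simp add: g_def)
qed

lemma integral_gauss:
  "(\<integral>z. exp (- (norm (z::real^'d))\<^sup>2 / 2) \<partial>lborel) = sqrt (2 * pi) ^ CARD('d)"
  using integral_gauss_cis[of 1 "0::real^'d"] by (simp flip: of_real_power)

text \<open>Gaussian summability: let s tend to 0 in \<open>integral_gauss_ft\<close>. The frequency
  side converges because \<open>ft f\<close> is integrable, the space side because f is bounded and
  continuous at 0.\<close>

lemma fourier_inversion_at_0:
  fixes f :: "real^'d \<Rightarrow> real"
  assumes f: "nice_density f" and int: "integrable lborel (ft f)"
  shows "(\<integral>\<xi>. ft f \<xi> \<partial>lborel) = of_real ((2 * pi) ^ CARD('d) * f 0)"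
proof -
  note [measurable] = nice_densityD(5)[OF f]
  note F = nice_densityD[OF f]
  obtain B where B: "B > 0" "\<And>x. f x \<le> B" using nice_density_bound[OF f] by blast
  define s where "s n = 1 / real (Suc n)" for n
  have s: "s n > 0" for n by (simp add: s_def)
  have s0: "s \<longlonglongrightarrow> 0" unfolding s_def by (rule LIMSEQ_inverse_real_of_nat[unfolded inverse_eq_divide])
  have "(\<lambda>n. \<integral>\<xi>. of_real (exp (- (s n * norm \<xi>)\<^sup>2 / 2)) * ft f \<xi> \<partial>lborel) \<longlonglongrightarrow> (\<integral>\<xi>. ft f \<xi> \<partial>lborel)"
  proof (rule integral_dominated_convergence[where w = "\<lambda>\<xi>. norm (ft f \<xi>)"])
    show "AE \<xi> in lborel. (\<lambda>n. of_real (exp (- (s n * norm \<xi>)\<^sup>2 / 2)) * ft f \<xi>) \<longlonglongrightarrow> ft f \<xi>"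
    proof (rule AE_I2)
      fix \<xi> :: "real^'d"
      have "(\<lambda>n. of_real (exp (- (s n * norm \<xi>)\<^sup>2 / 2)) * ft f \<xi>) \<longlonglongrightarrow> of_real (exp (- (0 * norm \<xi>)\<^sup>2 / 2)) * ft f \<xi>"
        by (intro tendsto_intros s0) simp_all
      thus "(\<lambda>n. of_real (exp (- (s n * norm \<xi>)\<^sup>2 / 2)) * ft f \<xi>) \<longlonglongrightarrow> ft f \<xi>" by simp
    qed
  qed (use int in \<open>auto simp: norm_mult intro!: mult_left_le_one_le\<close>)
  moreover have "(\<lambda>n. \<integral>z. f (s n *\<^sub>R z) * exp (- (norm z)\<^sup>2 / 2) \<partial>lborel)
       \<longlonglongrightarrow> (\<integral>z. f 0 * exp (- (norm (z::real^'d))\<^sup>2 / 2) \<partial>lborel)"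
  proof (rule integral_dominated_convergence[where w = "\<lambda>z. B * exp (- (norm z)\<^sup>2 / 2)"])
    show "integrable lborel (\<lambda>z::real^'d. B * exp (- (norm z)\<^sup>2 / 2))"
      using integrable_gauss[of 1, where 'd = 'd] by simp
    show "AE z in lborel. (\<lambda>n. f (s n *\<^sub>R z) * exp (- (norm z)\<^sup>2 / 2)) \<longlonglongrightarrow> f 0 * exp (- (norm z)\<^sup>2 / 2)"
    proof (intro AE_I2 tendsto_mult tendsto_const)
      fix z :: "real^'d"
      have "isCont f 0" using F(2) by (simp add: continuous_on_eq_continuous_at)
      moreover have "(\<lambda>n. s n *\<^sub>R z) \<longlonglongrightarrow> 0" using tendsto_scaleR[OF s0 tendsto_const[of z]] by simp
      ultimately show "(\<lambda>n. f (s n *\<^sub>R z)) \<longlonglongrightarrow> f 0" by (rule isCont_tendsto_compose)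
    qed
  qed (use F B in \<open>auto simp: abs_mult\<close>)
  hence "(\<lambda>n. complex_of_real (sqrt (2 * pi) ^ CARD('d) * (\<integral>z. f (s n *\<^sub>R z) * exp (- (norm z)\<^sup>2 / 2) \<partial>lborel)))
      \<longlonglongrightarrow> of_real (sqrt (2 * pi) ^ CARD('d) * (f 0 * sqrt (2 * pi) ^ CARD('d)))"
    by (intro tendsto_intros) (simp add: integral_gauss[simplified])
  ultimately have "(\<integral>\<xi>. ft f \<xi> \<partial>lborel) = of_real (sqrt (2 * pi) ^ CARD('d) * (f 0 * sqrt (2 * pi) ^ CARD('d)))"
    unfolding integral_gauss_ft(2)[OF f s] by (rule LIMSEQ_unique)
  also have "sqrt (2 * pi) ^ CARD('d) * (f 0 * sqrt (2 * pi) ^ CARD('d)) = (sqrt (2 * pi) * sqrt (2 * pi)) ^ CARD('d) * f 0"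
    by (simp only: power_mult_distrib mult_ac)
  also have "sqrt (2 * pi) * sqrt (2 * pi) = 2 * pi" by (simp del: real_sqrt_mult)
  finally show ?thesis .
qed

lemma nice_density_reflect:
  assumes f: "nice_density f"
  shows "nice_density (\<lambda>x. f (- x))" and "ft (\<lambda>x. f (- x)) \<xi> = cnj (ft f \<xi>)"
proof -
  note [measurable] = nice_densityD(5)[OF f]
  note F = nice_densityD[OF f]
  have "continuous_on UNIV (\<lambda>x. f (- x))"
    by (rule continuous_on_compose2[OF F(2)]) (auto intro: continuous_intros)
  moreover have "range (\<lambda>x. f (- x)) = range f"
    using surj_uminus by (metis fun.set_map image_image)
  moreover have "integrable lborel (\<lambda>x. f (- x))" "(\<integral>x. f (- x) \<partial>lborel) = 1"
    using integrable_scale_iff[of f "-1"] integral_scale[of f "-1"] F by auto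
  ultimately show "nice_density (\<lambda>x. f (- x))"
    using f by (auto simp: nice_density_def)
  have "ft (\<lambda>x. f (- x)) \<xi> = (\<integral>x. of_real (f x) * cis (- (\<xi> \<bullet> x)) \<partial>lborel)"
    using integral_scale[of "\<lambda>x. of_real (f x) * cis (- (\<xi> \<bullet> x))" "-1"] by (simp add: ft_def)
  also have "\<dots> = (\<integral>x. cnj (of_real (f x) * cis (\<xi> \<bullet> x)) \<partial>lborel)"
    by (simp add: cis_cnj)
  also have "\<dots> = cnj (ft f \<xi>)" unfolding ft_def
    by (rule integral_bounded_linear[OF bounded_linear_cnj integrable_ft_integrand]) (rule F)
  finally show "ft (\<lambda>x. f (- x)) \<xi> = cnj (ft f \<xi>)" .
qed

(* |ft f|^2 is the transform of the density f * f(-x), so its Gaussian-damped integrals are bounded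
   by the supremum of that density. *)
lemma integrable_ft_square:
  fixes f :: "real^'d \<Rightarrow> real"
  assumes f: "nice_density f"
  shows "integrable lborel (\<lambda>\<xi>. (norm (ft f \<xi>))\<^sup>2)"
proof -
  note [measurable] = nice_densityD(5)[OF f]
  define g where "g = conv f (\<lambda>x. f (- x))"
  have g: "nice_density g"
    unfolding g_def by (intro nice_density_conv f nice_density_reflect)
  have ftg: "ft g \<xi> = of_real ((norm (ft f \<xi>))\<^sup>2)" for \<xi>
    unfolding g_def
    by (simp add: ft_conv[OF f nice_density_reflect(1)[OF f]] nice_density_reflect(2)[OF f] complex_norm_square flip: of_real_power)
  obtain B where B: "B > 0" "\<And>x. g x \<le> B" using nice_density_bound[OF g] by blast
  note [measurable] = nice_densityD(5)[OF g]
  define C where "C = sqrt (2 * pi) ^ CARD('d) * (B * sqrt (2 * pi) ^ CARD('d))"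
  define s where "s n = 1 / real (Suc n)" for n
  have s: "s n > 0" for n by (simp add: s_def)
  have s0: "s \<longlonglongrightarrow> 0" unfolding s_def by (rule LIMSEQ_inverse_real_of_nat[unfolded inverse_eq_divide])
  have bnd: "(\<integral>\<^sup>+\<xi>. ennreal (exp (- (s n * norm \<xi>)\<^sup>2 / 2) * (norm (ft f \<xi>))\<^sup>2) \<partial>lborel) \<le> ennreal C" for n
  proof -
    have "integrable lborel (\<lambda>\<xi>. complex_of_real (exp (- (s n * norm \<xi>)\<^sup>2 / 2) * (norm (ft f \<xi>))\<^sup>2))"
      using integral_gauss_ft(1)[OF g s[of n]] by (simp add: ftg)
    hence i: "integrable lborel (\<lambda>\<xi>. exp (- (s n * norm \<xi>)\<^sup>2 / 2) * (norm (ft f \<xi>))\<^sup>2)"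
      by (simp only: complex_of_real_integrable_eq)
    have "complex_of_real (\<integral>\<xi>. exp (- (s n * norm \<xi>)\<^sup>2 / 2) * (norm (ft f \<xi>))\<^sup>2 \<partial>lborel)
       = of_real (sqrt (2 * pi) ^ CARD('d) * (\<integral>z. g (s n *\<^sub>R z) * exp (- (norm z)\<^sup>2 / 2) \<partial>lborel))"
      unfolding integral_gauss_ft(2)[OF g s, symmetric] ftg integral_complex_of_real[symmetric] by simp
    hence "(\<integral>\<xi>. exp (- (s n * norm \<xi>)\<^sup>2 / 2) * (norm (ft f \<xi>))\<^sup>2 \<partial>lborel)
       = sqrt (2 * pi) ^ CARD('d) * (\<integral>z. g (s n *\<^sub>R z) * exp (- (norm z)\<^sup>2 / 2) \<partial>lborel)"
      by (simp only: of_real_eq_iff)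
    also have "(\<integral>z. g (s n *\<^sub>R z) * exp (- (norm z)\<^sup>2 / 2) \<partial>lborel) \<le> (\<integral>z. B * exp (- (norm (z::real^'d))\<^sup>2 / 2) \<partial>lborel)"
    proof (rule integral_mono')
      show "integrable lborel (\<lambda>z::real^'d. B * exp (- (norm z)\<^sup>2 / 2))"
        using integrable_gauss[of 1, where 'd = 'd] by simp
    qed (use B nice_densityD[OF g] in auto)
    finally have le: "(\<integral>\<xi>. exp (- (s n * norm \<xi>)\<^sup>2 / 2) * (norm (ft f \<xi>))\<^sup>2 \<partial>lborel) \<le> C"
      by (simp add: C_def integral_gauss[simplified] mult_left_mono)
    show ?thesis
      using le by (subst nn_integral_eq_integral[OF i]) (auto intro: ennreal_leI)
  qed
  \<comment> \<open>Fatou: the damping factors tend to 1 pointwise, while the damped integrals stay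
    below \<open>C\<close>.\<close>
  have "(\<integral>\<^sup>+\<xi>. ennreal ((norm (ft f \<xi>))\<^sup>2) \<partial>lborel)
     = (\<integral>\<^sup>+\<xi>. liminf (\<lambda>n. ennreal (exp (- (s n * norm \<xi>)\<^sup>2 / 2) * (norm (ft f \<xi>))\<^sup>2)) \<partial>lborel)"
  proof (rule nn_integral_cong)
    fix \<xi> :: "real^'d"
    have "(\<lambda>n. ennreal (exp (- (s n * norm \<xi>)\<^sup>2 / 2) * (norm (ft f \<xi>))\<^sup>2)) \<longlonglongrightarrow> ennreal (exp (- (0 * norm \<xi>)\<^sup>2 / 2) * (norm (ft f \<xi>))\<^sup>2)"
      by (intro tendsto_intros s0) simp_all
    hence "liminf (\<lambda>n. ennreal (exp (- (s n * norm \<xi>)\<^sup>2 / 2) * (norm (ft f \<xi>))\<^sup>2)) = ennreal (exp (- (0 * norm \<xi>)\<^sup>2 / 2) * (norm (ft f \<xi>))\<^sup>2)"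
      by (intro lim_imp_Liminf) auto
    thus "ennreal ((norm (ft f \<xi>))\<^sup>2) = liminf (\<lambda>n. ennreal (exp (- (s n * norm \<xi>)\<^sup>2 / 2) * (norm (ft f \<xi>))\<^sup>2))"
      by simp
  qed
  also have "\<dots> \<le> liminf (\<lambda>n. \<integral>\<^sup>+\<xi>. ennreal (exp (- (s n * norm \<xi>)\<^sup>2 / 2) * (norm (ft f \<xi>))\<^sup>2) \<partial>lborel)"
    by (rule nn_integral_liminf) measurable
  also have "\<dots> \<le> liminf (\<lambda>n. ennreal C)"
    by (intro Liminf_mono always_eventually allI bnd)
  also have "\<dots> < \<infinity>" by (simp add: Liminf_const)
  finally show ?thesis
    by (subst integrable_iff_bounded) (auto simp: power2_eq_square)
qed

text \<open>The condition j \<ge> 2 supplies integrability: |ft f| \<le> 1, so the j-th power is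
  dominated by the square.\<close>

lemma conv_power_at_0:
  fixes f :: "real^'d \<Rightarrow> real"
  assumes f: "nice_density f" and j: "j \<ge> 2"
  shows "integrable lborel (\<lambda>\<xi>. ft f \<xi> ^ j)"
    and "(\<integral>\<xi>. ft f \<xi> ^ j \<partial>lborel) = of_real ((2 * pi) ^ CARD('d) * conv_power f j 0)"
proof -
  note [measurable] = nice_densityD(5)[OF f]
  obtain n where n: "j = Suc n" using j by (cases j) auto
  show int: "integrable lborel (\<lambda>\<xi>. ft f \<xi> ^ j)"
  proof (rule Bochner_Integration.integrable_bound[OF integrable_ft_square[OF f]])
    show "AE \<xi> in lborel. norm (ft f \<xi> ^ j) \<le> norm ((norm (ft f \<xi>))\<^sup>2)"
      using norm_ft_le[OF f] j by (auto simp: norm_power intro!: power_decreasing)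
  qed measurable
  have "ft (conv_power f j) = (\<lambda>\<xi>. ft f \<xi> ^ j)"
    unfolding n by (intro ext ft_conv_power f)
  with fourier_inversion_at_0[of "conv_power f j"] nice_density_conv_power[OF f, of n] int
  show "(\<integral>\<xi>. ft f \<xi> ^ j \<partial>lborel) = of_real ((2 * pi) ^ CARD('d) * conv_power f j 0)"
    by (simp add: n)
qed

section \<open>Decay of the Fourier transform\<close>

text \<open>1 - cos x is half the squared chord |1 - e^(ix)|^2. Chord lengths satisfy the triangle
  inequality, and squaring a sum of two costs the factor 2. The inequality is applied twice: to
  remove an unknown phase b from a Fourier transform, and to recover frequency 1 from the
  consecutive frequencies m and m + 1.\<close>

lemma one_minus_cos_diff_le:
  "1 - cos h \<le> 2 * ((1 - cos b) + (1 - cos (b + h)))" for b h :: real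
proof -
  have sq: "1 - cos x = 2 * (sin (x / 2))\<^sup>2" for x :: real
    using cos_double_sin[of "x / 2"] by simp
  define p q where "p = sin (b / 2)" and "q = sin ((b + h) / 2)"
  have "sin (h / 2) = sin ((b + h) / 2 - b / 2)" by (simp add: field_simps)
  also have "\<dots> = q * cos (b / 2) - cos ((b + h) / 2) * p"
    by (simp add: sin_diff p_def q_def)
  finally have s: "sin (h / 2) = q * cos (b / 2) - cos ((b + h) / 2) * p" .
  have "(sin (h / 2))\<^sup>2 \<le> 2 * ((q * cos (b / 2))\<^sup>2 + (cos ((b + h) / 2) * p)\<^sup>2)"
    unfolding s using zero_le_power2[of "q * cos (b / 2) + cos ((b + h) / 2) * p"]
    by (simp add: power2_eq_square algebra_simps)
  also have "(q * cos (b / 2))\<^sup>2 \<le> q\<^sup>2"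
    by (simp add: power_mult_distrib mult_left_le abs_square_le_1)
  also have "(cos ((b + h) / 2) * p)\<^sup>2 \<le> p\<^sup>2"
    by (simp add: power_mult_distrib mult_left_le_one_le abs_square_le_1)
  finally have "(sin (h / 2))\<^sup>2 \<le> 2 * (q\<^sup>2 + p\<^sup>2)" by simp
  thus ?thesis unfolding sq p_def q_def by (simp add: algebra_simps)
qed

text \<open>The Taylor remainder x^4/24 is at most x^2/6 for |x| \<le> 2, which leaves x^2/2 - x^2/6
  = x^2/3.\<close>

lemma one_minus_cos_ge:
  fixes x :: real
  assumes "\<bar>x\<bar> \<le> 2"
  shows "1 - cos x \<ge> x\<^sup>2 / 3"
proof -
  have "norm (iexp x - (\<Sum>k\<le>3. (\<i> * x) ^ k / fact k)) \<le> \<bar>x\<bar> ^ Suc 3 / fact (Suc 3)"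
    by (rule iexp_approx1)
  moreover have "\<bar>Re (iexp x - (\<Sum>k\<le>3. (\<i> * x) ^ k / fact k))\<bar> \<le> norm (iexp x - (\<Sum>k\<le>3. (\<i> * x) ^ k / fact k))"
    by (rule abs_Re_le_cmod)
  moreover have "Re (iexp x - (\<Sum>k\<le>3. (\<i> * x) ^ k / fact k)) = cos x - (1 - x\<^sup>2 / 2)"
    by (simp add: numeral_3_eq_3 power2_eq_square field_simps flip: cis_conv_exp)
  ultimately have "cos x - (1 - x\<^sup>2 / 2) \<le> x ^ 4 / 24"
    by (simp add: fact_numeral)
  moreover have "x ^ 4 \<le> 4 * x\<^sup>2"
  proof -
    have "x\<^sup>2 \<le> 2\<^sup>2" using assms by (metis abs_le_square_iff abs_numeral)
    hence "x\<^sup>2 * x\<^sup>2 \<le> 4 * x\<^sup>2" by (intro mult_right_mono) auto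
    thus ?thesis by (simp add: power4_eq_xxxx power2_eq_square mult_ac)
  qed
  ultimately show ?thesis by (simp add: field_simps)
qed

(* 1 - |ft f xi| is the f-average of 1 - cos (xi . x - alpha) for some phase alpha.  Pairing x with
   x + h e_i eliminates alpha, and h is chosen such that |h xi_i| <= 2. *)
lemma norm_ft_decay:
  fixes f :: "real^'d \<Rightarrow> real"
  assumes f: "nice_density f"
  obtains c where "c > 0" "\<And>\<xi> i. norm (ft f \<xi>) \<le> exp (- c * min ((\<xi> $ i)\<^sup>2) 1)"
proof -
  note [measurable] = nice_densityD(5)[OF f]
  note F = nice_densityD[OF f]
  have "\<exists>x0. f x0 > 0"
  proof (rule ccontr)
    assume "\<nexists>x0. f x0 > 0"
    hence "f = (\<lambda>_. 0)" using F(1) by (intro ext) (meson antisym not_le)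
    with F(4) show False by simp
  qed
  then obtain x0 where x0: "f x0 > 0" ..
  define \<eta> where "\<eta> = f x0 / 2"
  have \<eta>: "\<eta> > 0" using x0 by (simp add: \<eta>_def)
  have "isCont f x0" using F(2) by (simp add: continuous_on_eq_continuous_at)
  then obtain \<delta>' where \<delta>': "\<delta>' > 0" "\<And>x. dist x x0 < \<delta>' \<Longrightarrow> dist (f x) (f x0) < \<eta>"
    using \<eta> unfolding continuous_at_eps_delta by blast
  define \<delta> where "\<delta> = \<delta>' / 2"
  have \<delta>: "\<delta> > 0" using \<delta>' by (simp add: \<delta>_def)
  \<comment> \<open>The radius is 2 \<open>\<delta>\<close> so that a point of the ball of radius
    \<open>\<delta>\<close> and its translate by at most \<open>\<delta>\<close> both lie where
    \<open>f\<close> is bounded below.\<close>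
  have low: "f x \<ge> \<eta>" if "dist x x0 < 2 * \<delta>" for x
    using \<delta>'(2)[of x] that unfolding \<delta>_def \<eta>_def by (auto simp: dist_real_def abs_if split: if_splits)
  define V where "V = measure lborel (ball x0 \<delta>)"
  have "V > 0" unfolding V_def using content_ball_pos[OF \<delta>, of x0] by simp
  have main: "1 - norm (ft f \<xi>) \<ge> \<eta> * V / 4 * (1 - cos (h * \<xi> $ i))" if h: "\<bar>h\<bar> \<le> \<delta>" for h \<xi> i
  proof -
    define e where "e = (axis i 1 :: real^'d)"
    define \<alpha> where "\<alpha> = Arg (ft f \<xi>)"
    define g where "g x = f x * (1 - cos (\<xi> \<bullet> x - \<alpha>))" for x
    have [measurable]: "g \<in> borel_measurable borel" unfolding g_def by measurable
    have g0: "0 \<le> g x" for x using F(1) by (simp add: g_def)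
    have ci: "integrable lborel (\<lambda>x. f x * cos (\<xi> \<bullet> x - \<alpha>))"
      by (rule Bochner_Integration.integrable_bound[OF F(3)])
         (auto simp: abs_mult intro!: mult_left_le)
    have gi: "integrable lborel g"
      unfolding g_def using ci F(3) by (simp add: algebra_simps)
    have "norm (ft f \<xi>) = Re (ft f \<xi> * cis (- \<alpha>))"
    proof -
      have "ft f \<xi> = rcis (norm (ft f \<xi>)) \<alpha>" unfolding \<alpha>_def by (simp add: rcis_cmod_Arg)
      thus ?thesis by (metis Re_complex_of_real cis_rcis_eq rcis_mult add.right_inverse mult.right_neutral rcis_zero_arg)
    qed
    also have "\<dots> = Re (\<integral>x. of_real (f x) * cis (\<xi> \<bullet> x) * cis (- \<alpha>) \<partial>lborel)"
      unfolding ft_def by simp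
    also have "\<dots> = (\<integral>x. Re (of_real (f x) * cis (\<xi> \<bullet> x) * cis (- \<alpha>)) \<partial>lborel)"
      by (rule integral_bounded_linear[OF bounded_linear_Re, symmetric])
         (intro integrable_mult_left integrable_ft_integrand F)
    also have "\<dots> = (\<integral>x. f x * cos (\<xi> \<bullet> x - \<alpha>) \<partial>lborel)"
      by (intro Bochner_Integration.integral_cong) (auto simp: mult.assoc cis_mult)
    finally have "1 - norm (ft f \<xi>) = (\<integral>x. g x \<partial>lborel)"
      unfolding g_def using ci F(3,4) by (simp add: algebra_simps)
    moreover have "2 * (\<integral>x. g x \<partial>lborel) \<ge> \<eta> * ((1 - cos (h * \<xi> $ i)) / 2) * V"
    proof -
      have gi': "integrable lborel (\<lambda>x. g (x - (- h *\<^sub>R e)))"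
        by (subst integrable_shift_iff) (auto simp: gi)
      have "\<eta> * ((1 - cos (h * \<xi> $ i)) / 2) * V = (\<integral>x. indicator (ball x0 \<delta>) x * (\<eta> * ((1 - cos (h * \<xi> $ i)) / 2)) \<partial>lborel)"
        unfolding V_def by simp
      also have "\<dots> \<le> (\<integral>x. g x + g (x - (- h *\<^sub>R e)) \<partial>lborel)"
      proof (rule integral_mono')
        fix x :: "real^'d"
        show "indicator (ball x0 \<delta>) x * (\<eta> * ((1 - cos (h * \<xi> $ i)) / 2)) \<le> g x + g (x - (- h *\<^sub>R e))"
        proof (cases "x \<in> ball x0 \<delta>")
          case True
          have d1: "dist x x0 < \<delta>" using True by (simp add: dist_commute)
          have "dist (x + h *\<^sub>R e) x0 \<le> dist (x + h *\<^sub>R e) x + dist x x0" by (rule dist_triangle)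
          also have "dist (x + h *\<^sub>R e) x = \<bar>h\<bar>" by (simp add: dist_norm e_def)
          finally have d2: "dist (x + h *\<^sub>R e) x0 < 2 * \<delta>" using h d1 by simp
          have "\<xi> \<bullet> (x + h *\<^sub>R e) = \<xi> \<bullet> x + h * \<xi> $ i"
            by (simp add: inner_add_right e_def inner_axis)
          hence "\<eta> * ((1 - cos (h * \<xi> $ i)) / 2) \<le> \<eta> * ((1 - cos (\<xi> \<bullet> x - \<alpha>)) + (1 - cos (\<xi> \<bullet> (x + h *\<^sub>R e) - \<alpha>)))"
            using \<eta> one_minus_cos_diff_le[of "h * \<xi> $ i" "\<xi> \<bullet> x - \<alpha>"]
            by (intro mult_left_mono) (auto simp: field_simps)
          also have "\<dots> = \<eta> * (1 - cos (\<xi> \<bullet> x - \<alpha>)) + \<eta> * (1 - cos (\<xi> \<bullet> (x + h *\<^sub>R e) - \<alpha>))"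
            by (rule distrib_left)
          also have "\<dots> \<le> g x + g (x + h *\<^sub>R e)"
            unfolding g_def using low[of x] low[of "x + h *\<^sub>R e"] d1 d2 \<delta>
            by (intro add_mono mult_right_mono) auto
          finally show ?thesis using True by simp
        qed (use g0 in auto)
      qed (use gi gi' g0 in auto)
      also have "\<dots> = (\<integral>x. g x \<partial>lborel) + (\<integral>x. g (x - (- h *\<^sub>R e)) \<partial>lborel)"
        by (rule Bochner_Integration.integral_add) (use gi gi' in auto)
      also have "(\<integral>x. g (x - (- h *\<^sub>R e)) \<partial>lborel) = (\<integral>x. g x \<partial>lborel)"
        by (rule integral_shift) auto
      finally show ?thesis by simp
    qed
    ultimately show ?thesis by (simp add: field_simps)
  qed
  define c where "c = \<eta> * V / 12 * min (\<delta>\<^sup>2) 1"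
  have c: "c > 0" using \<eta> \<open>V > 0\<close> \<delta> by (simp add: c_def)
  have "norm (ft f \<xi>) \<le> exp (- c * min ((\<xi> $ i)\<^sup>2) 1)" for \<xi> i
  proof -
    \<comment> \<open>The witness is \<open>\<delta>\<close> as long as its product with |xi_i|
      stays below 2. For larger frequencies it is 2 / xi_i, which is smaller than
      \<open>\<delta>\<close> and gives 1 - cos 2 \<ge> 4/3.\<close>
    have "\<exists>h. \<bar>h\<bar> \<le> \<delta> \<and> 1 - cos (h * \<xi> $ i) \<ge> (min (\<delta>\<^sup>2) 1 * min ((\<xi> $ i)\<^sup>2) 1) / 3"
    proof (cases "\<delta> * \<bar>\<xi> $ i\<bar> \<le> 2")
      case True
      have "min (\<delta>\<^sup>2) 1 * min ((\<xi> $ i)\<^sup>2) 1 \<le> \<delta>\<^sup>2 * (\<xi> $ i)\<^sup>2"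
        by (intro mult_mono) auto
      with True one_minus_cos_ge[of "\<delta> * \<xi> $ i"] \<delta> show ?thesis
        by (intro exI[of _ \<delta>]) (auto simp: abs_mult power_mult_distrib)
    next
      case False
      hence nz: "\<xi> $ i \<noteq> 0" by auto
      have "min (\<delta>\<^sup>2) 1 * min ((\<xi> $ i)\<^sup>2) 1 \<le> 1 * 1"
        by (intro mult_mono) auto
      with False nz \<delta> one_minus_cos_ge[of 2] show ?thesis
        by (intro exI[of _ "2 / (\<xi> $ i)"]) (auto simp: field_simps)
    qed
    then obtain h where h: "\<bar>h\<bar> \<le> \<delta>" "1 - cos (h * \<xi> $ i) \<ge> (min (\<delta>\<^sup>2) 1 * min ((\<xi> $ i)\<^sup>2) 1) / 3" by blast
    have "c * min ((\<xi> $ i)\<^sup>2) 1 = \<eta> * V / 4 * ((min (\<delta>\<^sup>2) 1 * min ((\<xi> $ i)\<^sup>2) 1) / 3)"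
      by (simp add: c_def)
    also have "\<dots> \<le> \<eta> * V / 4 * (1 - cos (h * \<xi> $ i))"
      using h(2) \<eta> \<open>V > 0\<close> by (intro mult_left_mono) auto
    also have "\<dots> \<le> 1 - norm (ft f \<xi>)" by (rule main[OF h(1)])
    finally have "norm (ft f \<xi>) \<le> 1 + (- c * min ((\<xi> $ i)\<^sup>2) 1)" by simp
    also have "\<dots> \<le> exp (- c * min ((\<xi> $ i)\<^sup>2) 1)" by (rule exp_ge_add_one_self)
    finally show ?thesis .
  qed
  with c that show ?thesis by blast
qed

text \<open>Multiplying the bounds for the d coordinates and taking the d-th root divides the
  constant by d. The sum form factorises over coordinates and becomes Gaussian after scaling; the
  single-coordinate form gives a uniform gap outside the unit cube.\<close>

lemma norm_ft_decay_prod: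
  fixes f :: "real^'d \<Rightarrow> real"
  assumes f: "nice_density f"
  obtains c where "c > 0" "\<And>\<xi> i. norm (ft f \<xi>) \<le> exp (- c * min ((\<xi> $ i)\<^sup>2) 1)"
    "\<And>\<xi>. norm (ft f \<xi>) \<le> exp (- c * (\<Sum>i\<in>UNIV. min ((\<xi> $ i)\<^sup>2) 1))"
proof -
  obtain c where c: "c > 0" "\<And>\<xi> i. norm (ft f \<xi>) \<le> exp (- c * min ((\<xi> $ i)\<^sup>2) 1)"
    using norm_ft_decay[OF f] by blast
  define d where "d = real CARD('d)"
  have d: "d \<ge> 1" unfolding d_def using zero_less_card_finite[where 'a = 'd] by linarith
  have 1: "norm (ft f \<xi>) \<le> exp (- (c / d) * min ((\<xi> $ i)\<^sup>2) 1)" for \<xi> i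
  proof -
    have "c / d * min ((\<xi> $ i)\<^sup>2) 1 \<le> c * min ((\<xi> $ i)\<^sup>2) 1"
      using d c(1) by (intro mult_right_mono) (auto simp: field_simps)
    thus ?thesis by (intro order_trans[OF c(2)[of \<xi> i]]) simp
  qed
  have 2: "norm (ft f \<xi>) \<le> exp (- (c / d) * (\<Sum>i\<in>UNIV. min ((\<xi> $ i)\<^sup>2) 1))" for \<xi>
  proof -
    have "norm (ft f \<xi>) ^ CARD('d) = (\<Prod>i\<in>(UNIV :: 'd set). norm (ft f \<xi>))" by simp
    also have "\<dots> \<le> (\<Prod>i\<in>UNIV. exp (- c * min ((\<xi> $ i)\<^sup>2) 1))"
      by (intro prod_mono) (use c in auto)
    also have "\<dots> = exp (\<Sum>i\<in>UNIV. - c * min ((\<xi> $ i)\<^sup>2) 1)" by (simp add: exp_sum)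
    also have "(\<Sum>i\<in>UNIV. - c * min ((\<xi> $ i)\<^sup>2) 1) = d * (- (c / d) * (\<Sum>i\<in>UNIV. min ((\<xi> $ i)\<^sup>2) 1))"
      using d by (simp add: sum_distrib_left sum_negf)
    also have "exp \<dots> = exp (- (c / d) * (\<Sum>i\<in>UNIV. min ((\<xi> $ i)\<^sup>2) 1)) ^ CARD('d)"
      unfolding d_def by (rule exp_of_nat_mult)
    finally show ?thesis by (subst (asm) power_mono_iff) auto
  qed
  show ?thesis by (rule that[of "c / d"]) (use c d 1 2 in auto)
qed

section \<open>The local limit theorem for convolution powers at the origin\<close>

text \<open>For a centred density this is the quadratic form of the covariance matrix. The matrix
  itself appears only when its determinant is computed in dimension 2.\<close>

definition quad_form :: "(real^'d \<Rightarrow> real) \<Rightarrow> real^'d \<Rightarrow> real" where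
  "quad_form f u = (\<integral>x. (u \<bullet> x)\<^sup>2 * f x \<partial>lborel)"

lemma integrable_moments:
  fixes f :: "real^'d \<Rightarrow> real"
  assumes f: "nice_density f" and m3: "integrable lborel (\<lambda>x. norm x ^ 3 * f x)"
    and k: "k \<le> 3"
  shows "integrable lborel (\<lambda>x. norm x ^ k * f x)"
    and "integrable lborel (\<lambda>x. (u \<bullet> x) ^ k * f x)"
    and "integrable lborel (\<lambda>x. \<bar>u \<bullet> x\<bar> ^ k * f x)"
proof -
  note [measurable] = nice_densityD(5)[OF f]
  note F = nice_densityD[OF f]
  show 1: "integrable lborel (\<lambda>x. norm x ^ k * f x)"
  proof (rule Bochner_Integration.integrable_bound[OF Bochner_Integration.integrable_add[OF F(3) m3]])
    have "norm x ^ k \<le> 1 + norm x ^ 3" for x :: "real^'d"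
    proof (cases "norm x \<le> 1")
      case True
      thus ?thesis by (intro order_trans[OF power_le_one]) auto
    next
      case False
      hence "norm x ^ k \<le> norm x ^ 3" using k by (intro power_increasing) auto
      thus ?thesis by linarith
    qed
    hence "norm x ^ k * f x \<le> (1 + norm x ^ 3) * f x" for x
      using F(1) by (intro mult_right_mono)
    thus "AE x in lborel. norm (norm x ^ k * f x) \<le> norm (f x + norm x ^ 3 * f x)"
      using F(1) by (auto simp: algebra_simps abs_mult)
  qed measurable
  have le: "\<bar>u \<bullet> x\<bar> ^ k * f x \<le> norm u ^ k * (norm x ^ k * f x)" for x
    using power_mono[OF Cauchy_Schwarz_ineq2[of u x], of k] F(1)[of x]
    by (simp add: power_mult_distrib mult.assoc[symmetric] mult_right_mono)
  show "integrable lborel (\<lambda>x. (u \<bullet> x) ^ k * f x)"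
    by (rule Bochner_Integration.integrable_bound[OF integrable_mult_right[OF 1, of "norm u ^ k"]])
       (use le F(1) in \<open>auto simp: abs_mult power_abs\<close>)
  show "integrable lborel (\<lambda>x. \<bar>u \<bullet> x\<bar> ^ k * f x)"
    by (rule Bochner_Integration.integrable_bound[OF integrable_mult_right[OF 1, of "norm u ^ k"]])
       (use le F(1) in \<open>auto simp: abs_mult power_abs\<close>)
qed

lemma integral_inner_eq_0:
  fixes f :: "real^'d \<Rightarrow> real"
  assumes f: "nice_density f" and m3: "integrable lborel (\<lambda>x. norm x ^ 3 * f x)"
    and mean: "mean_vec f = 0"
  shows "(\<integral>x. (u \<bullet> x) * f x \<partial>lborel) = 0"
proof -
  note [measurable] = nice_densityD(5)[OF f]
  have "integrable lborel (\<lambda>x. f x *\<^sub>R x)"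
    by (rule Bochner_Integration.integrable_bound[OF integrable_moments(1)[OF f m3, of 1]])
       (auto simp: mult.commute)
  hence "(\<integral>x. u \<bullet> (f x *\<^sub>R x) \<partial>lborel) = u \<bullet> mean_vec f"
    unfolding mean_vec_def by (rule integral_inner_right)
  thus ?thesis by (simp add: mean mult.commute)
qed

text \<open>The third-order bound for e^(iy) is integrated against f; the linear term disappears
  because the mean is 0.\<close>

lemma ft_taylor:
  fixes f :: "real^'d \<Rightarrow> real"
  assumes f: "nice_density f" and m3: "integrable lborel (\<lambda>x. norm x ^ 3 * f x)"
    and mean: "mean_vec f = 0"
  shows "norm (ft f u - (1 - of_real (quad_form f u) / 2)) \<le> (\<integral>x. \<bar>u \<bullet> x\<bar> ^ 3 * f x \<partial>lborel) / 6"
proof -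
  note [measurable] = nice_densityD(5)[OF f]
  note F = nice_densityD[OF f]
  have i1: "integrable lborel (\<lambda>x. (u \<bullet> x) * f x)"
    using integrable_moments(2)[OF f m3, of 1 u] by simp
  have i2: "integrable lborel (\<lambda>x. (u \<bullet> x)\<^sup>2 * f x)"
    using integrable_moments(2)[OF f m3, of 2 u] by simp
  have i3: "integrable lborel (\<lambda>x. \<bar>u \<bullet> x\<bar> ^ 3 * f x)"
    using integrable_moments(3)[OF f m3, of 3 u] by simp
  have i0: "integrable lborel (\<lambda>x. complex_of_real (f x) * cis (u \<bullet> x))"
    by (rule integrable_ft_integrand) (rule F)
  define P where "P x = of_real (f x) + \<i> * of_real ((u \<bullet> x) * f x) - of_real ((u \<bullet> x)\<^sup>2 * f x) / 2" for x
  have c0: "integrable lborel (\<lambda>x. complex_of_real (f x))"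
    using F(3) by (simp only: complex_of_real_integrable_eq)
  have c1: "integrable lborel (\<lambda>x. \<i> * complex_of_real ((u \<bullet> x) * f x))"
    by (intro integrable_mult_right) (use i1 in \<open>simp only: complex_of_real_integrable_eq\<close>)
  have c2: "integrable lborel (\<lambda>x. complex_of_real ((u \<bullet> x)\<^sup>2 * f x) / 2)"
    by (intro integrable_divide_zero) (use i2 in \<open>simp only: complex_of_real_integrable_eq\<close>)
  have iP: "integrable lborel P"
    unfolding P_def by (intro Bochner_Integration.integrable_diff Bochner_Integration.integrable_add c0 c1 c2)
  have "integral\<^sup>L lborel P = (\<integral>x. complex_of_real (f x) \<partial>lborel) + \<i> * (\<integral>x. complex_of_real ((u \<bullet> x) * f x) \<partial>lborel)
      - (\<integral>x. complex_of_real ((u \<bullet> x)\<^sup>2 * f x) \<partial>lborel) / 2"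
    unfolding P_def
      Bochner_Integration.integral_diff[OF Bochner_Integration.integrable_add[OF c0 c1] c2]
      Bochner_Integration.integral_add[OF c0 c1] integral_mult_right_zero integral_divide_zero ..
  also have "\<dots> = 1 - of_real (quad_form f u) / 2"
    unfolding integral_complex_of_real integral_inner_eq_0[OF f m3 mean] quad_form_def[symmetric] F(4) by simp
  finally have eq: "1 - of_real (quad_form f u) / 2 = integral\<^sup>L lborel P" ..
  have "norm (ft f u - integral\<^sup>L lborel P) = norm (\<integral>x. complex_of_real (f x) * cis (u \<bullet> x) - P x \<partial>lborel)"
    unfolding ft_def by (subst Bochner_Integration.integral_diff[OF i0 iP]) simp
  also have "\<dots> \<le> (\<integral>x. \<bar>u \<bullet> x\<bar> ^ 3 * f x / 6 \<partial>lborel)"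
  proof (rule Bochner_Integration.integral_norm_bound_integral)
    show "integrable lborel (\<lambda>x. complex_of_real (f x) * cis (u \<bullet> x) - P x)"
      by (intro Bochner_Integration.integrable_diff i0 iP)
    show "integrable lborel (\<lambda>x. \<bar>u \<bullet> x\<bar> ^ 3 * f x / 6)" using i3 by simp
    fix x
    have "norm (iexp (u \<bullet> x) - (\<Sum>k\<le>2. (\<i> * of_real (u \<bullet> x)) ^ k / fact k)) \<le> \<bar>u \<bullet> x\<bar> ^ Suc 2 / fact (Suc 2)"
      by (rule iexp_approx1)
    hence le: "norm (cis (u \<bullet> x) - (1 + \<i> * of_real (u \<bullet> x) - of_real ((u \<bullet> x)\<^sup>2) / 2)) \<le> \<bar>u \<bullet> x\<bar> ^ 3 / 6"
      by (simp add: cis_conv_exp numeral_2_eq_2 power2_eq_square algebra_simps eval_nat_numeral)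
    have "complex_of_real (f x) * cis (u \<bullet> x) - P x = of_real (f x) * (cis (u \<bullet> x) - (1 + \<i> * of_real (u \<bullet> x) - of_real ((u \<bullet> x)\<^sup>2) / 2))"
      by (simp add: P_def algebra_simps)
    also have "norm \<dots> \<le> f x * (\<bar>u \<bullet> x\<bar> ^ 3 / 6)"
      unfolding norm_mult using F(1) le by (intro mult_mono) auto
    finally show "norm (complex_of_real (f x) * cis (u \<bullet> x) - P x) \<le> \<bar>u \<bullet> x\<bar> ^ 3 * f x / 6"
      by (simp add: mult.commute)
  qed
  finally show ?thesis by (simp add: eq)
qed

lemma quad_form_nonneg: "nice_density f \<Longrightarrow> 0 \<le> quad_form f u"
  unfolding quad_form_def by (auto intro!: Bochner_Integration.integral_nonneg mult_nonneg_nonneg dest: nice_densityD(1))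

lemma quad_form_scale: "quad_form f (s *\<^sub>R u) = s\<^sup>2 * quad_form f u"
  by (simp add: quad_form_def power_mult_distrib mult.assoc)

text \<open>The central limit theorem at a fixed frequency. For z, w in the unit disc |z^j - w^j|
  \<le> j |z - w|; here w^j is exactly the Gaussian value, and z and w agree with 1 - q/(2j) up to
  O(j^(-3/2)).\<close>

lemma ft_power_limit:
  fixes f :: "real^'d \<Rightarrow> real"
  assumes f: "nice_density f" and m3: "integrable lborel (\<lambda>x. norm x ^ 3 * f x)"
    and mean: "mean_vec f = 0"
  shows "(\<lambda>j. ft f ((1 / sqrt (real j)) *\<^sub>R u) ^ j) \<longlonglongrightarrow> of_real (exp (- quad_form f u / 2))"
proof -
  define q where "q = quad_form f u"
  have q: "q \<ge> 0" unfolding q_def by (rule quad_form_nonneg[OF f])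
  define K where "K = (\<integral>x. \<bar>u \<bullet> x\<bar> ^ 3 * f x \<partial>lborel)"
  have bnd: "norm (ft f ((1 / sqrt (real j)) *\<^sub>R u) ^ j - of_real (exp (- q / 2)))
        \<le> K / 6 * (1 / sqrt (real j)) + q\<^sup>2 / 8 * (1 / real j)" if j: "j > 0" for j
  proof -
    define s where "s = 1 / sqrt (real j)"
    have s: "s > 0" "s\<^sup>2 = 1 / real j" using j by (auto simp: s_def power_divide)
    define w where "w = complex_of_real (exp (- q * s\<^sup>2 / 2))"
    have t1: "norm (ft f (s *\<^sub>R u) - (1 - of_real (s\<^sup>2 * q) / 2)) \<le> s ^ 3 * K / 6"
      using ft_taylor[OF f m3 mean, of "s *\<^sub>R u"] s(1)
      by (simp add: quad_form_scale q_def K_def abs_mult power_mult_distrib mult.assoc)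
    have t2: "norm ((1 - of_real (s\<^sup>2 * q) / 2) - w) \<le> (s\<^sup>2 * q)\<^sup>2 / 8"
    proof -
      define y where "y = s\<^sup>2 * q / 2"
      have y: "y \<ge> 0" using q by (simp add: y_def)
      have a: "exp (- y) \<ge> 1 - y" using exp_ge_add_one_self[of "- y"] by simp
      \<comment> \<open>(1 - y + y^2/2) (1 + y + y^2/2) = 1 + y^4/4, so the lower Taylor bound for
        exp y turns into this upper bound for its reciprocal.\<close>
      have b: "exp (- y) \<le> 1 - y + y\<^sup>2 / 2"
      proof -
        have "exp y \<ge> 1 + y + y\<^sup>2 / 2" by (rule exp_lower_Taylor_quadratic[OF y])
        hence "exp (- y) * (1 + y + y\<^sup>2 / 2) \<le> exp (- y) * exp y" by (intro mult_left_mono) auto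
        hence "exp (- y) * (1 + y + y\<^sup>2 / 2) \<le> 1" by (simp flip: exp_add)
        also have "1 \<le> 1 + y ^ 4 / 4" by simp
        also have "\<dots> = (1 - y + y\<^sup>2 / 2) * (1 + y + y\<^sup>2 / 2)"
          by (simp add: power2_eq_square power4_eq_xxxx algebra_simps)
        finally have *: "exp (- y) * (1 + y + y\<^sup>2 / 2) \<le> (1 - y + y\<^sup>2 / 2) * (1 + y + y\<^sup>2 / 2)" .
        have "1 + y + y\<^sup>2 / 2 > 0" using y zero_le_power2[of y] by linarith
        with * show ?thesis by (simp add: mult_le_cancel_right)
      qed
      have "(1 - of_real (s\<^sup>2 * q) / 2) - w = of_real (1 - y - exp (- y))"
        by (simp add: w_def y_def mult_ac)
      hence "norm ((1 - of_real (s\<^sup>2 * q) / 2) - w) = \<bar>1 - y - exp (- y)\<bar>" by (simp only: norm_of_real)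
      also have "\<dots> \<le> y\<^sup>2 / 2" using a b by linarith
      also have "\<dots> = (s\<^sup>2 * q)\<^sup>2 / 8" by (simp add: y_def power2_eq_square)
      finally show ?thesis .
    qed
    have wj: "w ^ j = of_real (exp (- q / 2))"
    proof -
      have "w ^ j = of_real (exp (- q * s\<^sup>2 / 2) ^ j)" by (simp add: w_def)
      also have "exp (- q * s\<^sup>2 / 2) ^ j = exp (real j * (- q * s\<^sup>2 / 2))" by (rule exp_of_nat_mult[symmetric])
      also have "real j * (- q * s\<^sup>2 / 2) = - q / 2" using j by (simp add: s(2))
      finally show ?thesis .
    qed
    have "norm (ft f (s *\<^sub>R u) ^ j - w ^ j) \<le> j * norm (ft f (s *\<^sub>R u) - w)"
      by (rule norm_power_diff) (use norm_ft_le[OF f] q in \<open>auto simp: w_def\<close>)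
    also have "\<dots> \<le> j * (s ^ 3 * K / 6 + (s\<^sup>2 * q)\<^sup>2 / 8)"
      using norm_triangle_mono[OF t1 t2] by (intro mult_left_mono) (auto simp: algebra_simps)
    also have "\<dots> = (j * s\<^sup>2) * (s * K / 6 + s\<^sup>2 * q\<^sup>2 / 8)"
      by (simp add: power2_eq_square power3_eq_cube algebra_simps)
    also have "\<dots> = K / 6 * (1 / sqrt (real j)) + q\<^sup>2 / 8 * (1 / real j)"
      using j by (simp add: s(2)) (simp add: s_def)
    finally show ?thesis by (simp add: wj s_def)
  qed
  have "(\<lambda>j. ft f ((1 / sqrt (real j)) *\<^sub>R u) ^ j - of_real (exp (- q / 2))) \<longlonglongrightarrow> 0"
  proof (rule Lim_null_comparison)
    show "eventually (\<lambda>j. norm (ft f ((1 / sqrt (real j)) *\<^sub>R u) ^ j - of_real (exp (- q / 2)))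
        \<le> K / 6 * (1 / sqrt (real j)) + q\<^sup>2 / 8 * (1 / real j)) sequentially"
      using eventually_gt_at_top[of 0] by eventually_elim (rule bnd)
    show "(\<lambda>j. K / 6 * (1 / sqrt (real j)) + q\<^sup>2 / 8 * (1 / real j)) \<longlonglongrightarrow> 0"
      by real_asymp
  qed
  thus ?thesis by (simp add: q_def LIM_zero_iff)
qed

text \<open>Non-degeneracy is read off the Fourier side: for large j the decay bound gives |ft f (u
  / sqrt j)|^j \<le> exp (- c u_i^2), and the left side tends to exp (- q/2), whence q \<ge> 2 c
  u_i^2.\<close>

lemma quad_form_pos:
  fixes f :: "real^'d \<Rightarrow> real"
  assumes f: "nice_density f" and m3: "integrable lborel (\<lambda>x. norm x ^ 3 * f x)"
    and mean: "mean_vec f = 0" and u: "u \<noteq> 0"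
  shows "quad_form f u > 0"
proof -
  obtain c where c: "c > 0" "\<And>\<xi> i. norm (ft f \<xi>) \<le> exp (- c * min ((\<xi> $ i)\<^sup>2) 1)"
    using norm_ft_decay[OF f] by blast
  obtain i where i: "u $ i \<noteq> 0" using u by (auto simp: vec_eq_iff)
  have lim: "(\<lambda>j. norm (ft f ((1 / sqrt (real j)) *\<^sub>R u) ^ j)) \<longlonglongrightarrow> norm (complex_of_real (exp (- quad_form f u / 2)))"
    by (intro tendsto_norm ft_power_limit f m3 mean)
  have "norm (complex_of_real (exp (- quad_form f u / 2))) \<le> exp (- c * (u $ i)\<^sup>2)"
  proof (rule tendsto_upperbound[OF lim])
    show "\<forall>\<^sub>F j in sequentially. norm (ft f ((1 / sqrt (real j)) *\<^sub>R u) ^ j) \<le> exp (- c * (u $ i)\<^sup>2)"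
      using eventually_ge_at_top[of "nat \<lceil>(u $ i)\<^sup>2\<rceil> + 1"]
    proof eventually_elim
      case (elim j)
      hence j: "real j \<ge> (u $ i)\<^sup>2" "j > 0" by (auto simp: nat_le_iff ceiling_le_iff) linarith
      define s where "s = 1 / sqrt (real j)"
      have s: "s\<^sup>2 = 1 / real j" using j by (simp add: s_def power_divide)
      have "norm (ft f (s *\<^sub>R u)) ^ j \<le> exp (- c * min (((s *\<^sub>R u) $ i)\<^sup>2) 1) ^ j"
        by (intro power_mono c) auto
      also have "((s *\<^sub>R u) $ i)\<^sup>2 = (u $ i)\<^sup>2 / real j" by (simp add: power_mult_distrib s)
      also have "min \<dots> 1 = (u $ i)\<^sup>2 / real j" using j by (simp add: field_simps)
      also have "exp (- c * ((u $ i)\<^sup>2 / real j)) ^ j = exp (- c * (u $ i)\<^sup>2)"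
        using j by (simp flip: exp_of_nat_mult)
      finally show ?case by (simp add: s_def norm_power)
    qed
  qed auto
  hence "- quad_form f u / 2 \<le> - c * (u $ i)\<^sup>2" by simp
  moreover have "c * (u $ i)\<^sup>2 > 0" using c i by simp
  ultimately show ?thesis by linarith
qed

text \<open>Fourier inversion turns the value at 0 into the integral of (ft f)^j. After the
  substitution xi = u / sqrt j the part over the unit cube converges by dominated convergence, and
  the part outside is exponentially small in j.\<close>

theorem conv_power_local_limit:
  fixes f :: "real^'d \<Rightarrow> real"
  assumes f: "nice_density f" and m3: "integrable lborel (\<lambda>x. norm x ^ 3 * f x)"
    and mean: "mean_vec f = 0"
  shows "integrable lborel (\<lambda>u. exp (- quad_form f u / 2))"
    and "(\<lambda>j. sqrt (real j) ^ CARD('d) * conv_power f j 0)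
      \<longlonglongrightarrow> (\<integral>u. exp (- quad_form f u / 2) \<partial>lborel) / (2 * pi) ^ CARD('d)"
proof -
  note [measurable] = nice_densityD(5)[OF f]
  obtain c where c: "c > 0" "\<And>\<xi> i. norm (ft f \<xi>) \<le> exp (- c * min ((\<xi> $ i)\<^sup>2) 1)"
    "\<And>\<xi>. norm (ft f \<xi>) \<le> exp (- c * (\<Sum>i\<in>UNIV. min ((\<xi> $ i)\<^sup>2) 1))"
    using norm_ft_decay_prod[OF f] by blast
  \<comment> \<open>On this cube the minimum in the decay bound equals xi_i^2, so the bound scales
    to a Gaussian majorant independent of j.\<close>
  define D where "D = {\<xi> :: real^'d. \<forall>i. (\<xi> $ i)\<^sup>2 \<le> 1}"
  have "closed D" unfolding D_def
    by (intro closed_Collect_all closed_Collect_le continuous_intros)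
  hence [measurable]: "D \<in> sets borel" by auto
  define A where "A j u = (indicator D ((1 / sqrt (real j)) *\<^sub>R u) * ft f ((1 / sqrt (real j)) *\<^sub>R u) ^ j)" for j u
  have [measurable]: "A j \<in> borel_measurable borel" for j unfolding A_def by measurable
  have w: "integrable lborel (\<lambda>u::real^'d. exp (- c * (norm u)\<^sup>2))"
    using integrable_gauss[of "sqrt (2 * c)", where 'd = 'd] c(1) by (simp add: power_mult_distrib)
  have Alim: "(\<lambda>j. A (Suc j) u) \<longlonglongrightarrow> of_real (exp (- quad_form f u / 2))" for u
  proof -
    have "\<forall>\<^sub>F j in sequentially. ft f ((1 / sqrt (real j)) *\<^sub>R u) ^ j = A j u"
      using eventually_ge_at_top[of "nat \<lceil>(norm u)\<^sup>2\<rceil> + 1"]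
    proof eventually_elim
      case (elim j)
      hence j: "real j \<ge> (norm u)\<^sup>2" "j > 0" by (auto simp: nat_le_iff ceiling_le_iff) linarith
      have "(u $ i)\<^sup>2 \<le> real j" for i
      proof -
        have "(u $ i)\<^sup>2 \<le> (norm u)\<^sup>2"
          using power_mono[OF component_le_norm_cart[of u i], of 2] by simp
        with j show ?thesis by linarith
      qed
      hence "(1 / sqrt (real j)) *\<^sub>R u \<in> D"
        using j(2) by (auto simp: D_def power_divide)
      thus ?case by (simp add: A_def)
    qed
    hence "(\<lambda>j. A j u) \<longlonglongrightarrow> of_real (exp (- quad_form f u / 2))"
      by (rule Lim_transform_eventually[OF ft_power_limit[OF f m3 mean, of u]])
    thus ?thesis by (rule LIMSEQ_Suc)
  qed
  \<comment> \<open>The index is shifted because the majorant fails at j = 0: there 1 / sqrt 0 = 0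
    by convention and \<open>A 0\<close> is constantly 1.\<close>
  have Abound: "norm (A (Suc j) u) \<le> exp (- c * (norm u)\<^sup>2)" for j u
  proof (cases "(1 / sqrt (real (Suc j))) *\<^sub>R u \<in> D")
    case True
    define s where "s = 1 / sqrt (real (Suc j))"
    have s: "s\<^sup>2 = 1 / real (Suc j)" by (simp add: s_def power_divide)
    have "norm (A (Suc j) u) = norm (ft f (s *\<^sub>R u)) ^ Suc j"
      using True by (simp add: A_def s_def norm_mult norm_power)
    also have "\<dots> \<le> exp (- c * (\<Sum>i\<in>UNIV. min (((s *\<^sub>R u) $ i)\<^sup>2) 1)) ^ Suc j"
      by (intro power_mono c) auto
    also have "(\<Sum>i\<in>UNIV. min (((s *\<^sub>R u) $ i)\<^sup>2) 1) = (\<Sum>i\<in>UNIV. s\<^sup>2 * (u $ i)\<^sup>2)"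
      using True by (intro sum.cong) (auto simp: D_def s_def power_mult_distrib power_divide)
    also have "\<dots> = (norm u)\<^sup>2 / real (Suc j)"
      by (simp add: norm_vec_power2 s sum_divide_distrib)
    also have "exp (- c * ((norm u)\<^sup>2 / real (Suc j))) ^ Suc j = exp (- c * (norm u)\<^sup>2)"
      by (simp flip: exp_of_nat_mult del: power_Suc of_nat_Suc)
    finally show ?thesis .
  qed (auto simp: A_def)
  have "integrable lborel (\<lambda>u. complex_of_real (exp (- quad_form f u / 2)))"
  proof (rule integrable_dominated_convergence[where s = "\<lambda>j. A (Suc j)", OF _ _ w])
    show "(\<lambda>u. complex_of_real (exp (- quad_form f u / 2))) \<in> borel_measurable lborel"
      by (rule borel_measurable_LIMSEQ_metric[where f = "\<lambda>j. A (Suc j)"]) (use Alim in auto)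
  qed (use Alim Abound in auto)
  thus int: "integrable lborel (\<lambda>u. exp (- quad_form f u / 2))"
    by (simp only: complex_of_real_integrable_eq)
  have lim1: "(\<lambda>j. \<integral>u. A (Suc j) u \<partial>lborel) \<longlonglongrightarrow> (\<integral>u. complex_of_real (exp (- quad_form f u / 2)) \<partial>lborel)"
  proof (rule integral_dominated_convergence[OF _ _ w])
    show "(\<lambda>u. complex_of_real (exp (- quad_form f u / 2))) \<in> borel_measurable lborel"
      by (rule borel_measurable_LIMSEQ_metric[where f = "\<lambda>j. A (Suc j)"]) (use Alim in auto)
  qed (use Alim Abound in auto)
  define I2 where "I2 = (\<integral>\<xi>. (norm (ft f \<xi>))\<^sup>2 \<partial>lborel)"
  \<comment> \<open>Outside \<open>D\<close> two of the j factors are kept for integrability, and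
    each of the remaining j - 2 is at most exp (- c).\<close>
  have split: "norm (of_real (sqrt (real j) ^ CARD('d) * ((2 * pi) ^ CARD('d) * conv_power f j 0)) - (\<integral>u. A j u \<partial>lborel))
      \<le> sqrt (real j) ^ CARD('d) * (exp (- c * real (j - 2)) * I2)" if j: "j \<ge> 2" for j
  proof -
    define s where "s = 1 / sqrt (real j)"
    have s: "s > 0" "s \<noteq> 0" using j by (auto simp: s_def)
    have i1: "integrable lborel (\<lambda>\<xi>. ft f \<xi> ^ j)" by (rule conv_power_at_0[OF f j])
    have i2: "integrable lborel (\<lambda>\<xi>. indicator D \<xi> * ft f \<xi> ^ j)"
      by (rule Bochner_Integration.integrable_bound[OF i1]) (auto simp: norm_mult indicator_def)
    have scl: "sqrt (real j) ^ CARD('d) * \<bar>s\<bar> ^ CARD('d) = 1"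
      using j by (simp add: s_def power_divide)
    have "(\<integral>u. A j u \<partial>lborel) = of_real (sqrt (real j) ^ CARD('d) * \<bar>s\<bar> ^ CARD('d)) * (\<integral>u. A j u \<partial>lborel)"
      unfolding scl by simp
    also have "\<dots> = of_real (sqrt (real j) ^ CARD('d)) * (\<bar>s\<bar> ^ DIM(real^'d) *\<^sub>R (\<integral>u. indicator D (s *\<^sub>R u) * ft f (s *\<^sub>R u) ^ j \<partial>lborel))"
      by (simp add: A_def s_def scaleR_conv_of_real)
    also have "\<bar>s\<bar> ^ DIM(real^'d) *\<^sub>R (\<integral>u. indicator D (s *\<^sub>R u) * ft f (s *\<^sub>R u) ^ j \<partial>lborel)
       = (\<integral>\<xi>. indicator D \<xi> * ft f \<xi> ^ j \<partial>lborel)"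
      by (rule integral_scale) (use s in measurable)
    finally have Aeq: "(\<integral>u. A j u \<partial>lborel) = of_real (sqrt (real j) ^ CARD('d)) * (\<integral>\<xi>. indicator D \<xi> * ft f \<xi> ^ j \<partial>lborel)" .
    have "of_real (sqrt (real j) ^ CARD('d) * ((2 * pi) ^ CARD('d) * conv_power f j 0)) - (\<integral>u. A j u \<partial>lborel)
       = of_real (sqrt (real j) ^ CARD('d)) * ((\<integral>\<xi>. ft f \<xi> ^ j \<partial>lborel) - (\<integral>\<xi>. indicator D \<xi> * ft f \<xi> ^ j \<partial>lborel))"
      unfolding Aeq conv_power_at_0(2)[OF f j] of_real_mult right_diff_distrib ..
    also have "(\<integral>\<xi>. ft f \<xi> ^ j \<partial>lborel) - (\<integral>\<xi>. indicator D \<xi> * ft f \<xi> ^ j \<partial>lborel)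
       = (\<integral>\<xi>. ft f \<xi> ^ j - indicator D \<xi> * ft f \<xi> ^ j \<partial>lborel)"
      by (rule Bochner_Integration.integral_diff[OF i1 i2, symmetric])
    also have "norm (of_real (sqrt (real j) ^ CARD('d)) * \<dots>) = sqrt (real j) ^ CARD('d) * norm \<dots>"
      by (simp add: norm_mult norm_power)
    also have "\<dots> \<le> sqrt (real j) ^ CARD('d) * (\<integral>\<xi>. exp (- c * real (j - 2)) * (norm (ft f \<xi>))\<^sup>2 \<partial>lborel)"
    proof (intro mult_left_mono Bochner_Integration.integral_norm_bound_integral)
      show "integrable lborel (\<lambda>\<xi>. ft f \<xi> ^ j - indicator D \<xi> * ft f \<xi> ^ j)"
        by (rule Bochner_Integration.integrable_diff[OF i1 i2])
      show "integrable lborel (\<lambda>\<xi>. exp (- c * real (j - 2)) * (norm (ft f \<xi>))\<^sup>2)"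
        by (intro integrable_mult_right integrable_ft_square f)
      fix \<xi> :: "real^'d"
      show "norm (ft f \<xi> ^ j - indicator D \<xi> * ft f \<xi> ^ j) \<le> exp (- c * real (j - 2)) * (norm (ft f \<xi>))\<^sup>2"
      proof (cases "\<xi> \<in> D")
        case False
        then obtain i where "(\<xi> $ i)\<^sup>2 > 1" by (auto simp: D_def not_le)
        with c(2)[of \<xi> i] have le: "norm (ft f \<xi>) \<le> exp (- c)" by simp
        have "norm (ft f \<xi>) ^ (j - 2) \<le> exp (- c) ^ (j - 2)"
          by (intro power_mono le) auto
        also have "\<dots> = exp (- c * real (j - 2))" by (simp flip: exp_of_nat_mult add: mult.commute)
        finally have "norm (ft f \<xi>) ^ (j - 2) * (norm (ft f \<xi>))\<^sup>2 \<le> exp (- c * real (j - 2)) * (norm (ft f \<xi>))\<^sup>2"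
          by (intro mult_right_mono) auto
        moreover have "norm (ft f \<xi>) ^ (j - 2) * (norm (ft f \<xi>))\<^sup>2 = norm (ft f \<xi>) ^ j"
          using j by (simp only: power_add[symmetric] le_add_diff_inverse2)
        ultimately show ?thesis using False by (simp add: norm_power)
      qed auto
    qed auto
    finally show ?thesis by (simp add: I2_def)
  qed
  define S where "S j = sqrt (real j) ^ CARD('d) * ((2 * pi) ^ CARD('d) * conv_power f j 0)" for j
  have "(\<lambda>j. complex_of_real (S j) - (\<integral>u. A j u \<partial>lborel)) \<longlonglongrightarrow> 0"
  proof (rule Lim_null_comparison)
    show "\<forall>\<^sub>F j in sequentially. norm (complex_of_real (S j) - (\<integral>u. A j u \<partial>lborel)) \<le> sqrt (real j) ^ CARD('d) * (exp (- c * real (j - 2)) * I2)"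
      using eventually_ge_at_top[of 2] by eventually_elim (unfold S_def, rule split)
    have "(\<lambda>j. exp (2 * c) * I2 * (sqrt (real j) ^ CARD('d) * exp (- c * real j))) \<longlonglongrightarrow> exp (2 * c) * I2 * 0"
      using c(1) by (intro tendsto_mult tendsto_const) real_asymp
    moreover have "\<forall>\<^sub>F j in sequentially. exp (2 * c) * I2 * (sqrt (real j) ^ CARD('d) * exp (- c * real j))
        = sqrt (real j) ^ CARD('d) * (exp (- c * real (j - 2)) * I2)"
      using eventually_ge_at_top[of 2]
      by eventually_elim (simp add: of_nat_diff algebra_simps exp_diff exp_minus field_simps flip: exp_add)
    ultimately show "(\<lambda>j. sqrt (real j) ^ CARD('d) * (exp (- c * real (j - 2)) * I2)) \<longlonglongrightarrow> 0"
      using Lim_transform_eventually by force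
  qed
  hence "(\<lambda>j. complex_of_real (S (Suc j)) - (\<integral>u. A (Suc j) u \<partial>lborel)) \<longlonglongrightarrow> 0"
    by (rule LIMSEQ_Suc)
  from tendsto_add[OF this lim1]
  have "(\<lambda>j. complex_of_real (S (Suc j))) \<longlonglongrightarrow> of_real (\<integral>u. exp (- quad_form f u / 2) \<partial>lborel)"
    by simp
  hence "S \<longlonglongrightarrow> (\<integral>u. exp (- quad_form f u / 2) \<partial>lborel)"
    by (simp only: tendsto_of_real_iff filterlim_sequentially_Suc)
  hence "(\<lambda>j. S j / (2 * pi) ^ CARD('d)) \<longlonglongrightarrow> (\<integral>u. exp (- quad_form f u / 2) \<partial>lborel) / (2 * pi) ^ CARD('d)"
    by (intro tendsto_divide tendsto_const) auto
  thus "(\<lambda>j. sqrt (real j) ^ CARD('d) * conv_power f j 0)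
      \<longlonglongrightarrow> (\<integral>u. exp (- quad_form f u / 2) \<partial>lborel) / (2 * pi) ^ CARD('d)"
    by (simp add: S_def)
qed

section \<open>Schwartz densities and the two-dimensional Gaussian integral\<close>

lemma integrable_lorentz: "integrable lborel (\<lambda>x::real. 1 / (1 + x\<^sup>2))"
proof -
  have "einterval (- \<infinity>) \<infinity> = UNIV" by (auto simp: einterval_def)
  with Sinc_Integral.integrable_inverse_1_plus_square
  have "integrable lborel (\<lambda>x::real. inverse (1 + x\<^sup>2))"
    by (simp add: set_integrable_def)
  thus ?thesis by (simp add: inverse_eq_divide)
qed

text \<open>The product of the 1 + x_i^2 is at most 2^d (1 + |x|^(2d)), so decay of the orders k and
  k + 2d suffices. The product form is chosen because integrals and lattice sums of it factorise
  over coordinates.\<close>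

lemma schwartz_decay:
  fixes \<phi> :: "real^'d \<Rightarrow> real"
  assumes s: "schwartz \<phi>" and nn: "\<forall>x. \<phi> x \<ge> 0"
  obtains C where "C > 0" "\<And>x. norm x ^ k * \<phi> x \<le> C * (\<Prod>i\<in>UNIV. 1 / (1 + (x $ i)\<^sup>2))"
proof -
  have bdd: "\<exists>B>0. \<forall>x. norm x ^ n * \<phi> x \<le> B" for n
  proof -
    have "bounded (range (\<lambda>x. norm x ^ n * \<phi> x))"
      using s partials_of.self[of \<phi>] by (auto simp: schwartz_def)
    then obtain B where "B > 0" "\<And>x. norm (norm x ^ n * \<phi> x) \<le> B"
      unfolding bounded_pos by auto
    thus ?thesis by (intro exI[of _ B]) (auto intro: order_trans[OF abs_ge_self])
  qed
  define d where "d = CARD('d)"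
  obtain B1 where B1: "B1 > 0" "\<And>x. norm x ^ k * \<phi> x \<le> B1" using bdd by blast
  obtain B2 where B2: "B2 > 0" "\<And>x. norm x ^ (k + 2 * d) * \<phi> x \<le> B2" using bdd by blast
  show ?thesis
  proof (rule that)
    show "2 ^ d * (B1 + B2) > 0" using B1 B2 by simp
    fix x :: "real^'d"
    have prod: "(\<Prod>i\<in>UNIV. 1 + (x $ i)\<^sup>2) \<le> 2 ^ d * (1 + norm x ^ (2 * d))"
    proof -
      have "(\<Prod>i\<in>UNIV. 1 + (x $ i)\<^sup>2) \<le> (\<Prod>i\<in>(UNIV::'d set). 1 + (norm x)\<^sup>2)"
        using power_mono[OF component_le_norm_cart[of x], where n = 2]
        by (intro prod_mono) (auto simp: add_nonneg_nonneg)
      also have "\<dots> = (1 + (norm x)\<^sup>2) ^ d" by (simp add: d_def)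
      also have "\<dots> \<le> (2 * max 1 ((norm x)\<^sup>2)) ^ d" by (intro power_mono) auto
      also have "\<dots> = 2 ^ d * max 1 ((norm x)\<^sup>2) ^ d" by (rule power_mult_distrib)
      also have "max 1 ((norm x)\<^sup>2) ^ d \<le> 1 + norm x ^ (2 * d)"
        by (cases "(norm x)\<^sup>2 \<le> 1") (auto simp: max_def power_mult)
      finally show ?thesis by simp
    qed
    have "norm x ^ k * \<phi> x * (\<Prod>i\<in>UNIV. 1 + (x $ i)\<^sup>2) \<le> norm x ^ k * \<phi> x * (2 ^ d * (1 + norm x ^ (2 * d)))"
      using nn by (intro mult_left_mono prod) auto
    also have "\<dots> = 2 ^ d * (norm x ^ k * \<phi> x + norm x ^ (k + 2 * d) * \<phi> x)"
      by (simp add: power_add algebra_simps)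
    also have "\<dots> \<le> 2 ^ d * (B1 + B2)"
      using B1 B2 by (intro mult_left_mono add_mono) auto
    finally have "norm x ^ k * \<phi> x * (\<Prod>i\<in>UNIV. 1 + (x $ i)\<^sup>2) \<le> 2 ^ d * (B1 + B2)" .
    moreover have "(\<Prod>i\<in>UNIV. 1 + (x $ i)\<^sup>2) > 0"
      by (intro prod_pos) (auto intro: add_pos_nonneg)
    ultimately show "norm x ^ k * \<phi> x \<le> 2 ^ d * (B1 + B2) * (\<Prod>i\<in>UNIV. 1 / (1 + (x $ i)\<^sup>2))"
      by (simp add: prod_dividef field_simps)
  qed
qed

lemma schwartz_density:
  fixes \<phi> :: "real^'d \<Rightarrow> real"
  assumes s: "schwartz \<phi>" and nn: "\<forall>x. \<phi> x \<ge> 0" and one: "(\<integral>x. \<phi> x \<partial>lborel) = 1"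
  shows "nice_density \<phi>" and "integrable lborel (\<lambda>x. norm x ^ 3 * \<phi> x)"
proof -
  have diff: "\<phi> differentiable (at x)" for x
    using s partials_of.self[of \<phi>] by (auto simp: schwartz_def)
  have cont: "continuous_on UNIV \<phi>"
    using diff by (simp add: continuous_on_eq_continuous_at differentiable_imp_continuous_within)
  have [measurable]: "\<phi> \<in> borel_measurable borel"
    by (rule borel_measurable_continuous_onI[OF cont])
  have "bounded (range (\<lambda>x. norm x ^ 0 * \<phi> x))"
    using s partials_of.self[of \<phi>] unfolding schwartz_def by blast
  \<comment> \<open>A non-integrable function has Bochner integral 0 by convention, so integral 1
    implies integrability.\<close>
  moreover have "integrable lborel \<phi>"
    using one not_integrable_integral_eq[of lborel \<phi>] by force
  ultimately show "nice_density \<phi>"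
    using nn cont one by (simp add: nice_density_def)
  obtain C where C: "C > 0" "\<And>x. norm x ^ 3 * \<phi> x \<le> C * (\<Prod>i\<in>UNIV. 1 / (1 + (x $ i)\<^sup>2))"
    using schwartz_decay[OF s nn] by blast
  have "integrable lborel (\<lambda>x::real^'d. C * (\<Prod>i\<in>UNIV. 1 / (1 + (x $ i)\<^sup>2)))"
    by (intro integrable_mult_right integrable_prod_coords integrable_lorentz)
  thus "integrable lborel (\<lambda>x. norm x ^ 3 * \<phi> x)"
  proof (rule Bochner_Integration.integrable_bound)
    show "AE x in lborel. norm (norm x ^ 3 * \<phi> x) \<le> norm (C * (\<Prod>i\<in>UNIV. 1 / (1 + (x $ i)\<^sup>2)))"
      using C nn by (intro AE_I2) (auto intro!: order_trans[OF _ abs_ge_self])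
  qed measurable
qed

lemma two_indices:
  assumes "CARD('d) = 2"
  obtains i k :: 'd where "i \<noteq> k" "UNIV = {i, k}"
  using assms by (auto simp: card_2_iff)

(* The linear change of variables of HOL-Analysis needs a well-ordered index type, hence this
   direct identification of the plane with real \<times> real. *)
lemma lborel_two_coords:
  fixes i k :: "'d::finite"
  assumes ik: "i \<noteq> k" "UNIV = {i, k}"
  shows "(lborel :: (real^'d) measure)
    = distr (lborel \<Otimes>\<^sub>M lborel) borel (\<lambda>(s, t). s *\<^sub>R axis i 1 + t *\<^sub>R axis k 1)"
proof (rule lborel_eqI)
  fix l u :: "real^'d"
  have Basis: "(Basis :: (real^'d) set) = {axis i 1, axis k 1}"
    using ik(2) by (auto simp: Basis_vec_def)
  have ne: "axis i (1::real) \<noteq> axis k 1" using ik(1) by (simp add: axis_eq_axis)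
  assume lu: "\<And>b. b \<in> Basis \<Longrightarrow> l \<bullet> b \<le> u \<bullet> b"
  have le: "l $ i \<le> u $ i" "l $ k \<le> u $ k"
    using lu[of "axis i 1"] lu[of "axis k 1"] by (auto simp: Basis inner_axis)
  have all: "(\<forall>j. P j) \<longleftrightarrow> P i \<and> P k" for P
    using ik(2) by (metis UNIV_I insertE singletonD)
  have vim: "(\<lambda>(s, t). s *\<^sub>R axis i 1 + t *\<^sub>R axis k 1) -` box l u = {l $ i<..<u $ i} \<times> {l $ k<..<u $ k}"
    using ik(1) by (auto simp: mem_box_cart all axis_def)
  have "emeasure (distr (lborel \<Otimes>\<^sub>M lborel) borel (\<lambda>(s, t). s *\<^sub>R axis i 1 + t *\<^sub>R axis k 1)) (box l u)
     = emeasure (lborel \<Otimes>\<^sub>M lborel) ({l $ i<..<u $ i} \<times> {l $ k<..<u $ k})"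
    by (subst emeasure_distr) (auto simp: vim space_pair_measure)
  also have "\<dots> = ennreal (u $ i - l $ i) * ennreal (u $ k - l $ k)"
    using le by (subst lborel.emeasure_pair_measure_Times) auto
  also have "\<dots> = ennreal (\<Prod>b\<in>Basis. (u - l) \<bullet> b)"
    using le ne by (simp add: Basis inner_axis ennreal_mult)
  finally show "emeasure (distr (lborel \<Otimes>\<^sub>M lborel) borel (\<lambda>(s, t). s *\<^sub>R axis i 1 + t *\<^sub>R axis k 1)) (box l u)
    = (\<Prod>b\<in>Basis. (u - l) \<bullet> b)" by simp
qed simp

lemma gauss_integral_real: "s > 0 \<Longrightarrow> (\<integral>t. exp (- (s * t)\<^sup>2 / 2) \<partial>lborel) = sqrt (2 * pi) / s"
proof -
  assume s: "s > 0"
  have "complex_of_real (\<integral>t. exp (- (s * t)\<^sup>2 / 2) \<partial>lborel) = of_real (sqrt (2 * pi) / s)"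
    using integral_gauss_cis_1d[OF s, of 0] by (simp flip: integral_complex_of_real)
  thus ?thesis by (simp only: of_real_eq_iff)
qed

text \<open>Completing the square, a s^2 + 2 b s t + c t^2 = a (s + b t / a)^2 + \<gamma> t^2 with
  \<gamma> = c - b^2 / a. The integral splits into two Gaussians on the line, and a \<gamma> is the
  determinant.\<close>

lemma integral_exp_quad_form_dim2:
  fixes f :: "real^'d \<Rightarrow> real"
  assumes d: "CARD('d) = 2" and f: "nice_density f"
    and m3: "integrable lborel (\<lambda>x. norm x ^ 3 * f x)" and mean: "mean_vec f = 0"
  shows "(\<integral>u. exp (- quad_form f u / 2) \<partial>lborel) = 2 * pi / sqrt (det (cov_mat f))"
proof -
  note [measurable] = nice_densityD(5)[OF f]
  note F = nice_densityD[OF f]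
  obtain i k :: 'd where ik: "i \<noteq> k" "UNIV = {i, k}" using two_indices[OF d] by blast
  define a where "a = cov_mat f $ i $ i"
  define b where "b = cov_mat f $ i $ k"
  define c where "c = cov_mat f $ k $ k"
  have int: "integrable lborel (\<lambda>x. x $ p * x $ q * f x)" for p q
  proof (rule Bochner_Integration.integrable_bound[OF integrable_moments(1)[OF f m3, of 2]])
    have "\<bar>x $ p\<bar> * \<bar>x $ q\<bar> \<le> (norm x)\<^sup>2" for x :: "real^'d"
      unfolding power2_eq_square by (intro mult_mono component_le_norm_cart) auto
    thus "AE x in lborel. norm (x $ p * x $ q * f x) \<le> norm (norm x ^ 2 * f x)"
      using F(1) by (auto simp: abs_mult intro!: mult_right_mono)
  qed auto
  have cov: "cov_mat f $ p $ q = (\<integral>x. x $ p * x $ q * f x \<partial>lborel)" for p q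
    by (simp add: cov_mat_def mean)
  have b': "cov_mat f $ k $ i = b" by (simp add: b_def cov mult_ac)
  have det: "det (cov_mat f) = a * c - b\<^sup>2"
  proof -
    have f12: "finite {k}" "i \<notin> {k}" using ik by auto
    have "det (cov_mat f) = a * c - b * b"
      unfolding det_def ik(2) sum_over_permutations_insert[OF f12] permutes_sing
      using ik(1) by (simp add: sign_swap_id sign_id swap_id_eq a_def b_def c_def b'[unfolded b_def])
    thus ?thesis by (simp add: power2_eq_square)
  qed
  have Q: "quad_form f u = a * (u $ i)\<^sup>2 + 2 * b * (u $ i) * (u $ k) + c * (u $ k)\<^sup>2" for u
  proof -
    have "(u \<bullet> x)\<^sup>2 * f x = (u $ i)\<^sup>2 * (x $ i * x $ i * f x) + 2 * (u $ i) * (u $ k) * (x $ i * x $ k * f x)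
       + (u $ k)\<^sup>2 * (x $ k * x $ k * f x)" for x
      unfolding inner_vec_def ik(2) using ik(1) by (simp add: power2_eq_square algebra_simps)
    hence "quad_form f u = (u $ i)\<^sup>2 * a + 2 * (u $ i) * (u $ k) * b + (u $ k)\<^sup>2 * c"
      unfolding quad_form_def a_def b_def c_def cov using int by simp
    thus ?thesis by (simp add: algebra_simps)
  qed
  have a: "a > 0"
  proof -
    have "axis i (1::real) \<noteq> 0" by (simp add: axis_eq_0_iff)
    from quad_form_pos[OF f m3 mean this] show ?thesis
      unfolding Q using ik(1) by (simp add: axis_def)
  qed
  define \<gamma> where "\<gamma> = c - b\<^sup>2 / a"
  have \<gamma>: "\<gamma> > 0"
  proof -
    \<comment> \<open>At this vector the form takes the value \<open>\<gamma>\<close>: it minimises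
      the form over all vectors e_k + s e_i.\<close>
    have "(axis k 1 - (b / a) *\<^sub>R axis i 1 :: real^'d) \<noteq> 0"
      using ik(1) by (auto simp: vec_eq_iff axis_def intro!: exI[of _ k])
    from quad_form_pos[OF f m3 mean this] show ?thesis
      unfolding Q \<gamma>_def using ik(1) a by (simp add: axis_def power2_eq_square field_simps)
  qed
  define h where "h = (\<lambda>(s, t). exp (- (a * s\<^sup>2 + 2 * b * s * t + c * t\<^sup>2) / 2) :: real)"
  have [measurable]: "h \<in> borel_measurable (borel \<Otimes>\<^sub>M borel)" unfolding h_def by measurable
  have h_eq: "exp (- (quad_form f (case z of (s, t) \<Rightarrow> s *\<^sub>R axis i 1 + t *\<^sub>R axis k 1) / 2)) = h z" for z
    using ik(1) by (cases z) (auto simp: Q h_def axis_def field_simps)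
  have meas: "(\<lambda>u. exp (- quad_form f u / 2)) \<in> borel_measurable borel"
    unfolding Q by measurable
  have J: "(\<integral>u. exp (- quad_form f u / 2) \<partial>lborel) = integral\<^sup>L (lborel \<Otimes>\<^sub>M lborel) h"
    by (subst lborel_two_coords[OF ik], subst integral_distr) (use meas in \<open>auto simp: h_eq\<close>)
  have inth: "integrable (lborel \<Otimes>\<^sub>M lborel) h"
    using conv_power_local_limit(1)[OF f m3 mean]
    by (subst (asm) lborel_two_coords[OF ik], subst (asm) integrable_distr_eq) (use meas in \<open>auto simp: h_eq\<close>)
  have inner: "(\<integral>s. h (s, t) \<partial>lborel) = sqrt (2 * pi) / sqrt a * exp (- (sqrt \<gamma> * t)\<^sup>2 / 2)" for t
  proof -
    define g where "g = (\<lambda>s. exp (- (sqrt a * s)\<^sup>2 / 2))"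
    have "h (s, t) = exp (- (sqrt \<gamma> * t)\<^sup>2 / 2) * g (s - (- (b * t / a)))" for s
      unfolding g_def h_def mult_exp_exp prod.case power_mult_distrib
      using a \<gamma> by (intro arg_cong[of _ _ exp]) (simp add: \<gamma>_def field_simps power2_eq_square)
    hence "(\<integral>s. h (s, t) \<partial>lborel) = exp (- (sqrt \<gamma> * t)\<^sup>2 / 2) * (\<integral>s. g (s - (- (b * t / a))) \<partial>lborel)"
      by simp
    also have "(\<integral>s. g (s - (- (b * t / a))) \<partial>lborel) = (\<integral>s. g s \<partial>lborel)"
      by (rule integral_shift) (simp add: g_def)
    also have "\<dots> = sqrt (2 * pi) / sqrt a"
      unfolding g_def by (rule gauss_integral_real) (use a in simp)
    finally show ?thesis by simp
  qed
  have "integral\<^sup>L (lborel \<Otimes>\<^sub>M lborel) h = (\<integral>t. \<integral>s. h (s, t) \<partial>lborel \<partial>lborel)"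
    using lborel_pair.integral_snd[of "\<lambda>s t. h (s, t)"] inth by simp
  also have "\<dots> = (\<integral>t. sqrt (2 * pi) / sqrt a * exp (- (sqrt \<gamma> * t)\<^sup>2 / 2) \<partial>lborel)"
    by (simp only: inner)
  also have "\<dots> = sqrt (2 * pi) / sqrt a * (sqrt (2 * pi) / sqrt \<gamma>)"
    unfolding integral_mult_right_zero using gauss_integral_real[of "sqrt \<gamma>"] \<gamma> by simp
  also have "\<dots> = 2 * pi / sqrt (a * \<gamma>)"
    by (simp only: times_divide_times_eq real_sqrt_mult[of a \<gamma>] real_sqrt_mult_self) simp
  also have "a * \<gamma> = det (cov_mat f)"
    using a by (simp add: \<gamma>_def det field_simps)
  finally show ?thesis unfolding J .
qed

section \<open>Periodised kernels\<close>

text \<open>Positive and negative integers contribute at most 2 each, by telescoping 1/n^2 \<le>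
  1/(n-1) - 1/n. The term k = 0 counts as 0 because division by zero is 0.\<close>

lemma sum_inverse_squares_le:
  fixes K :: "int set"
  assumes K: "finite K"
  shows "(\<Sum>k\<in>K. 1 / (real_of_int k)\<^sup>2) \<le> 4"
proof -
  have ind: "(\<Sum>n\<in>{1..N}. 1 / (real n)\<^sup>2) \<le> 2 - 1 / real N" for N
  proof (induction N)
    case (Suc N)
    show ?case
    proof (cases "N = 0")
      case False
      hence "1 / (real (Suc N))\<^sup>2 \<le> 1 / real N - 1 / real (Suc N)"
        by (simp add: divide_simps power2_eq_square)
      with Suc show ?thesis by simp
    qed simp
  qed simp
  have nat: "(\<Sum>k\<in>A. 1 / (real_of_int (g k))\<^sup>2) \<le> 2"
    if A: "finite A" "\<And>k. k \<in> A \<Longrightarrow> g k > 0" "inj_on g A" for A :: "int set" and g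
  proof -
    have "(\<Sum>k\<in>A. 1 / (real_of_int (g k))\<^sup>2) = (\<Sum>n\<in>(nat \<circ> g) ` A. 1 / (real n)\<^sup>2)"
    proof (subst sum.reindex)
      show "inj_on (nat \<circ> g) A"
        using A by (auto simp: inj_on_def) (metis eq_nat_nat_iff less_imp_le)
    qed (use A in \<open>auto intro!: sum.cong simp: less_imp_le\<close>)
    also have "\<dots> \<le> (\<Sum>n\<in>{1..Max (insert 0 ((nat \<circ> g) ` A))}. 1 / (real n)\<^sup>2)"
    proof (rule sum_mono2)
      show "(nat \<circ> g) ` A \<subseteq> {1..Max (insert 0 ((nat \<circ> g) ` A))}"
        using A by (force intro: Max_ge)
    qed auto
    also have "\<dots> \<le> 2" by (rule order_trans[OF ind]) simp
    finally show ?thesis .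
  qed
  have "(\<Sum>k\<in>K. 1 / (real_of_int k)\<^sup>2) = (\<Sum>k\<in>K - {0}. 1 / (real_of_int k)\<^sup>2)"
    using K by (intro sum.mono_neutral_right) auto
  also have "K - {0} = {k\<in>K. k > 0} \<union> {k\<in>K. k < 0}" by auto
  also have "(\<Sum>k\<in>\<dots>. 1 / (real_of_int k)\<^sup>2) = (\<Sum>k\<in>{k\<in>K. k > 0}. 1 / (real_of_int k)\<^sup>2) + (\<Sum>k\<in>{k\<in>K. k < 0}. 1 / (real_of_int k)\<^sup>2)"
    using K by (intro sum.union_disjoint) auto
  also have "\<dots> \<le> 2 + 2"
  proof (rule add_mono)
    show "(\<Sum>k\<in>{k\<in>K. k > 0}. 1 / (real_of_int k)\<^sup>2) \<le> 2"
      by (rule nat) (use K in auto)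
    have "(\<Sum>k\<in>{k\<in>K. k < 0}. 1 / (real_of_int (- k))\<^sup>2) \<le> 2"
      by (rule nat) (use K in auto)
    thus "(\<Sum>k\<in>{k\<in>K. k < 0}. 1 / (real_of_int k)\<^sup>2) \<le> 2" by simp
  qed
  finally show ?thesis by simp
qed

text \<open>y' is the representative of y modulo L nearest to 0. The nearest lattice point
  contributes 1/(1 + y'^2). The p-th other one lies at distance at least L |p| / 2, so the others
  contribute at most 16/L^2 together, and this is at most 8/(1 + y'^2) because |y'| \<le> L/2 and L
  \<ge> 2.\<close>

lemma sum_lorentz_le:
  fixes L y :: real and K :: "int set"
  assumes L: "L \<ge> 2" and K: "finite K"
  obtains y' where "\<bar>y'\<bar> \<le> L / 2" "\<exists>m::int. y = y' + L * m"
    "(\<Sum>k\<in>K. 1 / (1 + (L * k - y)\<^sup>2)) \<le> 9 / (1 + y'\<^sup>2)"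
proof -
  define m where "m = round (y / L)"
  define y' where "y' = y - L * m"
  have y': "\<bar>y'\<bar> \<le> L / 2"
  proof -
    have "\<bar>y'\<bar> = L * \<bar>real_of_int m - y / L\<bar>"
      using L by (simp add: y'_def abs_mult_pos' right_diff_distrib abs_minus_commute)
    also have "\<dots> \<le> L * (1 / 2)"
      unfolding m_def using L of_int_round_abs_le[of "y / L"] by (intro mult_left_mono) auto
    finally show ?thesis by simp
  qed
  define h where "h p = (if p = 0 then 1 / (1 + y'\<^sup>2) else 4 / L\<^sup>2 * (1 / (real_of_int p)\<^sup>2))" for p :: int
  have le: "1 / (1 + (L * k - y)\<^sup>2) \<le> h (k - m)" for k
  proof (cases "k = m")
    case True
    thus ?thesis by (simp add: h_def y'_def power2_commute)
  next
    case False
    define p where "p = real_of_int (k - m)"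
    have p: "\<bar>p\<bar> \<ge> 1" using False by (simp add: p_def)
    have eq: "L * k - y = L * p - y'" by (simp add: p_def y'_def algebra_simps)
    have "L * \<bar>p\<bar> / 2 \<le> \<bar>L * p - y'\<bar>"
    proof -
      have "L / 2 \<le> L * \<bar>p\<bar> / 2" using p L by simp
      moreover have "L * \<bar>p\<bar> = \<bar>L * p\<bar>" using L by (simp add: abs_mult)
      ultimately show ?thesis using y' by linarith
    qed
    hence "(L * \<bar>p\<bar> / 2)\<^sup>2 \<le> \<bar>L * p - y'\<bar>\<^sup>2" using L by (intro power_mono) auto
    hence "L\<^sup>2 * p\<^sup>2 / 4 \<le> 1 + (L * k - y)\<^sup>2" unfolding eq by (simp add: power_mult_distrib power_divide)
    moreover have "L\<^sup>2 * p\<^sup>2 / 4 > 0" using L p by auto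
    ultimately have "1 / (1 + (L * k - y)\<^sup>2) \<le> 1 / (L\<^sup>2 * p\<^sup>2 / 4)"
      by (intro divide_left_mono) (auto intro: mult_pos_pos)
    thus ?thesis using False by (simp add: h_def p_def)
  qed
  have "(\<Sum>k\<in>K. 1 / (1 + (L * k - y)\<^sup>2)) \<le> (\<Sum>k\<in>K. h (k - m))"
    by (intro sum_mono le)
  also have "\<dots> = (\<Sum>p\<in>(\<lambda>k. k - m) ` K. h p)"
    by (subst sum.reindex) (auto simp: inj_on_def)
  also have "\<dots> \<le> (\<Sum>p\<in>insert 0 ((\<lambda>k. k - m) ` K). h p)"
    using K L by (intro sum_mono2) (auto simp: h_def)
  also have "\<dots> = h 0 + (\<Sum>p\<in>(\<lambda>k. k - m) ` K - {0}. h p)"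
    using K by (subst sum.insert_remove) auto
  also have "(\<Sum>p\<in>(\<lambda>k. k - m) ` K - {0}. h p) = 4 / L\<^sup>2 * (\<Sum>p\<in>(\<lambda>k. k - m) ` K - {0}. 1 / (real_of_int p)\<^sup>2)"
    by (simp add: h_def sum_distrib_left)
  also have "\<dots> \<le> 4 / L\<^sup>2 * 4"
    using K by (intro mult_left_mono sum_inverse_squares_le) auto
  also have "4 / L\<^sup>2 * 4 \<le> 8 / (1 + y'\<^sup>2)"
  proof -
    have "y'\<^sup>2 \<le> (L / 2)\<^sup>2" using power_mono[OF y', of 2] by simp
    moreover have "2\<^sup>2 \<le> L\<^sup>2" using L by (intro power_mono) auto
    ultimately have "2 * (1 + y'\<^sup>2) \<le> L\<^sup>2" by (simp add: power_divide)
    moreover have "1 + y'\<^sup>2 > 0" by (intro add_pos_nonneg) auto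
    ultimately show ?thesis using L by (simp add: field_simps)
  qed
  finally have "(\<Sum>k\<in>K. 1 / (1 + (L * k - y)\<^sup>2)) \<le> 9 / (1 + y'\<^sup>2)"
    by (simp add: h_def)
  with y' show ?thesis by (intro that[of y']) (auto simp: y'_def)
qed

(* The Poisson kernel sum_m s^|m| e^(i m theta), truncated so that its later expansion under the
   integral sign is a finite sum. *)
definition trig_kernel :: "real \<Rightarrow> nat \<Rightarrow> real \<Rightarrow> complex" where
  "trig_kernel s Q \<theta> = (\<Sum>m\<in>{- int Q..int Q}. of_real (s ^ nat \<bar>m\<bar>) * cis (of_int m * \<theta>))"

text \<open>Geometric summation: the real part of (1 + z)/(1 - z) is the full Poisson kernel, and
  the second term is the truncated tail.\<close>

lemma trig_kernel_eq:
  assumes s: "0 < s" "s < 1"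
  defines "z \<equiv> \<lambda>\<theta>. of_real s * cis \<theta>"
  shows "trig_kernel s Q \<theta> = of_real (Re ((1 + z \<theta>) / (1 - z \<theta>)) - 2 * Re (z \<theta> ^ Suc Q / (1 - z \<theta>)))"
proof -
  have pow: "z \<theta> ^ n = of_real (s ^ n) * cis (real n * \<theta>)" for n
    by (simp add: z_def power_mult_distrib Complex.DeMoivre)
  have nz: "1 - z \<theta> \<noteq> 0"
  proof
    assume "1 - z \<theta> = 0"
    hence "norm (z \<theta>) = 1" by simp
    with s show False by (simp add: z_def norm_mult)
  qed
  have "trig_kernel s Q \<theta> = 1 + (\<Sum>n\<in>{1..Q}. z \<theta> ^ n + cnj (z \<theta> ^ n))"
  proof (induction Q)
    case 0
    show ?case by (simp add: trig_kernel_def)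
  next
    case (Suc Q)
    have "{- int (Suc Q)..int (Suc Q)} = insert (int (Suc Q)) (insert (- int (Suc Q)) {- int Q..int Q})"
      by auto
    hence "trig_kernel s (Suc Q) \<theta> = of_real (s ^ Suc Q) * cis (real (Suc Q) * \<theta>)
        + of_real (s ^ Suc Q) * cis (- (real (Suc Q) * \<theta>)) + trig_kernel s Q \<theta>"
      by (simp add: trig_kernel_def nat_add_distrib left_diff_distrib distrib_right del: power_Suc)
    also have "of_real (s ^ Suc Q) * cis (real (Suc Q) * \<theta>) = z \<theta> ^ Suc Q" by (rule pow[symmetric])
    also have "of_real (s ^ Suc Q) * cis (- (real (Suc Q) * \<theta>)) = cnj (z \<theta> ^ Suc Q)"
      unfolding pow by (simp add: cis_cnj)
    finally show ?case using Suc by simp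
  qed
  also have "\<dots> = of_real (1 + 2 * (\<Sum>n\<in>{1..Q}. Re (z \<theta> ^ n)))"
    by (simp only: complex_add_cnj of_real_add of_real_sum of_real_mult of_real_1 of_real_numeral sum_distrib_left)
  also have "(\<Sum>n\<in>{1..Q}. Re (z \<theta> ^ n)) = Re (\<Sum>n\<in>{1..Q}. z \<theta> ^ n)" by simp
  also have "(\<Sum>n\<in>{1..Q}. z \<theta> ^ n) = (z \<theta> - z \<theta> ^ Suc Q) / (1 - z \<theta>)"
  proof -
    have "(\<Sum>n\<in>{1..Q}. z \<theta> ^ n) * (1 - z \<theta>) = z \<theta> - z \<theta> ^ Suc Q"
    proof (induction Q)
      case (Suc Q)
      have "(\<Sum>n\<in>{1..Suc Q}. z \<theta> ^ n) * (1 - z \<theta>) = (\<Sum>n\<in>{1..Q}. z \<theta> ^ n) * (1 - z \<theta>) + z \<theta> ^ Suc Q * (1 - z \<theta>)"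
        by (simp add: distrib_right)
      also have "\<dots> = z \<theta> - z \<theta> ^ Suc (Suc Q)"
        unfolding Suc by (simp add: algebra_simps)
      finally show ?case .
    qed simp
    thus ?thesis using nz by (simp add: nonzero_eq_divide_eq)
  qed
  also have "1 + 2 * Re \<dots> = Re (1 + 2 * ((z \<theta> - z \<theta> ^ Suc Q) / (1 - z \<theta>)))"
  proof -
    have "1 + 2 * Re x = Re (1 + 2 * x)" for x by simp
    thus ?thesis .
  qed
  also have "1 + 2 * ((z \<theta> - z \<theta> ^ Suc Q) / (1 - z \<theta>)) = (1 + z \<theta>) / (1 - z \<theta>) - 2 * (z \<theta> ^ Suc Q / (1 - z \<theta>))"
  proof -
    have "(1 + z \<theta>) / (1 - z \<theta>) = 1 + 2 * (z \<theta> / (1 - z \<theta>))"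
      using nz by (simp add: field_simps)
    thus ?thesis by (simp add: diff_divide_distrib right_diff_distrib)
  qed
  also have "Re (a - 2 * w) = Re a - 2 * Re w" for a w by simp
  finally show ?thesis .
qed

text \<open>With s = 1 - 1/L the Poisson kernel (1 - s^2)/(1 - 2 s cos \<theta> + s^2) at \<theta> =
  2 pi y / L has a peak of height of order L and, measured in y, of width of order 1. Divided by L
  it therefore dominates the periodised Lorentzian up to a constant.\<close>

lemma trig_kernel_majorant:
  fixes L :: real
  assumes L: "L \<ge> 2"
  obtains Q where "\<And>\<theta>. Im (trig_kernel (1 - 1 / L) Q \<theta>) = 0"
    and "\<And>y K. finite K \<Longrightarrow> (\<Sum>k\<in>K. 1 / (1 + (L * real_of_int k - y)\<^sup>2)) \<le> 800 / L * Re (trig_kernel (1 - 1 / L) Q (2 * pi * y / L))"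
proof -
  define s where "s = 1 - 1 / L"
  have s: "0 < s" "s < 1" "s \<ge> 1 / 2" using L by (auto simp: s_def field_simps)
  have "(\<lambda>n. s ^ n) \<longlonglongrightarrow> 0" using s by (intro LIMSEQ_realpow_zero) auto
  \<comment> \<open>This threshold bounds the truncation error by (1 - s)/4, half of the lower bound
    (1 - s)/2 for the kernel, so truncation loses at most a factor 2.\<close>
  hence "\<forall>\<^sub>F n in sequentially. s ^ n < (1 - s)\<^sup>2 / 8"
    using s by (intro order_tendstoD(2)) auto
  then obtain n where n: "\<And>n'. n' \<ge> n \<Longrightarrow> s ^ n' < (1 - s)\<^sup>2 / 8"
    by (auto simp: eventually_sequentially)
  define Q where "Q = n"
  have Q: "s ^ Suc Q < (1 - s)\<^sup>2 / 8" using n[of "Suc Q"] by (simp add: Q_def)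
  have low: "Re (trig_kernel s Q \<theta>) \<ge> (1 - s\<^sup>2) / (1 - 2 * s * cos \<theta> + s\<^sup>2) / 2"
    and pos: "1 - 2 * s * cos \<theta> + s\<^sup>2 > 0" for \<theta>
  proof -
    define z where "z = of_real s * cis \<theta>"
    have nz: "norm z = s" using s by (simp add: z_def norm_mult)
    have n1: "norm (1 - z) \<ge> 1 - s" using norm_triangle_ineq2[of 1 z] nz by simp
    have sq: "(norm (1 - z))\<^sup>2 = 1 - 2 * s * cos \<theta> + s\<^sup>2"
    proof -
      have "(norm (1 - z))\<^sup>2 = (1 - s * cos \<theta>)\<^sup>2 + (s * sin \<theta>)\<^sup>2"
        by (simp add: cmod_power2 z_def)
      also have "\<dots> = 1 - 2 * s * cos \<theta> + s\<^sup>2 * ((cos \<theta>)\<^sup>2 + (sin \<theta>)\<^sup>2)"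
        by algebra
      finally show ?thesis by simp
    qed
    show pos: "1 - 2 * s * cos \<theta> + s\<^sup>2 > 0"
      unfolding sq[symmetric] using n1 s by auto
    have "Re ((1 + z) / (1 - z)) = (1 - s\<^sup>2) / (1 - 2 * s * cos \<theta> + s\<^sup>2)"
    proof -
      have "Re ((1 + z) / (1 - z)) = Re ((1 + z) * cnj (1 - z)) / (norm (1 - z))\<^sup>2"
        by (simp add: complex_div_cnj[of "1 + z"] Re_divide_of_real flip: of_real_power)
      also have "Re ((1 + z) * cnj (1 - z)) = 1 - (norm z)\<^sup>2"
        unfolding cmod_power2 by (simp add: power2_eq_square algebra_simps)
      finally show ?thesis by (simp add: sq nz)
    qed
    moreover have "\<bar>Re (z ^ Suc Q / (1 - z))\<bar> \<le> (1 - s) / 8"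
    proof -
      have "\<bar>Re (z ^ Suc Q / (1 - z))\<bar> \<le> norm (z ^ Suc Q / (1 - z))" by (rule abs_Re_le_cmod)
      also have "\<dots> = s ^ Suc Q / norm (1 - z)" by (simp add: norm_divide norm_power norm_mult nz)
      also have "\<dots> \<le> ((1 - s)\<^sup>2 / 8) / (1 - s)"
        using Q n1 s by (intro frac_le) auto
      also have "\<dots> = (1 - s) / 8" using s by (subst nonzero_divide_eq_eq) (auto simp: power2_eq_square)
      finally show ?thesis .
    qed
    moreover have "(1 - s) / 2 \<le> (1 - s\<^sup>2) / (1 - 2 * s * cos \<theta> + s\<^sup>2)"
    proof -
      have "- (s * cos \<theta>) \<le> s" using mult_left_mono[of "- cos \<theta>" 1 s] cos_ge_minus_one[of \<theta>] s by simp
      hence "1 - 2 * s * cos \<theta> + s\<^sup>2 \<le> (1 + s)\<^sup>2" by (simp add: power2_eq_square algebra_simps)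
      hence "(1 - s\<^sup>2) / (1 + s)\<^sup>2 \<le> (1 - s\<^sup>2) / (1 - 2 * s * cos \<theta> + s\<^sup>2)"
        using pos s by (intro divide_left_mono) (auto simp: power2_eq_square mult_le_one)
      moreover have "(1 - s\<^sup>2) / (1 + s)\<^sup>2 = (1 - s) / (1 + s)"

      proof (subst frac_eq_eq)
        show "(1 - s\<^sup>2) * (1 + s) = (1 - s) * (1 + s)\<^sup>2"
          by (simp add: power2_eq_square algebra_simps)
      qed (use s in auto)
      moreover have "(1 - s) / 2 \<le> (1 - s) / (1 + s)" using s by (intro divide_left_mono) auto
      ultimately show ?thesis by linarith
    qed
    moreover have "Re (trig_kernel s Q \<theta>) = Re ((1 + z) / (1 - z)) - 2 * Re (z ^ Suc Q / (1 - z))"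
      using trig_kernel_eq[OF s(1,2), of Q \<theta>] by (simp add: z_def)
    moreover have "p / 2 \<le> R" if "A = p" "\<bar>e\<bar> \<le> (1 - s) / 8" "(1 - s) / 2 \<le> p" "R = A - 2 * e" for A R e p :: real
      using that by linarith
    ultimately show "Re (trig_kernel s Q \<theta>) \<ge> (1 - s\<^sup>2) / (1 - 2 * s * cos \<theta> + s\<^sup>2) / 2"
      by blast
  qed
  show ?thesis
  proof (rule that[of Q])
    show "Im (trig_kernel (1 - 1 / L) Q \<theta>) = 0" for \<theta>
      using trig_kernel_eq[OF s(1,2), of Q \<theta>] by (simp add: s_def)
    fix y :: real and K :: "int set" assume K: "finite K"
    obtain y' m where y': "\<bar>y'\<bar> \<le> L / 2" "y = y' + L * of_int m"
      "(\<Sum>k\<in>K. 1 / (1 + (L * k - y)\<^sup>2)) \<le> 9 / (1 + y'\<^sup>2)"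
      using sum_lorentz_le[OF L K, of y] by blast
    define \<theta> where "\<theta> = 2 * pi * y / L"
    define \<theta>' where "\<theta>' = 2 * pi * y' / L"
    have "\<theta> = \<theta>' + 2 * pi * of_int m" using L by (simp add: \<theta>_def \<theta>'_def y'(2) field_simps)
    hence "cos \<theta> = cos \<theta>'" by (simp only: cos_add cos_int_2pin sin_int_2pin)
    moreover have "1 - cos \<theta>' \<le> \<theta>'\<^sup>2 / 2"
    proof -
      have "1 - cos \<theta>' = 2 * \<bar>sin (\<theta>' / 2)\<bar>\<^sup>2" using cos_double_sin[of "\<theta>' / 2"] by simp
      also have "\<dots> \<le> 2 * \<bar>\<theta>' / 2\<bar>\<^sup>2"
        by (intro mult_left_mono power_mono abs_sin_x_le_abs_x) auto
      finally show ?thesis by (simp add: power_divide)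
    qed
    ultimately have c: "1 - cos \<theta> \<le> \<theta>'\<^sup>2 / 2" by simp
    have d: "1 - 2 * s * cos \<theta> + s\<^sup>2 \<le> 40 * (1 + y'\<^sup>2) / L\<^sup>2"
    proof -
      have "1 - 2 * s * cos \<theta> + s\<^sup>2 = (1 - s)\<^sup>2 + 2 * s * (1 - cos \<theta>)" by (simp add: power2_eq_square algebra_simps)
      also have "2 * s * (1 - cos \<theta>) \<le> 2 * 1 * (\<theta>'\<^sup>2 / 2)"
        using s c by (intro mult_mono) auto
      also have "(1 - s)\<^sup>2 + 2 * 1 * (\<theta>'\<^sup>2 / 2) = (1 + 4 * pi\<^sup>2 * y'\<^sup>2) / L\<^sup>2"
        using L by (simp add: s_def \<theta>'_def power_divide power_mult_distrib add_divide_distrib)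
      also have "\<dots> \<le> 40 * (1 + y'\<^sup>2) / L\<^sup>2"
      proof (rule divide_right_mono)
        have "pi\<^sup>2 \<le> 3.15\<^sup>2" using pi_approx by (intro power_mono) auto
        hence "4 * pi\<^sup>2 \<le> 40" by (simp add: power2_eq_square)
        hence "4 * pi\<^sup>2 * y'\<^sup>2 \<le> 40 * y'\<^sup>2" by (intro mult_right_mono) auto
        thus "1 + 4 * pi\<^sup>2 * y'\<^sup>2 \<le> 40 * (1 + y'\<^sup>2)" by simp
      qed auto
      finally show ?thesis by simp
    qed
    have s2: "1 - s\<^sup>2 \<ge> 1 / L"
    proof -
      have "s\<^sup>2 \<le> s" using s by (simp add: power2_eq_square mult_left_le)
      thus ?thesis by (simp add: s_def)
    qed
    have "1 / L > 0" using L by simp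
    with s2 have s21: "s\<^sup>2 \<le> 1" by linarith
    have yp: "1 + y'\<^sup>2 > 0" by (intro add_pos_nonneg) auto
    \<comment> \<open>The 40 bounds 4 pi^2 in the denominator of the kernel and the final 2 pays for
      truncation; 800 = 2 * 40 * 10 then leaves 10 where 9 is required.\<close>
    have "800 / L * (1 / L / (40 * Y / L\<^sup>2) / 2) = 10 / Y" if "Y > 0" for Y
      using L that by (simp add: power2_eq_square field_simps)
    from this[OF yp] have "9 / (1 + y'\<^sup>2) \<le> 800 / L * (1 / L / (40 * (1 + y'\<^sup>2) / L\<^sup>2) / 2)"
      using yp by (simp add: divide_right_mono)
    also have "\<dots> \<le> 800 / L * ((1 - s\<^sup>2) / (1 - 2 * s * cos \<theta> + s\<^sup>2) / 2)"
      using s2 d pos[of \<theta>] L yp s21 by (intro mult_left_mono divide_right_mono frac_le) auto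
    also have "\<dots> \<le> 800 / L * Re (trig_kernel s Q \<theta>)"
      using L by (intro mult_left_mono low) auto
    finally show "(\<Sum>k\<in>K. 1 / (1 + (L * real_of_int k - y)\<^sup>2)) \<le> 800 / L * Re (trig_kernel (1 - 1 / L) Q (2 * pi * y / L))"
      using y'(3) by (simp add: s_def \<theta>_def)
  qed
qed

section \<open>Lattice sums of convolution powers\<close>

lemma prod_sum_PiE:
  fixes g :: "'a \<Rightarrow> 'b \<Rightarrow> 'c::comm_semiring_1"
  assumes "finite A" and B: "finite B"
  shows "(\<Prod>i\<in>A. \<Sum>m\<in>B. g i m) = (\<Sum>f\<in>PiE A (\<lambda>_. B). \<Prod>i\<in>A. g i (f i))"
  using assms(1)
proof induction
  case (insert x A)
  have inj: "inj_on (\<lambda>(y, f). f(x := y)) (B \<times> PiE A (\<lambda>_. B))"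
    using inj_combinator[OF insert(2), of "\<lambda>_. B"] by simp
  have "(\<Sum>f\<in>PiE (insert x A) (\<lambda>_. B). \<Prod>i\<in>insert x A. g i (f i))
     = (\<Sum>(y, f)\<in>B \<times> PiE A (\<lambda>_. B). \<Prod>i\<in>insert x A. g i ((f(x := y)) i))"
    unfolding PiE_insert_eq by (subst sum.reindex[OF inj]) (simp add: case_prod_unfold)
  also have "\<dots> = (\<Sum>(y, f)\<in>B \<times> PiE A (\<lambda>_. B). g x y * (\<Prod>i\<in>A. g i (f i)))"
  proof (intro sum.cong refl, clarify)
    fix y f
    have "(\<Prod>i\<in>A. g i ((f(x := y)) i)) = (\<Prod>i\<in>A. g i (f i))"
      using insert(2) by (intro prod.cong) auto
    thus "(\<Prod>i\<in>insert x A. g i ((f(x := y)) i)) = g x y * (\<Prod>i\<in>A. g i (f i))"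
      using insert(1,2) by simp
  qed
  also have "\<dots> = (\<Sum>m\<in>B. g x m) * (\<Sum>f\<in>PiE A (\<lambda>_. B). \<Prod>i\<in>A. g i (f i))"
    by (simp add: sum_product sum.cartesian_product)
  finally show ?case using insert by simp
qed simp

text \<open>Every finite set of lattice points lies in a box, a power of one finite set of integers,
  and over boxes the product bounds factorise.\<close>

lemma summable_on_int_lattice:
  fixes g :: "real^'d \<Rightarrow> real"
  assumes nn: "\<And>x. g x \<ge> 0"
    and B: "\<And>K. finite K \<Longrightarrow> (\<Sum>f\<in>PiE UNIV (\<lambda>_. K). g (\<chi> i. of_int (f i))) \<le> B"
  shows "g summable_on int_lattice" and "infsum g int_lattice \<le> B"
proof -
  have le: "sum g F \<le> B" if F: "finite F" "F \<subseteq> int_lattice" for F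
  proof -
    define K where "K = (\<Union>x\<in>F. range (\<lambda>i. \<lfloor>x $ i\<rfloor>))"
    have K: "finite K" unfolding K_def using F by auto
    define e where "e f = (\<chi> i. real_of_int (f i))" for f :: "'d \<Rightarrow> int"
    have inj: "inj e" by (auto simp: inj_def e_def vec_eq_iff)
    have "F \<subseteq> e ` PiE UNIV (\<lambda>_. K)"
    proof
      fix x assume x: "x \<in> F"
      have "x = e (\<lambda>i. \<lfloor>x $ i\<rfloor>)"
        using F(2) x by (auto simp: e_def vec_eq_iff int_lattice_def elim!: Ints_cases)
      moreover have "(\<lambda>i. \<lfloor>x $ i\<rfloor>) \<in> PiE UNIV (\<lambda>_. K)" using x by (auto simp: K_def)
      ultimately show "x \<in> e ` PiE UNIV (\<lambda>_. K)" by blast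
    qed
    hence "sum g F \<le> sum g (e ` PiE UNIV (\<lambda>_. K))"
      using K nn by (intro sum_mono2) (auto intro!: finite_PiE)
    also have "\<dots> = (\<Sum>f\<in>PiE UNIV (\<lambda>_. K). g (e f))"
      by (subst sum.reindex) (auto intro: inj_on_subset[OF inj])
    also have "\<dots> \<le> B" unfolding e_def by (rule B[OF K])
    finally show ?thesis .
  qed
  show s: "g summable_on int_lattice"
    by (rule nonneg_bdd_above_summable_on) (use nn le in \<open>auto intro!: bdd_aboveI[of _ B]\<close>)
  show "infsum g int_lattice \<le> B"
    by (rule infsum_le_finite_sums[OF s]) (use le in auto)
qed

lemma exp_neg_le_inverse_sqrt: "x > 0 \<Longrightarrow> exp (- x) \<le> 1 / sqrt x" for x :: real
proof -
  assume x: "x > 0"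
  have "sqrt x \<le> 1 + x"
  proof (rule real_le_lsqrt)
    show "x \<le> (1 + x)\<^sup>2" using x by (simp add: power2_eq_square algebra_simps)
  qed (use x in auto)
  also have "\<dots> \<le> exp x" by (rule exp_ge_add_one_self)
  finally have "1 / exp x \<le> 1 / sqrt x" using x by (intro divide_left_mono) auto
  thus ?thesis by (simp add: exp_minus inverse_eq_divide)
qed

lemma sum_symmetric_int:
  fixes g :: "int \<Rightarrow> real"
  assumes "\<And>m. g (- m) = g m"
  shows "(\<Sum>m\<in>{- int Q..int Q}. g m) = g 0 + 2 * (\<Sum>n\<in>{1..Q}. g (int n))"
proof (induction Q)
  case (Suc Q)
  have "{- int (Suc Q)..int (Suc Q)} = insert (int (Suc Q)) (insert (- int (Suc Q)) {- int Q..int Q})"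
    by auto
  hence "(\<Sum>m\<in>{- int (Suc Q)..int (Suc Q)}. g m) = g (int (Suc Q)) + g (- int (Suc Q)) + (\<Sum>m\<in>{- int Q..int Q}. g m)"
    by simp
  with Suc show ?case by (simp only: assms) simp
qed simp

lemma sum_geometric_le:
  fixes q :: real
  assumes "0 \<le> q" "q < 1"
  shows "(\<Sum>n\<in>{1..Q}. q ^ n) \<le> q / (1 - q)"
proof -
  have "(\<Sum>n\<in>{1..Q}. q ^ n) * (1 - q) = q - q ^ Suc Q"
  proof (induction Q)
    case (Suc Q)
    have "(\<Sum>n\<in>{1..Suc Q}. q ^ n) * (1 - q) = (\<Sum>n\<in>{1..Q}. q ^ n) * (1 - q) + q ^ Suc Q * (1 - q)"
      by (simp add: distrib_right)
    also have "\<dots> = q - q ^ Suc (Suc Q)"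
      unfolding Suc by (simp add: algebra_simps)
    finally show ?case .
  qed simp
  also have "\<dots> \<le> q" using assms by simp
  finally show ?thesis using assms by (simp add: pos_le_divide_eq)
qed

text \<open>While |2 pi m / L| \<le> 1 the terms are Gaussian in m on the scale L / sqrt (c j).
  Beyond that the factor exp (- c (j - 1)) is tiny, and the damping (1 - 1/L)^|m| keeps the sum
  below L uniformly in \<open>Q\<close>. The exponent is j - 1 because one of the j factors of the
  convolution is spent on the majorant.\<close>

lemma kernel_sum_le:
  fixes L c :: real
  assumes L: "L \<ge> 2" and c: "c > 0" and j: "j \<ge> 2"
  shows "(\<Sum>m\<in>{- int Q..int Q}. (1 - 1 / L) ^ nat \<bar>m\<bar> * exp (- c * min ((2 * pi * m / L)\<^sup>2) 1) ^ (j - 1))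
    \<le> 1 + 8 / sqrt c * (L / sqrt (real j))"
proof -
  define s where "s = 1 - 1 / L"
  have s: "0 < s" "s < 1" using L by (auto simp: s_def)
  define x where "x = c * real (j - 1)"
  have x: "x > 0" using c j by (simp add: x_def)
  define b where "b = sqrt x / L"
  have b: "b > 0" using x L by (simp add: b_def)
  define g where "g m = s ^ nat \<bar>m\<bar> * exp (- c * min ((2 * pi * m / L)\<^sup>2) 1) ^ (j - 1)" for m :: int
  have "(\<Sum>m\<in>{- int Q..int Q}. g m) = g 0 + 2 * (\<Sum>n\<in>{1..Q}. g (int n))"
    by (rule sum_symmetric_int) (simp add: g_def)
  also have "g 0 = 1" by (simp add: g_def)
  also have "(\<Sum>n\<in>{1..Q}. g (int n)) \<le> (\<Sum>n\<in>{1..Q}. exp 1 * exp (- 2 * b) ^ n + exp (- x) * s ^ n)"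
  proof (rule sum_mono)
    fix n assume n: "n \<in> {1..Q}"
    have "exp (- c * min ((2 * pi * n / L)\<^sup>2) 1) ^ (j - 1) = exp (- x * min ((2 * pi * n / L)\<^sup>2) 1)"
      unfolding x_def exp_of_nat_mult[symmetric] by (simp add: mult_ac)
    hence g: "g (int n) = s ^ n * exp (- x * min ((2 * pi * n / L)\<^sup>2) 1)" by (simp add: g_def)
    show "g (int n) \<le> exp 1 * exp (- 2 * b) ^ n + exp (- x) * s ^ n"
    proof (cases "(2 * pi * n / L)\<^sup>2 \<le> 1")
      case True
      have "1 \<le> (2 * pi)\<^sup>2" using pi_gt3 by (intro one_le_power) auto
      hence "x * (n / L)\<^sup>2 * 1 \<le> x * (n / L)\<^sup>2 * (2 * pi)\<^sup>2" using x by (intro mult_left_mono) auto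
      also have "\<dots> = x * (2 * pi * n / L)\<^sup>2" by (simp add: power_mult_distrib power_divide)
      finally have 1: "x * (n / L)\<^sup>2 \<le> x * (2 * pi * n / L)\<^sup>2" by simp
      (* (b n)^2 >= 2 b n - 1 turns the Gaussian sum into a geometric one *)
      have "x * (n / L)\<^sup>2 = (b * n)\<^sup>2" using x by (simp add: b_def power_mult_distrib power_divide)
      also have "\<dots> \<ge> 2 * (b * n) - 1"
        using zero_le_power2[of "b * n - 1"] by (simp add: power2_eq_square algebra_simps)
      finally have "- x * (2 * pi * n / L)\<^sup>2 \<le> 1 + real n * (- 2 * b)" using 1 by (simp add: algebra_simps)
      hence "exp (- x * (2 * pi * n / L)\<^sup>2) \<le> exp (1 + real n * (- 2 * b))" by (simp only: exp_le_cancel_iff)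
      also have "\<dots> = exp 1 * exp (- 2 * b) ^ n" by (simp only: exp_add exp_of_nat_mult)
      finally have "exp (- x * (2 * pi * n / L)\<^sup>2) \<le> exp 1 * exp (- 2 * b) ^ n" .
      moreover have "g (int n) \<le> exp (- x * (2 * pi * n / L)\<^sup>2)"
        unfolding g using True s by (simp add: min_def mult_left_le_one_le power_le_one)
      moreover have "exp (- x) * s ^ n \<ge> 0" using s by simp
      ultimately show ?thesis by linarith
    next
      case False
      hence "g (int n) = exp (- x) * s ^ n" by (simp add: g min_def)
      thus ?thesis by simp
    qed
  qed
  also have "\<dots> = exp 1 * (\<Sum>n\<in>{1..Q}. exp (- 2 * b) ^ n) + exp (- x) * (\<Sum>n\<in>{1..Q}. s ^ n)"
    by (simp add: sum.distrib sum_distrib_left)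
  also have "\<dots> \<le> 3 * (1 / (2 * b)) + 1 / sqrt x * L"
  proof (intro add_mono mult_mono)
    show "exp 1 \<le> (3 :: real)" using exp_le by simp
    have "(\<Sum>n\<in>{1..Q}. exp (- 2 * b) ^ n) \<le> exp (- 2 * b) / (1 - exp (- 2 * b))"
      by (rule sum_geometric_le) (use b in auto)
    also have "\<dots> = 1 / (exp (2 * b) - 1)"
    proof -
      have "exp (2 * b) * exp (- 2 * b) = 1" by (simp flip: exp_add)
      moreover have "exp (2 * b) > 1" "exp (- 2 * b) < 1" using b by auto
      ultimately show ?thesis by (subst frac_eq_eq) (auto simp: algebra_simps)
    qed
    also have "\<dots> \<le> 1 / (2 * b)"
    proof (rule divide_left_mono)
      show e: "2 * b \<le> exp (2 * b) - 1" using exp_ge_add_one_self[of "2 * b"] by linarith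
      show "0 < (exp (2 * b) - 1) * (2 * b)" using b e by (intro mult_pos_pos) linarith+
    qed simp
    finally show "(\<Sum>n\<in>{1..Q}. exp (- 2 * b) ^ n) \<le> 1 / (2 * b)" .
    show "exp (- x) \<le> 1 / sqrt x" by (rule exp_neg_le_inverse_sqrt[OF x])
    have "(\<Sum>n\<in>{1..Q}. s ^ n) \<le> s / (1 - s)" by (rule sum_geometric_le) (use s in auto)
    also have "\<dots> = s * L" using L by (simp add: s_def)
    also have "\<dots> \<le> L" using s L by (intro mult_left_le_one_le) auto
    finally show "(\<Sum>n\<in>{1..Q}. s ^ n) \<le> L" .
  qed (use s x in \<open>auto intro!: sum_nonneg\<close>)
  also have "3 * (1 / (2 * b)) + 1 / sqrt x * L = 5 / 2 * (L / sqrt x)"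
    by (simp add: b_def field_simps)
  also have "\<dots> \<le> 5 / 2 * (L * (sqrt 2 / (sqrt c * sqrt (real j))))"
  proof (intro mult_left_mono)
    have "c * real j \<le> 2 * x" using j c by (simp add: x_def of_nat_diff)
    hence "sqrt (c * real j) \<le> sqrt (2 * x)" by (rule real_sqrt_le_mono)
    hence "sqrt c * sqrt (real j) \<le> sqrt 2 * sqrt x" by (simp add: real_sqrt_mult)
    hence "1 / sqrt x \<le> sqrt 2 / (sqrt c * sqrt (real j))" using c j x by (simp add: field_simps)
    hence "L * (1 / sqrt x) \<le> L * (sqrt 2 / (sqrt c * sqrt (real j)))" using L by (intro mult_left_mono) auto
    thus "L / sqrt x \<le> L * (sqrt 2 / (sqrt c * sqrt (real j)))" by simp
  qed auto
  also have "\<dots> = 5 / 2 * sqrt 2 * (L / (sqrt c * sqrt (real j)))" by simp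
  also have "\<dots> \<le> 4 * (L / (sqrt c * sqrt (real j)))"
  proof (intro mult_right_mono)
    have "sqrt 2 \<le> 3 / 2" by (rule real_le_lsqrt) (auto simp: power2_eq_square)
    thus "5 / 2 * sqrt 2 \<le> (4 :: real)" by simp
  qed (use L c in auto)
  finally show ?thesis by (simp add: g_def s_def)
qed

text \<open>\<open>conv_power\<close> puts the base density into the unshifted slot. The commuted
  form moves the shift onto it, where the lattice sum can be taken under the integral.\<close>

lemma conv_commute:
  fixes f g :: "real^'d \<Rightarrow> real"
  assumes [measurable]: "f \<in> borel_measurable borel" "g \<in> borel_measurable borel"
  shows "conv f g x = (\<integral>y. g y * f (x - y) \<partial>lborel)"
proof -
  define h where "h y = g y * f (x - y)" for y
  have [measurable]: "h \<in> borel_measurable borel" unfolding h_def by measurable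
  have "integral\<^sup>L lborel h = (\<integral>y. h (- y) \<partial>lborel)"
    using integral_scale[of h "-1"] by simp
  also have "\<dots> = (\<integral>y. h (- (y - x)) \<partial>lborel)"
    by (rule integral_shift[symmetric]) measurable
  also have "\<dots> = conv f g x" by (simp add: h_def conv_def mult.commute)
  finally show ?thesis unfolding h_def[abs_def] ..
qed

text \<open>For j \<ge> 2 one factor \<open>\<phi>\<close> is summed over the lattice and bounded by
  a trigonometric polynomial with nonnegative coefficients. Integrating it against the density of
  the other j - 1 factors evaluates their Fourier transform at points of the dual lattice, where the
  decay bound splits into a product of one-dimensional kernel sums. All estimates are over finite
  boxes and independent of the box.\<close>

theorem lattice_sum_conv_power_le:
  fixes \<phi> :: "real^'d \<Rightarrow> real"
  assumes f: "nice_density \<phi>" and C0: "C0 > 0"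
    and decay: "\<And>x. \<phi> x \<le> C0 * (\<Prod>i\<in>UNIV. 1 / (1 + (x $ i)\<^sup>2))"
  obtains C where "C > 0"
    and "\<And>L j. L \<ge> 2 \<Longrightarrow> j \<ge> 1 \<Longrightarrow> (\<lambda>k. conv_power \<phi> j (L *\<^sub>R k)) summable_on int_lattice"
    and "\<And>L j. L \<ge> 2 \<Longrightarrow> j \<ge> 1 \<Longrightarrow> L ^ CARD('d) * infsum (\<lambda>k. conv_power \<phi> j (L *\<^sub>R k)) int_lattice
           \<le> C * (1 + L / sqrt (real j)) ^ CARD('d)"
proof -
  define d where "d = CARD('d)"
  obtain c where c: "c > 0" "\<And>\<xi>. norm (ft \<phi> \<xi>) \<le> exp (- c * (\<Sum>i\<in>UNIV. min ((\<xi> $ i)\<^sup>2) 1))"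
    using norm_ft_decay_prod[OF f] by metis
  define C1 where "C1 = 1 + 8 / sqrt c"
  have C1: "C1 \<ge> 1" using c by (simp add: C1_def)
  define C where "C = C0 * (800 * C1) ^ d"
  have C: "C > 0" using C0 C1 by (simp add: C_def)
  have box: "(\<Sum>f\<in>PiE UNIV (\<lambda>_. K). conv_power \<phi> j (L *\<^sub>R (\<chi> i. of_int (f i)))) \<le> C * (1 + L / sqrt (real j)) ^ d / L ^ d"
    if L: "L \<ge> 2" and j: "j \<ge> 1" and K: "finite K" for L :: real and j K
  proof -
    have phi_sum: "(\<Sum>f\<in>PiE UNIV (\<lambda>_. K). \<phi> (L *\<^sub>R (\<chi> i. of_int (f i)) - y)) \<le> C0 * (\<Prod>i\<in>UNIV. \<Sum>m\<in>K. 1 / (1 + (L * of_int m - y $ i)\<^sup>2))" for y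
    proof -
      have "(\<Sum>f\<in>PiE UNIV (\<lambda>_. K). \<phi> (L *\<^sub>R (\<chi> i. of_int (f i)) - y)) \<le> (\<Sum>f\<in>PiE UNIV (\<lambda>_. K). C0 * (\<Prod>i\<in>UNIV. 1 / (1 + (L * of_int (f i) - y $ i)\<^sup>2)))"
        by (rule sum_mono) (rule order_trans[OF decay], simp)
      also have "\<dots> = C0 * (\<Prod>i\<in>UNIV. \<Sum>m\<in>K. 1 / (1 + (L * of_int m - y $ i)\<^sup>2))"
        by (subst prod_sum_PiE) (use K in \<open>auto simp: sum_distrib_left\<close>)
      finally show ?thesis .
    qed
    show ?thesis
    \<comment> \<open>For j = 1 there is no second density to integrate against; the decay of
      \<open>\<phi>\<close> is summed directly over the lattice.\<close>
    proof (cases "j = 1")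
      case True
      have "(\<Sum>f\<in>PiE UNIV (\<lambda>_. K). conv_power \<phi> j (L *\<^sub>R (\<chi> i. of_int (f i)))) \<le> C0 * (\<Prod>i\<in>(UNIV::'d set). \<Sum>m\<in>K. 1 / (1 + (L * of_int m - 0)\<^sup>2))"
        using phi_sum[of 0] True by simp
      also have "\<dots> \<le> C0 * (\<Prod>i\<in>(UNIV::'d set). 9)"
      proof (intro mult_left_mono prod_mono conjI)
        fix i :: 'd
        obtain y' where y': "(\<Sum>m\<in>K. 1 / (1 + (L * of_int m - 0)\<^sup>2)) \<le> 9 / (1 + y'\<^sup>2)"
          using sum_lorentz_le[OF L K, of 0] by blast
        have "1 + y'\<^sup>2 > 0" by (intro add_pos_nonneg) auto
        hence "9 / (1 + y'\<^sup>2) \<le> 9" by (simp add: field_simps)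
        with y' show "(\<Sum>m\<in>K. 1 / (1 + (L * of_int m - 0)\<^sup>2)) \<le> 9" by linarith
      qed (use C0 in \<open>auto intro!: sum_nonneg divide_nonneg_nonneg add_nonneg_nonneg\<close>)
      also have "\<dots> = C0 * 9 ^ d" by (simp add: d_def)
      also have "\<dots> \<le> C0 * (800 * C1 * (1 + L / sqrt (real j)) / L) ^ d"
      proof (intro mult_left_mono power_mono)
        have "9 * L \<le> 800 * 1 * (1 + L)" using L by simp
        also have "\<dots> \<le> 800 * C1 * (1 + L)" using C1 L by (intro mult_right_mono) auto
        finally show "9 \<le> 800 * C1 * (1 + L / sqrt (real j)) / L" using L True by (simp add: field_simps)
      qed (use C0 in auto)
      also have "C0 * (800 * C1 * X / L) ^ d = C * X ^ d / L ^ d" for X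
        by (simp add: C_def power_mult_distrib power_divide mult_ac)
      finally show ?thesis .
    next
      case False
      hence j2: "j \<ge> 2" using j by simp
      then obtain n where n: "j = Suc (Suc n)" by (metis add_2_eq_Suc le_Suc_ex)
      define \<psi> where "\<psi> = conv_power \<phi> (Suc n)"
      have \<psi>: "nice_density \<psi>" unfolding \<psi>_def by (rule nice_density_conv_power[OF f])
      note [measurable] = nice_densityD(5)[OF f] nice_densityD(5)[OF \<psi>]
      note P = nice_densityD[OF \<psi>] and F = nice_densityD[OF f]
      obtain B where B: "B > 0" "\<And>x. \<phi> x \<le> B" using nice_density_bound[OF f] by blast
      obtain Q where Q: "\<And>\<theta>. Im (trig_kernel (1 - 1 / L) Q \<theta>) = 0"
        "\<And>y K. finite K \<Longrightarrow> (\<Sum>k\<in>K. 1 / (1 + (L * real_of_int k - y)\<^sup>2)) \<le> 800 / L * Re (trig_kernel (1 - 1 / L) Q (2 * pi * y / L))"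
        using trig_kernel_majorant[OF L] by blast
      define A where "A = {- int Q..int Q}"
      have A: "finite A" by (simp add: A_def)
      define s where "s = 1 - 1 / L"
      have s: "0 < s" "s < 1" using L by (auto simp: s_def)
      define T where "T y = (\<Prod>i\<in>UNIV. trig_kernel s Q (2 * pi * y $ i / L))" for y :: "real^'d"
      \<comment> \<open>The dual lattice of L Z^d, at whose points the expanded product of kernels
        oscillates.\<close>
      define \<xi> where "\<xi> f = (\<chi> i. 2 * pi * of_int (f i) / L)" for f :: "'d \<Rightarrow> int"
      have T: "T y = (\<Sum>f\<in>PiE UNIV (\<lambda>_. A). of_real (\<Prod>i\<in>UNIV. s ^ nat \<bar>f i\<bar>) * cis (\<xi> f \<bullet> y))" for y
        unfolding T_def trig_kernel_def A_def[symmetric]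
        by (subst prod_sum_PiE) (auto simp: A prod.distrib \<xi>_def inner_vec_def cis_sum intro!: sum.cong prod.cong arg_cong[of _ _ cis])
      have T_real: "T y = of_real (\<Prod>i\<in>UNIV. Re (trig_kernel s Q (2 * pi * y $ i / L)))" for y
        unfolding T_def of_real_prod using Q(1) by (intro prod.cong) (auto simp: s_def complex_eq_iff)
      have Tmaj: "(\<Sum>f\<in>PiE UNIV (\<lambda>_. K). \<phi> (L *\<^sub>R (\<chi> i. of_int (f i)) - y)) \<le> C0 * (800 / L) ^ d * Re (T y)" for y
      proof -
        have "(\<Prod>i\<in>UNIV. \<Sum>m\<in>K. 1 / (1 + (L * of_int m - y $ i)\<^sup>2)) \<le> (\<Prod>i\<in>UNIV. 800 / L * Re (trig_kernel s Q (2 * pi * y $ i / L)))"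
          using Q(2)[OF K] by (intro prod_mono) (auto simp: s_def intro!: sum_nonneg divide_nonneg_nonneg add_nonneg_nonneg)
        also have "\<dots> = (800 / L) ^ d * Re (T y)"
          by (simp only: T_real Re_complex_of_real prod.distrib prod_constant d_def)
        finally show ?thesis using phi_sum[of y] C0 by (simp add: mult.assoc) (meson mult_left_mono less_imp_le order_trans)
      qed
      have iT: "integrable lborel (\<lambda>y. of_real (\<psi> y) * T y)"
        and eqT: "(\<integral>y. of_real (\<psi> y) * T y \<partial>lborel) = (\<Sum>f\<in>PiE UNIV (\<lambda>_. A). of_real (\<Prod>i\<in>UNIV. s ^ nat \<bar>f i\<bar>) * ft \<psi> (\<xi> f))"
      proof -
        have e: "of_real (\<psi> y) * T y = (\<Sum>f\<in>PiE UNIV (\<lambda>_. A). of_real (\<Prod>i\<in>UNIV. s ^ nat \<bar>f i\<bar>) * (of_real (\<psi> y) * cis (\<xi> f \<bullet> y)))" for y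
          unfolding T sum_distrib_left by (simp add: mult_ac)
        have i: "integrable lborel (\<lambda>y. of_real (\<Prod>i\<in>UNIV. s ^ nat \<bar>f i\<bar>) * (of_real (\<psi> y) * cis (\<xi> f \<bullet> y)))" for f
          by (intro integrable_mult_right integrable_ft_integrand P)
        show "integrable lborel (\<lambda>y. of_real (\<psi> y) * T y)"
          unfolding e by (intro Bochner_Integration.integrable_sum i)
        show "(\<integral>y. of_real (\<psi> y) * T y \<partial>lborel) = (\<Sum>f\<in>PiE UNIV (\<lambda>_. A). of_real (\<Prod>i\<in>UNIV. s ^ nat \<bar>f i\<bar>) * ft \<psi> (\<xi> f))"
          unfolding e ft_def by (subst Bochner_Integration.integral_sum[OF i]) simp
      qed
      have iTr: "integrable lborel (\<lambda>y. \<psi> y * Re (T y))"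
        using integrable_Re[OF iT] by simp
      have int: "integrable lborel (\<lambda>y. \<psi> y * \<phi> (x - y))" for x
        by (rule Bochner_Integration.integrable_bound[OF integrable_mult_left[OF P(3), of B]])
           (use B F(1) P(1) in \<open>auto simp: abs_mult intro!: AE_I2 mult_left_mono\<close>)
      have "(\<Sum>f\<in>PiE UNIV (\<lambda>_. K). conv_power \<phi> j (L *\<^sub>R (\<chi> i. of_int (f i))))
         = (\<Sum>f\<in>PiE UNIV (\<lambda>_. K). \<integral>y. \<psi> y * \<phi> (L *\<^sub>R (\<chi> i. of_int (f i)) - y) \<partial>lborel)"
        unfolding n conv_power.simps \<psi>_def[symmetric] by (subst conv_commute) auto
      also have "\<dots> = (\<integral>y. (\<Sum>f\<in>PiE UNIV (\<lambda>_. K). \<psi> y * \<phi> (L *\<^sub>R (\<chi> i. of_int (f i)) - y)) \<partial>lborel)"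
        by (rule Bochner_Integration.integral_sum[symmetric]) (rule int)
      also have "\<dots> \<le> (\<integral>y. (C0 * (800 / L) ^ d) * (\<psi> y * Re (T y)) \<partial>lborel)"
      proof (rule integral_mono)
        show "integrable lborel (\<lambda>y. \<Sum>f\<in>PiE UNIV (\<lambda>_. K). \<psi> y * \<phi> (L *\<^sub>R (\<chi> i. of_int (f i)) - y))"
          by (intro Bochner_Integration.integrable_sum int)
        show "integrable lborel (\<lambda>y. (C0 * (800 / L) ^ d) * (\<psi> y * Re (T y)))"
          by (intro integrable_mult_right iTr)
        fix y
        have "(\<Sum>f\<in>PiE UNIV (\<lambda>_. K). \<psi> y * \<phi> (L *\<^sub>R (\<chi> i. of_int (f i)) - y)) = \<psi> y * (\<Sum>f\<in>PiE UNIV (\<lambda>_. K). \<phi> (L *\<^sub>R (\<chi> i. of_int (f i)) - y))"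
          by (simp add: sum_distrib_left)
        also have "\<dots> \<le> \<psi> y * (C0 * (800 / L) ^ d * Re (T y))"
          by (intro mult_left_mono Tmaj P)
        finally show "(\<Sum>f\<in>PiE UNIV (\<lambda>_. K). \<psi> y * \<phi> (L *\<^sub>R (\<chi> i. of_int (f i)) - y)) \<le> (C0 * (800 / L) ^ d) * (\<psi> y * Re (T y))"
          by (simp add: mult_ac)
      qed
      also have "\<dots> = (C0 * (800 / L) ^ d) * (\<integral>y. \<psi> y * Re (T y) \<partial>lborel)" by simp
      also have "\<dots> \<le> (C0 * (800 / L) ^ d) * (C1 * (1 + L / sqrt (real j))) ^ d"
      proof (intro mult_left_mono)
        have "(\<integral>y. \<psi> y * Re (T y) \<partial>lborel) = (\<integral>y. Re (of_real (\<psi> y) * T y) \<partial>lborel)" by simp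
        also have "\<dots> = Re (\<integral>y. of_real (\<psi> y) * T y \<partial>lborel)"
          by (rule integral_bounded_linear[OF bounded_linear_Re iT])
        also have "\<dots> \<le> norm (\<integral>y. of_real (\<psi> y) * T y \<partial>lborel)" by (rule complex_Re_le_cmod)
        also have "\<dots> \<le> (\<Sum>f\<in>PiE UNIV (\<lambda>_. A). norm (of_real (\<Prod>i\<in>UNIV. s ^ nat \<bar>f i\<bar>) * ft \<psi> (\<xi> f)))"
          unfolding eqT by (rule norm_sum)
        also have "\<dots> \<le> (\<Sum>f\<in>PiE (UNIV::'d set) (\<lambda>_. A). \<Prod>i\<in>UNIV. s ^ nat \<bar>f i\<bar> * exp (- c * min ((2 * pi * f i / L)\<^sup>2) 1) ^ (j - 1))"
        proof (rule sum_mono)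
          fix f :: "'d \<Rightarrow> int"
          have "norm (ft \<psi> (\<xi> f)) = norm (ft \<phi> (\<xi> f)) ^ (j - 1)"
            unfolding \<psi>_def ft_conv_power[OF f] by (simp add: n norm_power norm_mult)
          also have "\<dots> \<le> exp (- c * (\<Sum>i\<in>UNIV. min ((\<xi> f $ i)\<^sup>2) 1)) ^ (j - 1)"
            by (intro power_mono c) auto
          also have "\<dots> = (\<Prod>i\<in>UNIV. exp (- c * min ((2 * pi * f i / L)\<^sup>2) 1) ^ (j - 1))"
            by (simp add: sum_distrib_left exp_sum sum_negf[symmetric] prod_power_distrib \<xi>_def)
          finally have "norm (ft \<psi> (\<xi> f)) \<le> \<dots>" .
          hence "(\<Prod>i\<in>UNIV. s ^ nat \<bar>f i\<bar>) * norm (ft \<psi> (\<xi> f)) \<le> (\<Prod>i\<in>UNIV. s ^ nat \<bar>f i\<bar>) * (\<Prod>i\<in>UNIV. exp (- c * min ((2 * pi * f i / L)\<^sup>2) 1) ^ (j - 1))"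
            using s by (intro mult_left_mono prod_nonneg) auto
          moreover have "norm (of_real (\<Prod>i\<in>UNIV. s ^ nat \<bar>f i\<bar>) * ft \<psi> (\<xi> f)) = (\<Prod>i\<in>UNIV. s ^ nat \<bar>f i\<bar>) * norm (ft \<psi> (\<xi> f))"
            using s by (subst norm_mult, subst norm_of_real) (auto intro!: abs_of_nonneg prod_nonneg)
          ultimately show "norm (of_real (\<Prod>i\<in>UNIV. s ^ nat \<bar>f i\<bar>) * ft \<psi> (\<xi> f)) \<le> (\<Prod>i\<in>UNIV. s ^ nat \<bar>f i\<bar> * exp (- c * min ((2 * pi * f i / L)\<^sup>2) 1) ^ (j - 1))"
            by (simp only: prod.distrib)
        qed
        also have "\<dots> = (\<Prod>i\<in>(UNIV :: 'd set). \<Sum>m\<in>A. s ^ nat \<bar>m\<bar> * exp (- c * min ((2 * pi * m / L)\<^sup>2) 1) ^ (j - 1))"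
          by (rule prod_sum_PiE[symmetric]) (auto simp: A)
        also have "\<dots> \<le> (\<Prod>i\<in>(UNIV :: 'd set). C1 * (1 + L / sqrt (real j)))"
        proof (intro prod_mono conjI)
          have "(\<Sum>m\<in>A. s ^ nat \<bar>m\<bar> * exp (- c * min ((2 * pi * m / L)\<^sup>2) 1) ^ (j - 1)) \<le> 1 + 8 / sqrt c * (L / sqrt (real j))"
            unfolding A_def s_def by (rule kernel_sum_le[OF L c(1) j2])
          also have "\<dots> \<le> C1 * (1 + L / sqrt (real j))"
          proof -
            have *: "1 + q * t \<le> (1 + q) * (1 + t)" if "q \<ge> 0" "t \<ge> 0" for q t :: real
              using that by (simp add: algebra_simps)
            show ?thesis unfolding C1_def by (rule *) (use L c in auto)
          qed
          finally show "(\<Sum>m\<in>A. s ^ nat \<bar>m\<bar> * exp (- c * min ((2 * pi * m / L)\<^sup>2) 1) ^ (j - 1)) \<le> C1 * (1 + L / sqrt (real j))" .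
        qed (use s in \<open>auto intro!: sum_nonneg\<close>)
        also have "\<dots> = (C1 * (1 + L / sqrt (real j))) ^ d" by (simp add: d_def)
        finally show "(\<integral>y. \<psi> y * Re (T y) \<partial>lborel) \<le> (C1 * (1 + L / sqrt (real j))) ^ d" .
      qed (use C0 L in auto)
      also have "\<dots> = C * (1 + L / sqrt (real j)) ^ d / L ^ d"
        by (simp add: C_def power_mult_distrib power_divide mult_ac)
      finally show ?thesis .
    qed
  qed
  have nn: "conv_power \<phi> j x \<ge> 0" if "j \<ge> 1" for j x
    using that nice_densityD(1)[OF nice_density_conv_power[OF f, of "j - 1"]] by simp
  show ?thesis
  proof (rule that[OF C])
    fix L :: real and j :: nat assume L: "L \<ge> 2" and j: "j \<ge> 1"
    note * = summable_on_int_lattice[of "\<lambda>k. conv_power \<phi> j (L *\<^sub>R k)", OF nn[OF j] box[OF L j]]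
    show "(\<lambda>k. conv_power \<phi> j (L *\<^sub>R k)) summable_on int_lattice" by (rule *)
    have "L ^ d * infsum (\<lambda>k. conv_power \<phi> j (L *\<^sub>R k)) int_lattice \<le> L ^ d * (C * (1 + L / sqrt (real j)) ^ d / L ^ d)"
      using L by (intro mult_left_mono *) auto
    thus "L ^ CARD('d) * infsum (\<lambda>k. conv_power \<phi> j (L *\<^sub>R k)) int_lattice \<le> C * (1 + L / sqrt (real j)) ^ CARD('d)"
      using L by (simp add: d_def)
  qed
qed

section \<open>Coefficient extraction and Laplace asymptotics\<close>

text \<open>The body of \<open>H\<close> for an arbitrary weight sequence, so that the coefficient
  asymptotics can be proved without reference to lattice sums.\<close>

definition exp_coeff :: "(nat \<Rightarrow> real) \<Rightarrow> nat \<Rightarrow> real" where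
  "exp_coeff w n = fps_nth (fps_compose (fps_exp 1) (Abs_fps (\<lambda>j. if j = 0 then 0 else w j / real j))) n"

lemma exp_coeff_complex:
  "complex_of_real (exp_coeff w n)
    = fps_nth (fps_compose (fps_exp 1) (Abs_fps (\<lambda>j. if j = 0 then 0 else of_real (w j / real j)))) n"
proof -
  define A where "A = Abs_fps (\<lambda>j. if j = 0 then 0 else w j / real j)"
  define A' where "A' = Abs_fps (\<lambda>j. if j = 0 then 0 else complex_of_real (w j / real j))"
  have A: "fps_nth A' k = of_real (fps_nth A k)" for k by (simp add: A_def A'_def)
  have pow: "fps_nth (A' ^ i) k = of_real (fps_nth (A ^ i) k)" for i k
    by (induction i arbitrary: k) (auto simp: fps_mult_nth A)
  show ?thesis
    unfolding exp_coeff_def A_def[symmetric] A'_def[symmetric]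
    by (simp add: fps_compose_nth pow)
qed

text \<open>Bounded weights give the exponent a radius of convergence of at least 1, and the
  exponential of a function holomorphic on the unit disc is given by its Taylor series on the whole
  disc.\<close>

lemma exp_coeff_sums:
  fixes z :: complex
  assumes B: "\<And>j. \<bar>w (Suc j)\<bar> \<le> B" and z: "norm z < 1"
  shows "(\<lambda>n. of_real (exp_coeff w n) * z ^ n) sums exp (\<Sum>j. of_real (w (Suc j) / real (Suc j)) * z ^ Suc j)"
proof -
  define A where "A = Abs_fps (\<lambda>j. if j = 0 then 0 else complex_of_real (w j / real j))"
  have B0: "B \<ge> 0" using B[of 0] by linarith
  have An: "norm (fps_nth A n) \<le> B" for n
  proof (cases n)
    case (Suc k)
    have "\<bar>w (Suc k)\<bar> / real (Suc k) \<le> B / 1" using B[of k] B0 by (intro frac_le) auto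
    thus ?thesis using Suc by (simp add: A_def del: of_real_divide of_nat_Suc)
  qed (simp add: A_def B0)
  have rad: "fps_conv_radius A \<ge> 1"
    unfolding fps_conv_radius_def
  proof (rule conv_radius_geI_ex')
    fix r :: real assume r: "0 < r" "ereal r < 1"
    show "summable (\<lambda>n. fps_nth A n * of_real r ^ n)"
    proof (rule summable_comparison_test')
      show "summable (\<lambda>n. B * r ^ n)" using r by (intro summable_mult summable_geometric) auto
      show "norm (fps_nth A n * of_real r ^ n) \<le> B * r ^ n" if "n \<ge> 0" for n
        using An[of n] r by (simp add: norm_mult norm_power mult_right_mono)
    qed
  qed
  have sub: "eball (0::complex) 1 \<subseteq> eball 0 (fps_conv_radius A)"
  proof
    fix x :: complex assume "x \<in> eball 0 1"
    hence "ereal (dist 0 x) < 1" by (simp only: in_eball_iff)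
    thus "x \<in> eball 0 (fps_conv_radius A)" unfolding in_eball_iff using rad by (rule less_le_trans)
  qed
  have exps: "(exp \<circ> eval_fps A) has_fps_expansion fps_compose (fps_exp 1) A"
  proof (rule has_fps_expansion_compose)
    show "exp has_fps_expansion fps_exp (1::complex)" by (rule has_fps_expansion_exp1)
    show "eval_fps A has_fps_expansion A"
      by (rule eval_fps_has_fps_expansion) (use rad in \<open>auto intro: less_le_trans[of 0 1]\<close>)
    show "fps_nth A 0 = 0" by (simp add: A_def)
  qed
  have hol: "(exp \<circ> eval_fps A) holomorphic_on eball 0 1"
    unfolding o_def by (intro holomorphic_intros sub)
  have "(\<lambda>n. fps_nth (fps_compose (fps_exp 1) A) n * z ^ n) sums (exp \<circ> eval_fps A) z"
    by (rule has_fps_expansion_imp_sums_complex[OF exps hol]) (use z in auto)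
  moreover have "eval_fps A z = (\<Sum>j. of_real (w (Suc j) / real (Suc j)) * z ^ Suc j)"
  proof -
    have "norm z < fps_conv_radius A" by (rule less_le_trans[OF _ rad]) (use z in \<open>simp add: one_ereal_def\<close>)
    hence "summable (\<lambda>n. fps_nth A n * z ^ n)" by (rule summable_fps)
    from suminf_split_head[OF this] show ?thesis by (simp add: eval_fps_def A_def)
  qed
  ultimately show ?thesis by (simp add: A_def exp_coeff_complex)
qed

lemma integral_cis_interval:
  fixes k :: int
  shows "(\<integral>t. indicator {- pi..pi} t *\<^sub>R cis (of_int k * t) \<partial>lborel) = (if k = 0 then of_real (2 * pi) else 0)"
proof (cases "k = 0")
  case True
  thus ?thesis by (simp add: scaleR_conv_of_real)
next
  case False
  define F where "F t = exp (\<i> * of_int k * of_real t) / (\<i> * of_int k)" for t :: real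
  have cis_eq: "cis (of_int k * t) = exp (\<i> * of_int k * of_real t)" for t
    by (simp add: cis_conv_exp mult_ac)
  have D: "(F has_vector_derivative cis (of_int k * t)) (at t within A)" for t A
    unfolding F_def
  proof (rule has_vector_derivative_real_field)
    show "((\<lambda>z. exp (\<i> * of_int k * z) / (\<i> * of_int k)) has_field_derivative cis (of_int k * t)) (at (of_real t))"
      using False by (auto intro!: derivative_eq_intros simp: cis_eq)
  qed
  have "(\<integral>t. indicator {- pi..pi} t *\<^sub>R cis (of_int k * t) \<partial>lborel) = F pi - F (- pi)"
    by (rule integral_FTC_Icc) (auto intro!: D continuous_intros)
  also have "F pi = F (- pi)"
  proof -
    have "cis (of_int k * pi) = cis (of_int k * (- pi))"
      by (simp add: complex_eq_iff sin_times_pi_eq_0 mult.commute[of _ pi])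
    thus ?thesis unfolding cis_eq F_def by simp
  qed
  finally show ?thesis using False by simp
qed

text \<open>Cauchy's coefficient formula on a circle: absolute summability permits termwise
  integration, and the characters are orthogonal.\<close>

lemma integral_power_series_cis:
  fixes a :: "nat \<Rightarrow> complex"
  assumes a: "summable (\<lambda>m. norm (a m))"
  shows "(\<integral>t. indicator {- pi..pi} t *\<^sub>R ((\<Sum>m. a m * cis (real m * t)) * cis (- (real n * t))) \<partial>lborel) = 2 * pi * a n"
proof -
  define f where "f m t = indicator {- pi..pi} t *\<^sub>R (a m * cis (of_int (int m - int n) * t))" for m t
  have f: "f m t = a m * (indicator {- pi..pi} t *\<^sub>R cis (of_int (int m - int n) * t))" for m t
    by (simp add: f_def)
  have ind: "integrable lborel (\<lambda>t::real. indicator {- pi..pi} t :: real)" by simp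
  have ci: "integrable lborel (\<lambda>t. indicator {- pi..pi} t *\<^sub>R cis (of_int (int m - int n) * t))" for m
    by (rule Bochner_Integration.integrable_bound[OF ind]) auto
  have int: "integrable lborel (f m)" for m
    unfolding f by (intro integrable_mult_right ci)
  have nf: "norm (f m t) = norm (a m) * indicator {- pi..pi} t" for m t
    by (simp add: f norm_mult)
  have s: "summable (\<lambda>m. norm (f m t))" for t
    unfolding nf by (intro summable_mult2 a)
  have "(\<lambda>m. integral\<^sup>L lborel (f m)) sums (\<integral>t. (\<Sum>m. f m t) \<partial>lborel)"
  proof (rule sums_integral[OF int])
    show "summable (\<lambda>m. \<integral>t. norm (f m t) \<partial>lborel)"
      unfolding nf by (simp add: summable_mult2 a)
  qed (use s in auto)
  moreover have "integral\<^sup>L lborel (f m) = (if m = n then 2 * pi * a n else 0)" for m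
    unfolding f integral_mult_right_zero integral_cis_interval by simp
  ultimately have "(\<lambda>m. if m = n then 2 * pi * a n else 0) sums (\<integral>t. (\<Sum>m. f m t) \<partial>lborel)"
    by simp
  hence "(\<integral>t. (\<Sum>m. f m t) \<partial>lborel) = 2 * pi * a n"
    using sums_single[of n "\<lambda>_. 2 * pi * a n"] by (rule sums_unique2)
  moreover have "(\<Sum>m. f m t) = indicator {- pi..pi} t *\<^sub>R ((\<Sum>m. a m * cis (real m * t)) * cis (- (real n * t)))" for t
  proof -
    have sm: "summable (\<lambda>m. a m * cis (real m * t))"
      by (rule summable_norm_cancel) (simp add: norm_mult a)
    have "f m t = indicator {- pi..pi} t *\<^sub>R (a m * cis (real m * t) * cis (- (real n * t)))" for m
      by (simp add: f_def mult.assoc cis_mult left_diff_distrib)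
    hence "(\<Sum>m. f m t) = indicator {- pi..pi} t *\<^sub>R (\<Sum>m. a m * cis (real m * t) * cis (- (real n * t)))"
      using sm by (simp add: suminf_scaleR_right summable_mult2)
    thus ?thesis using sm by (simp add: suminf_mult2)
  qed
  ultimately show ?thesis by simp
qed

text \<open>With v = c sqrt |u| the bound v^4/4! \<le> exp v says u^2 \<le> (24/c^4) exp v, so a
  multiple of 1/(1 + u^2) dominates.\<close>

lemma integrable_exp_neg_sqrt:
  fixes c C :: real
  assumes c: "c > 0"
  shows "integrable lborel (\<lambda>u::real. exp (C - c * sqrt \<bar>u\<bar>))"
proof -
  have "integrable lborel (\<lambda>u::real. exp C * (1 + 24 / c ^ 4) * (1 / (1 + u\<^sup>2)))"
    by (intro integrable_mult_right integrable_lorentz)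
  thus ?thesis
  proof (rule Bochner_Integration.integrable_bound)
    have "exp (C - c * sqrt \<bar>u\<bar>) \<le> exp C * (1 + 24 / c ^ 4) * (1 / (1 + u\<^sup>2))" for u :: real
    proof -
      define v where "v = c * sqrt \<bar>u\<bar>"
      have v: "v \<ge> 0" using c by (simp add: v_def)
      have v4: "v ^ 4 = c ^ 4 * u\<^sup>2"
      proof -
        have "sqrt \<bar>u\<bar> ^ 4 = (sqrt \<bar>u\<bar> ^ 2) ^ 2" by (simp only: power_mult[symmetric]) simp
        thus ?thesis by (simp add: v_def power_mult_distrib)
      qed
      have "v ^ 4 / fact 4 \<le> exp v"
      proof -
        have "(\<Sum>k\<in>{4}. v ^ k / fact k) \<le> exp v"
          unfolding exp_def using summable_exp_generic[of v] v
          by (intro order_trans[OF _ sum_le_suminf[of _ "{4}"]]) (auto simp: divide_inverse mult.commute)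
        thus ?thesis by simp
      qed
      hence "u\<^sup>2 \<le> 24 / c ^ 4 * exp v" using c by (simp add: v4 fact_numeral field_simps)
      moreover have "1 \<le> exp v" using v by simp
      ultimately have "1 + u\<^sup>2 \<le> (1 + 24 / c ^ 4) * exp v"
        unfolding distrib_right mult_1 by (rule add_mono[rotated])
      hence "exp (- v) * (1 + u\<^sup>2) \<le> exp (- v) * ((1 + 24 / c ^ 4) * exp v)" by (intro mult_left_mono) auto
      also have "\<dots> = 1 + 24 / c ^ 4" by (simp add: exp_minus)
      finally have "exp (- v) * (1 + u\<^sup>2) \<le> 1 + 24 / c ^ 4" .
      moreover have "1 + u\<^sup>2 > 0" by (intro add_pos_nonneg) auto
      ultimately have "exp (- v) \<le> (1 + 24 / c ^ 4) * (1 / (1 + u\<^sup>2))" by (simp add: field_simps)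
      hence "exp C * exp (- v) \<le> exp C * ((1 + 24 / c ^ 4) * (1 / (1 + u\<^sup>2)))" by (intro mult_left_mono) auto
      thus ?thesis by (simp add: v_def exp_diff exp_minus divide_inverse mult_ac)
    qed
    thus "AE u in lborel. norm (exp (C - c * sqrt \<bar>u\<bar>)) \<le> norm (exp C * (1 + 24 / c ^ 4) * (1 / (1 + u\<^sup>2)))"
      by (auto intro: order_trans[OF _ abs_ge_self])
  qed measurable
qed

text \<open>The decay hypothesis is phrased in sqrt a |t| so that after scaling the majorant no
  longer depends on N. The factor \<open>cis (b N * t)\<close> carries the shift of the coefficient
  index; it tends to 1 pointwise because b = o(sqrt a).\<close>

theorem gaussian_local_limit:
  fixes E :: "nat \<Rightarrow> real \<Rightarrow> complex" and a \<kappa> b :: "nat \<Rightarrow> real"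
  assumes meas [measurable]: "\<And>N. E N \<in> borel_measurable borel"
    and a: "filterlim a at_top sequentially"
    and \<kappa>: "(\<lambda>N. \<kappa> N / (a N * sqrt (a N))) \<longlonglongrightarrow> 0"
    and taylor: "\<forall>\<^sub>F N in sequentially. \<forall>t\<in>{- pi..pi}. norm (E N t + of_real (a N * t\<^sup>2 / 2)) \<le> \<kappa> N * \<bar>t\<bar> ^ 3 / 6"
    and c: "c > 0"
    and decay: "\<forall>\<^sub>F N in sequentially. \<forall>t\<in>{- pi..pi}. Re (E N t) \<le> C - c * sqrt (sqrt (a N) * \<bar>t\<bar>)"
    and b: "(\<lambda>N. b N / sqrt (a N)) \<longlonglongrightarrow> 0"
  shows "(\<lambda>N. of_real (sqrt (a N) / sqrt (2 * pi)) *
      (\<integral>t. indicator {- pi..pi} t *\<^sub>R (exp (E N t) * cis (b N * t)) \<partial>lborel)) \<longlonglongrightarrow> 1"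
proof -
  have "\<forall>\<^sub>F N in sequentially. a N > 0" using a by (rule filterlim_at_top_dense[THEN iffD1, rule_format])
  with taylor decay have "\<forall>\<^sub>F N in sequentially. a N > 0 \<and>
      (\<forall>t\<in>{- pi..pi}. norm (E N t + of_real (a N * t\<^sup>2 / 2)) \<le> \<kappa> N * \<bar>t\<bar> ^ 3 / 6) \<and>
      (\<forall>t\<in>{- pi..pi}. Re (E N t) \<le> C - c * sqrt (sqrt (a N) * \<bar>t\<bar>))"
    by eventually_elim auto
  \<comment> \<open>Dominated convergence asks for the majorant at every index, so the sequence is
    started at \<open>N0\<close>.\<close>
  then obtain N0 where N0: "\<And>N. N \<ge> N0 \<Longrightarrow> a N > 0"
     "\<And>N t. N \<ge> N0 \<Longrightarrow> t \<in> {- pi..pi} \<Longrightarrow> norm (E N t + of_real (a N * t\<^sup>2 / 2)) \<le> \<kappa> N * \<bar>t\<bar> ^ 3 / 6"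
     "\<And>N t. N \<ge> N0 \<Longrightarrow> t \<in> {- pi..pi} \<Longrightarrow> Re (E N t) \<le> C - c * sqrt (sqrt (a N) * \<bar>t\<bar>)"
    unfolding eventually_sequentially by blast
  define f where "f N u = indicator {- pi..pi} (u / sqrt (a N)) *\<^sub>R (exp (E N (u / sqrt (a N))) * cis (b N * (u / sqrt (a N))))" for N u
  have [measurable]: "f N \<in> borel_measurable borel" for N unfolding f_def by measurable
  have lim: "(\<lambda>N. f (N + N0) u) \<longlonglongrightarrow> complex_of_real (exp (- (1 * u)\<^sup>2 / 2))" for u
  proof -
    have s: "filterlim (\<lambda>N. sqrt (a N)) at_top sequentially"
      by (rule filterlim_compose[OF sqrt_at_top a])
    have "(\<lambda>N. u / sqrt (a N)) \<longlonglongrightarrow> 0"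
      by (rule real_tendsto_divide_at_top[OF tendsto_const s])
    hence "\<forall>\<^sub>F N in sequentially. dist (u / sqrt (a N)) 0 < pi" by (rule tendstoD) simp
    hence inr: "\<forall>\<^sub>F N in sequentially. u / sqrt (a N) \<in> {- pi..pi}"
      by eventually_elim (simp add: dist_real_def abs_less_iff del: abs_divide)
    have "(\<lambda>N. E N (u / sqrt (a N)) + of_real (u\<^sup>2 / 2)) \<longlonglongrightarrow> 0"
    proof (rule Lim_null_comparison)
      show "\<forall>\<^sub>F N in sequentially. norm (E N (u / sqrt (a N)) + of_real (u\<^sup>2 / 2)) \<le> \<bar>u\<bar> ^ 3 / 6 * (\<kappa> N / (a N * sqrt (a N)))"
        using inr eventually_ge_at_top[of N0]
      proof eventually_elim
        case (elim N)
        have aN: "a N > 0" using N0(1) elim by auto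
        have "a N * (u / sqrt (a N))\<^sup>2 = u\<^sup>2" using aN by (simp add: power_divide)
        moreover have "\<bar>u / sqrt (a N)\<bar> ^ 3 = \<bar>u\<bar> ^ 3 / (a N * sqrt (a N))"
          using aN by (simp add: power_divide power3_eq_cube)
        ultimately show ?case using N0(2)[OF elim(2,1)] by (simp add: mult_ac)
      qed
      show "(\<lambda>N. \<bar>u\<bar> ^ 3 / 6 * (\<kappa> N / (a N * sqrt (a N)))) \<longlonglongrightarrow> 0"
        using tendsto_mult_right_zero[OF \<kappa>] by blast
    qed
    hence "(\<lambda>N. E N (u / sqrt (a N)) + of_real (u\<^sup>2 / 2) - of_real (u\<^sup>2 / 2)) \<longlonglongrightarrow> 0 - of_real (u\<^sup>2 / 2)"
      by (intro tendsto_diff tendsto_const)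
    hence E: "(\<lambda>N. exp (E N (u / sqrt (a N)))) \<longlonglongrightarrow> exp (- of_real (u\<^sup>2 / 2))"
      by (intro tendsto_exp) simp
    have "(\<lambda>N. b N * (u / sqrt (a N))) \<longlonglongrightarrow> 0"
      using tendsto_mult_left_zero[OF b, of u] by (simp add: mult_ac)
    moreover have "isCont cis 0"
    proof -
      have "continuous_on UNIV cis" by (auto intro!: continuous_intros)
      thus ?thesis by (simp add: continuous_on_eq_continuous_at)
    qed
    ultimately have "(\<lambda>N. cis (b N * (u / sqrt (a N)))) \<longlonglongrightarrow> cis 0"
      by (rule isCont_tendsto_compose[rotated])
    with E have "(\<lambda>N. exp (E N (u / sqrt (a N))) * cis (b N * (u / sqrt (a N)))) \<longlonglongrightarrow> exp (- of_real (u\<^sup>2 / 2)) * cis 0"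
      by (intro tendsto_mult)
    moreover have "\<forall>\<^sub>F N in sequentially. exp (E N (u / sqrt (a N))) * cis (b N * (u / sqrt (a N))) = f N u"
      using inr by eventually_elim (simp add: f_def)
    ultimately have "(\<lambda>N. f N u) \<longlonglongrightarrow> exp (- of_real (u\<^sup>2 / 2)) * cis 0"
      by (rule Lim_transform_eventually)
    hence "(\<lambda>N. f (N + N0) u) \<longlonglongrightarrow> exp (- of_real (u\<^sup>2 / 2)) * cis 0"
      by (rule LIMSEQ_ignore_initial_segment)
    thus ?thesis by (simp flip: exp_of_real)
  qed
  have "(\<lambda>N. \<integral>u. f (N + N0) u \<partial>lborel) \<longlonglongrightarrow> (\<integral>u. complex_of_real (exp (- (1 * u)\<^sup>2 / 2)) \<partial>lborel)"
  proof (rule integral_dominated_convergence[OF _ _ integrable_exp_neg_sqrt[OF c, of C]])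
    fix N
    show "AE u in lborel. norm (f (N + N0) u) \<le> exp (C - c * sqrt \<bar>u\<bar>)"
    proof (rule AE_I2)
      fix u
      let ?M = "N + N0"
      have aM: "a ?M > 0" using N0(1)[of ?M] by simp
      show "norm (f ?M u) \<le> exp (C - c * sqrt \<bar>u\<bar>)"
      proof (cases "u / sqrt (a ?M) \<in> {- pi..pi}")
        case True
        have "norm (f ?M u) = exp (Re (E ?M (u / sqrt (a ?M))))"
          using True by (simp add: f_def norm_mult)
        also have "\<dots> \<le> exp (C - c * sqrt (sqrt (a ?M) * \<bar>u / sqrt (a ?M)\<bar>))"
          using N0(3)[OF _ True] by simp
        also have "sqrt (a ?M) * \<bar>u / sqrt (a ?M)\<bar> = \<bar>u\<bar>" using aM by simp
        finally show ?thesis .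
      qed (simp add: f_def)
    qed
  qed (use lim in auto)
  also have "(\<integral>u. complex_of_real (exp (- (1 * u)\<^sup>2 / 2)) \<partial>lborel) = of_real (sqrt (2 * pi))"
    unfolding integral_complex_of_real by (subst gauss_integral_real) auto
  finally have "(\<lambda>N. \<integral>u. f N u \<partial>lborel) \<longlonglongrightarrow> of_real (sqrt (2 * pi))"
    by (rule LIMSEQ_offset)
  hence "(\<lambda>N. of_real (1 / sqrt (2 * pi)) * (\<integral>u. f N u \<partial>lborel)) \<longlonglongrightarrow> of_real (1 / sqrt (2 * pi)) * of_real (sqrt (2 * pi))"
    by (intro tendsto_mult tendsto_const)
  also have "complex_of_real (1 / sqrt (2 * pi)) * of_real (sqrt (2 * pi)) = 1"
    by (simp flip: of_real_mult)
  finally have l: "(\<lambda>N. of_real (1 / sqrt (2 * pi)) * (\<integral>u. f N u \<partial>lborel)) \<longlonglongrightarrow> 1" .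
  have "\<forall>\<^sub>F N in sequentially. of_real (1 / sqrt (2 * pi)) * (\<integral>u. f N u \<partial>lborel)
     = of_real (sqrt (a N) / sqrt (2 * pi)) * (\<integral>t. indicator {- pi..pi} t *\<^sub>R (exp (E N t) * cis (b N * t)) \<partial>lborel)"
    using eventually_ge_at_top[of N0]
  proof eventually_elim
    case (elim N)
    have aN: "a N > 0" using N0(1) elim by auto
    have "(\<integral>t. indicator {- pi..pi} t *\<^sub>R (exp (E N t) * cis (b N * t)) \<partial>lborel) = \<bar>1 / sqrt (a N)\<bar> *\<^sub>R (\<integral>u. f N u \<partial>lborel)"
      using aN by (subst lborel_integral_real_affine[where c = "1 / sqrt (a N)" and t = 0]) (auto simp: f_def[abs_def])
    thus ?case using aN by (simp add: scaleR_conv_of_real)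
  qed
  with l show ?thesis by (rule Lim_transform_eventually)
qed

section \<open>Exponential generating functions with nonnegative weights\<close>

text \<open>The exponent has coefficients w_j / j, so the order is lowered by one:
  \<open>moment 0\<close> is r G'(r), \<open>moment 1\<close> is the variance a, and
  \<open>moment 2\<close> is the third moment of the overview.\<close>

definition moment :: "nat \<Rightarrow> (nat \<Rightarrow> real) \<Rightarrow> real \<Rightarrow> real" where
  "moment k w r = (\<Sum>j. real (Suc j) ^ k * (w (Suc j) * r ^ Suc j))"

definition log_gen :: "(nat \<Rightarrow> real) \<Rightarrow> real \<Rightarrow> real" where
  "log_gen w r = (\<Sum>j. w (Suc j) * r ^ Suc j / real (Suc j))"

definition osc :: "(nat \<Rightarrow> real) \<Rightarrow> real \<Rightarrow> real \<Rightarrow> real" where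
  "osc w r t = (\<Sum>j. w (Suc j) * r ^ Suc j / real (Suc j) * (1 - cos (real (Suc j) * t)))"

text \<open>This is G(r e^(it)) - G(r); its real part is minus \<open>osc\<close>.\<close>

definition psi :: "(nat \<Rightarrow> real) \<Rightarrow> real \<Rightarrow> real \<Rightarrow> complex" where
  "psi w r t = (\<Sum>j. of_real (w (Suc j) * r ^ Suc j / real (Suc j)) * (cis (real (Suc j) * t) - 1))"

text \<open>Write r = q q with q = sqrt r: one factor q^n eventually absorbs the polynomial, the
  other gives a convergent geometric series.\<close>

lemma summable_poly_geometric:
  fixes r :: real
  assumes r: "0 < r" "r < 1"
  shows "summable (\<lambda>j. real (Suc j) ^ k * r ^ Suc j)"
proof -
  define q where "q = sqrt r"
  have q: "0 < q" "q < 1" using r by (auto simp: q_def)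
  have qq: "q * q = r" using r by (simp add: q_def)
  define l where "l = - ln q"
  have l: "l > 0" using q by (simp add: l_def)
  have "(\<lambda>n. real n ^ k * exp (- (l * real n))) \<longlonglongrightarrow> 0" using l by real_asymp
  moreover have "exp (- (l * real n)) = q ^ n" for n
    using q by (simp add: l_def exp_of_nat_mult mult.commute[of _ "real n"])
  ultimately have "(\<lambda>n. real n ^ k * q ^ n) \<longlonglongrightarrow> 0" by simp
  hence "\<forall>\<^sub>F n in sequentially. real n ^ k * q ^ n < 1" by (rule order_tendstoD) simp
  hence "\<forall>\<^sub>F n in sequentially. norm (real n ^ k * r ^ n) \<le> q ^ n"
  proof eventually_elim
    case (elim n)
    have "real n ^ k * r ^ n = (real n ^ k * q ^ n) * q ^ n"
      by (simp add: qq[symmetric] power_mult_distrib)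
    also have "\<dots> \<le> 1 * q ^ n" using elim q by (intro mult_right_mono) auto
    finally show ?case using r by simp
  qed
  hence "summable (\<lambda>n. real n ^ k * r ^ n)"
    by (rule summable_comparison_test_ev) (use q in \<open>auto intro: summable_geometric\<close>)
  thus ?thesis by (subst (asm) summable_Suc_iff[symmetric])
qed

lemma norm_mult_le_two:
  fixes y :: "'a::real_normed_field"
  shows "0 \<le> c \<Longrightarrow> norm y \<le> 2 \<Longrightarrow> norm (of_real c * y) \<le> 2 * c"
  using mult_left_mono[of "norm y" 2 c] by (simp add: norm_mult)

context
  fixes w :: "nat \<Rightarrow> real" and B r :: real
  assumes w: "\<And>j. 0 \<le> w (Suc j)" "\<And>j. w (Suc j) \<le> B" and r: "0 < r" "r < 1"
begin

lemma summable_moment: "summable (\<lambda>j. real (Suc j) ^ k * (w (Suc j) * r ^ Suc j))"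
proof (rule summable_comparison_test')
  show "summable (\<lambda>j. B * (real (Suc j) ^ k * r ^ Suc j))"
    by (intro summable_mult summable_poly_geometric r)
  show "norm (real (Suc j) ^ k * (w (Suc j) * r ^ Suc j)) \<le> B * (real (Suc j) ^ k * r ^ Suc j)" if "j \<ge> 0" for j
  proof -
    have "w (Suc j) * (real (Suc j) ^ k * r ^ Suc j) \<le> B * (real (Suc j) ^ k * r ^ Suc j)"
      using w r by (intro mult_right_mono) auto
    moreover have "norm (real (Suc j) ^ k * (w (Suc j) * r ^ Suc j)) = w (Suc j) * (real (Suc j) ^ k * r ^ Suc j)"
      using w(1)[of j] r by (simp add: abs_mult)
    ultimately show ?thesis by simp
  qed
qed

lemma moment_nonneg: "0 \<le> moment k w r"
  unfolding moment_def using w r by (intro suminf_nonneg summable_moment) auto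

lemma summable_log_gen: "summable (\<lambda>j. w (Suc j) * r ^ Suc j / real (Suc j))"
proof (rule summable_comparison_test'[OF summable_moment[of 0]])
  show "norm (w (Suc j) * r ^ Suc j / real (Suc j)) \<le> real (Suc j) ^ 0 * (w (Suc j) * r ^ Suc j)" if "j \<ge> 0" for j
  proof -
    have "w (Suc j) * r ^ Suc j / real (Suc j) \<le> w (Suc j) * r ^ Suc j / 1"
      using w(1)[of j] r by (intro divide_left_mono) auto
    thus ?thesis using w(1)[of j] r by simp
  qed
qed

lemma summable_psi: "summable (\<lambda>j. of_real (w (Suc j) * r ^ Suc j / real (Suc j)) * (cis (real (Suc j) * t) - 1))"
proof (rule summable_comparison_test'[OF summable_mult[OF summable_log_gen, of 2]])
  show "norm (of_real (w (Suc j) * r ^ Suc j / real (Suc j)) * (cis (real (Suc j) * t) - 1)) \<le> 2 * (w (Suc j) * r ^ Suc j / real (Suc j))"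
    if "j \<ge> 0" for j
  proof -
    have "norm (cis (real (Suc j) * t) - 1) \<le> 2"
      using norm_triangle_ineq4[of "cis (real (Suc j) * t)" 1] by simp
    thus ?thesis using w(1)[of j] r by (intro norm_mult_le_two) auto
  qed
qed

lemma summable_osc: "summable (\<lambda>j. w (Suc j) * r ^ Suc j / real (Suc j) * (1 - cos (real (Suc j) * t)))"
proof (rule summable_comparison_test'[OF summable_mult[OF summable_log_gen, of 2]])
  fix j :: nat
  have "norm (1 - cos (real (Suc j) * t)) \<le> 2"
    using cos_le_one[of "real (Suc j) * t"] cos_ge_minus_one[of "real (Suc j) * t"]
    unfolding real_norm_def by linarith
  from norm_mult_le_two[OF _ this, of "w (Suc j) * r ^ Suc j / real (Suc j)"]
  show "norm (w (Suc j) * r ^ Suc j / real (Suc j) * (1 - cos (real (Suc j) * t))) \<le> 2 * (w (Suc j) * r ^ Suc j / real (Suc j))"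
    using w(1)[of j] r by simp
qed

lemma Re_psi: "Re (psi w r t) = - osc w r t"
proof -
  have "Re (psi w r t) = (\<Sum>j. Re (of_real (w (Suc j) * r ^ Suc j / real (Suc j)) * (cis (real (Suc j) * t) - 1)))"
    unfolding psi_def by (rule bounded_linear.suminf[OF bounded_linear_Re summable_psi])
  also have "\<dots> = (\<Sum>j. - (w (Suc j) * r ^ Suc j / real (Suc j) * (1 - cos (real (Suc j) * t))))"
  proof -
    have "Re (of_real c * (cis x - 1)) = - (c * (1 - cos x))" for c x
      by (simp add: algebra_simps)
    thus ?thesis by (simp only:)
  qed
  also have "\<dots> = - osc w r t"
    unfolding osc_def
    by (rule suminf_minus) (rule summable_osc)
  finally show ?thesis .
qed

lemma osc_ge_sum:
  assumes "finite A"
  shows "osc w r t \<ge> (\<Sum>j\<in>A. w (Suc j) * r ^ Suc j / real (Suc j) * (1 - cos (real (Suc j) * t)))"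
  unfolding osc_def
  by (rule sum_le_suminf[OF summable_osc assms]) (use w(1) r in auto)

text \<open>The third-order bound for e^(ix) is applied termwise at x = j t. Its j^3, divided by the
  j of the coefficient, leaves the weight j^2 of \<open>moment 2\<close>.\<close>

lemma psi_taylor:
  "norm (psi w r t - \<i> * of_real (moment 0 w r * t) + of_real (moment 1 w r * t\<^sup>2 / 2)) \<le> moment 2 w r * \<bar>t\<bar> ^ 3 / 6"
proof -
  define m where "m j = w (Suc j) * r ^ Suc j" for j
  have m: "m j \<ge> 0" for j using w(1)[of j] r by (simp add: m_def)
  define P where "P j = of_real (m j / real (Suc j)) * (cis (real (Suc j) * t) - 1)" for j
  define Q where "Q j = \<i> * of_real t * of_real (real (Suc j) ^ 0 * m j)" for j
  define R where "R j = of_real (t\<^sup>2 / 2) * complex_of_real (real (Suc j) ^ 1 * m j)" for j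
  have sm: "summable (\<lambda>j. real (Suc j) ^ k * m j)" for k unfolding m_def by (rule summable_moment)
  have sP: "summable P" unfolding P_def m_def by (rule summable_psi)
  have sQ: "summable Q" unfolding Q_def by (intro summable_mult summable_of_real sm)
  have sR: "summable R" unfolding R_def by (intro summable_mult summable_of_real sm)
  have eq: "psi w r t - \<i> * of_real (moment 0 w r * t) + of_real (moment 1 w r * t\<^sup>2 / 2) = (\<Sum>j. P j - Q j + R j)"
  proof -
    have "suminf Q = \<i> * of_real t * of_real (moment 0 w r)"
      unfolding Q_def moment_def m_def[symmetric] suminf_of_real[OF sm]
      by (rule suminf_mult) (intro summable_of_real sm)
    moreover have "suminf R = of_real (t\<^sup>2 / 2) * of_real (moment 1 w r)"
      unfolding R_def moment_def m_def[symmetric] suminf_of_real[OF sm]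
      by (rule suminf_mult) (intro summable_of_real sm)
    moreover have "suminf P = psi w r t" unfolding P_def m_def psi_def ..
    moreover have "(\<Sum>j. P j - Q j + R j) = suminf P - suminf Q + suminf R"
      by (simp add: suminf_add[symmetric] suminf_diff[symmetric] summable_diff sP sQ sR)
    ultimately show ?thesis by (simp add: mult_ac)
  qed
  have bnd: "norm (P j - Q j + R j) \<le> \<bar>t\<bar> ^ 3 / 6 * (real (Suc j) ^ 2 * m j)" for j
  proof -
    define x where "x = real (Suc j) * t"
    have "norm (iexp x - (\<Sum>k\<le>2. (\<i> * of_real x) ^ k / fact k)) \<le> \<bar>x\<bar> ^ Suc 2 / fact (Suc 2)"
      by (rule iexp_approx1)
    hence le: "norm (cis x - 1 - \<i> * of_real x + of_real (x\<^sup>2) / 2) \<le> \<bar>x\<bar> ^ 3 / 6"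
      by (simp add: cis_conv_exp numeral_2_eq_2 power2_eq_square algebra_simps eval_nat_numeral)
    have "P j - Q j + R j = of_real (m j / real (Suc j)) * (cis x - 1 - \<i> * of_real x + of_real (x\<^sup>2) / 2)"
    proof -
      have n: "complex_of_real (real (Suc j)) \<noteq> 0" by (simp del: of_nat_Suc)
      define J where "J = complex_of_real (real (Suc j))"
      have J: "J \<noteq> 0" using n by (simp add: J_def)
      have "P j - Q j + R j = of_real (m j) / J * (cis x - 1) - \<i> * of_real t * of_real (m j) + of_real t ^ 2 / 2 * (J * of_real (m j))"
        by (simp add: P_def Q_def R_def J_def x_def del: of_nat_Suc)
      also have "\<dots> = of_real (m j) / J * (cis x - 1 - \<i> * (J * of_real t) + (J * of_real t)\<^sup>2 / 2)"
        using J by (simp add: field_simps power2_eq_square)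
      also have "\<dots> = of_real (m j / real (Suc j)) * (cis x - 1 - \<i> * of_real x + of_real (x\<^sup>2) / 2)"
        by (simp add: J_def x_def del: of_nat_Suc)
      finally show ?thesis .
    qed
    also have "norm \<dots> = m j / real (Suc j) * norm (cis x - 1 - \<i> * of_real x + of_real (x\<^sup>2) / 2)"
      using m[of j] by (subst norm_mult, subst norm_of_real) simp
    also have "\<dots> \<le> m j / real (Suc j) * (\<bar>x\<bar> ^ 3 / 6)"
      using m[of j] by (intro mult_left_mono le) auto
    also have "\<dots> = \<bar>t\<bar> ^ 3 / 6 * (real (Suc j) ^ 2 * m j)"
      by (simp add: x_def abs_mult power_mult_distrib power2_eq_square power3_eq_cube field_simps del: of_nat_Suc)
    finally show ?thesis .
  qed
  have "norm (\<Sum>j. P j - Q j + R j) \<le> (\<Sum>j. \<bar>t\<bar> ^ 3 / 6 * (real (Suc j) ^ 2 * m j))"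
    by (rule norm_suminf_le[OF bnd]) (intro summable_mult sm)
  also have "\<dots> = \<bar>t\<bar> ^ 3 / 6 * moment 2 w r"
    unfolding moment_def m_def[symmetric] by (rule suminf_mult) (rule sm)
  finally show ?thesis unfolding eq by (simp add: mult_ac)
qed

lemma exp_coeff_eq_integral:
  "complex_of_real (2 * pi * (exp_coeff w n * r ^ n * exp (- log_gen w r)))
    = (\<integral>t. indicator {- pi..pi} t *\<^sub>R (exp (psi w r t) * cis (- (real n * t))) \<partial>lborel)"
proof -
  define a where "a m = complex_of_real (exp_coeff w m * r ^ m * exp (- log_gen w r))" for m
  have wB: "\<bar>w (Suc j)\<bar> \<le> B" for j using w[of j] by simp
  have sums: "(\<lambda>m. of_real (exp_coeff w m) * z ^ m) sums exp (\<Sum>j. of_real (w (Suc j) / real (Suc j)) * z ^ Suc j)"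
    if "norm z < 1" for z :: complex
    by (rule exp_coeff_sums[where B = B]) (use wB that in auto)
  \<comment> \<open>Absolute summability at radius r follows from convergence at the larger radius
    (1 + r)/2.\<close>
  have "summable (\<lambda>m. norm (of_real (exp_coeff w m) * complex_of_real r ^ m))"
  proof (rule powser_insidea)
    show "summable (\<lambda>m. of_real (exp_coeff w m) * complex_of_real ((1 + r) / 2) ^ m)"
    proof (rule sums_summable[OF sums])
      show "norm (complex_of_real ((1 + r) / 2)) < 1" using r by (subst norm_of_real) auto
    qed
    show "norm (complex_of_real r) < norm (complex_of_real ((1 + r) / 2))"
      using r by (simp del: of_real_divide of_real_add)
  qed
  hence "summable (\<lambda>m. norm (of_real (exp_coeff w m) * complex_of_real r ^ m) * exp (- log_gen w r))"
    by (rule summable_mult2)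
  hence sa: "summable (\<lambda>m. norm (a m))" by (simp add: a_def norm_mult norm_power)
  have eq: "(\<Sum>m. a m * cis (real m * t)) = exp (psi w r t)" for t
  proof -
    define z where "z = of_real r * cis t"
    have z: "norm z < 1" using r by (simp add: z_def norm_mult)
    have zn: "z ^ n = of_real (r ^ n) * cis (real n * t)" for n
      by (simp add: z_def power_mult_distrib Complex.DeMoivre)
    have "a m * cis (real m * t) = of_real (exp_coeff w m) * z ^ m * of_real (exp (- log_gen w r))" for m
      by (simp add: a_def zn mult_ac)
    hence "(\<Sum>m. a m * cis (real m * t)) = (\<Sum>m. of_real (exp_coeff w m) * z ^ m) * of_real (exp (- log_gen w r))"
      using sums_summable[OF sums[OF z]] by (simp add: suminf_mult2)
    also have "\<dots> = exp (\<Sum>j. of_real (w (Suc j) / real (Suc j)) * z ^ Suc j) * exp (- of_real (log_gen w r))"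
      unfolding sums_unique[OF sums[OF z], symmetric] by (simp flip: exp_of_real)
    also have "(\<Sum>j. of_real (w (Suc j) / real (Suc j)) * z ^ Suc j) = psi w r t + of_real (log_gen w r)"
    proof -
      have "of_real (w (Suc j) / real (Suc j)) * z ^ Suc j
          = of_real (w (Suc j) * r ^ Suc j / real (Suc j)) * (cis (real (Suc j) * t) - 1) + of_real (w (Suc j) * r ^ Suc j / real (Suc j))" for j
        unfolding zn by (simp add: algebra_simps diff_divide_distrib del: of_nat_Suc power_Suc)
      hence "(\<Sum>j. of_real (w (Suc j) / real (Suc j)) * z ^ Suc j)
          = (\<Sum>j. of_real (w (Suc j) * r ^ Suc j / real (Suc j)) * (cis (real (Suc j) * t) - 1) + of_real (w (Suc j) * r ^ Suc j / real (Suc j)))"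
        by (simp only:)
      also have "\<dots> = psi w r t + (\<Sum>j. complex_of_real (w (Suc j) * r ^ Suc j / real (Suc j)))"
        unfolding psi_def by (rule suminf_add[symmetric]) (intro summable_psi summable_of_real summable_log_gen)+
      also have "(\<Sum>j. complex_of_real (w (Suc j) * r ^ Suc j / real (Suc j))) = of_real (log_gen w r)"
        unfolding log_gen_def by (rule suminf_of_real[symmetric]) (rule summable_log_gen)
      finally show ?thesis .
    qed
    also have "exp (psi w r t + of_real (log_gen w r)) * exp (- of_real (log_gen w r)) = exp (psi w r t)"
      by (simp flip: exp_add)
    finally show ?thesis .
  qed
  have "(\<integral>t. indicator {- pi..pi} t *\<^sub>R (exp (psi w r t) * cis (- (real n * t))) \<partial>lborel) = 2 * pi * a n"
    unfolding eq[symmetric] by (rule integral_power_series_cis[OF sa])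
  thus ?thesis by (simp add: a_def)
qed

end

lemma measurable_psi [measurable]: "psi w r \<in> borel_measurable borel"
  unfolding psi_def by measurable

theorem exp_coeff_local_limit:
  fixes w :: "nat \<Rightarrow> nat \<Rightarrow> real" and r :: "nat \<Rightarrow> real" and jN :: "nat \<Rightarrow> nat"
  assumes r: "\<forall>\<^sub>F N in sequentially. 0 < r N \<and> r N < 1 \<and> moment 0 (w N) (r N) = real N"
    and w: "\<forall>\<^sub>F N in sequentially. \<exists>B. \<forall>j. 0 \<le> w N (Suc j) \<and> w N (Suc j) \<le> B"
    and a: "filterlim (\<lambda>N. moment 1 (w N) (r N)) at_top sequentially"
    and \<kappa>: "(\<lambda>N. moment 2 (w N) (r N) / (moment 1 (w N) (r N) * sqrt (moment 1 (w N) (r N)))) \<longlonglongrightarrow> 0"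
    and c: "c > 0"
    and decay: "\<forall>\<^sub>F N in sequentially. \<forall>t\<in>{- pi..pi}. osc (w N) (r N) t \<ge> c * sqrt (sqrt (moment 1 (w N) (r N)) * \<bar>t\<bar>) - C"
    and jN: "\<forall>\<^sub>F N in sequentially. jN N \<le> N"
    and jo: "(\<lambda>N. (real (jN N))\<^sup>2 / moment 1 (w N) (r N)) \<longlonglongrightarrow> 0"
    and eps: "\<epsilon> > 0"
  shows "\<forall>\<^sub>F N in sequentially. \<forall>j\<le>jN N.
    \<bar>exp_coeff (w N) (N - j) / (exp (log_gen (w N) (r N)) / (r N ^ (N - j) * sqrt (2 * pi * moment 1 (w N) (r N)))) - 1\<bar> < \<epsilon>"
proof -
  define a where "a N = moment 1 (w N) (r N)" for N
  define X where "X N j = exp_coeff (w N) (N - j) / (exp (log_gen (w N) (r N)) / (r N ^ (N - j) * sqrt (2 * pi * a N)))" for N j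
  \<comment> \<open>At the saddle point \<open>moment 0\<close> equals N, so subtracting i N t
    cancels the linear term of \<open>psi\<close>. The coefficient of index N - b then retains only
    the phase b t.\<close>
  define E where "E N t = psi (w N) (r N) t - \<i> * of_real (real N * t)" for N t
  define bad where "bad N j \<longleftrightarrow> j \<le> jN N \<and> \<not> \<bar>X N j - 1\<bar> < \<epsilon>" for N j
  (* a worst index for each N: convergence along b is uniform convergence *)
  define b where "b N = (if \<exists>j. bad N j then SOME j. bad N j else 0)" for N
  have b_le: "b N \<le> jN N" for N
  proof (cases "\<exists>j. bad N j")
    case True
    hence "bad N (b N)" unfolding b_def using someI_ex[OF True] by simp
    thus ?thesis by (simp add: bad_def)
  qed (simp add: b_def)
  have b_bad: "bad N (b N)" if "bad N j" for N j
    unfolding b_def using someI_ex[of "bad N"] that by auto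
  have "(\<lambda>N. sqrt ((real (jN N))\<^sup>2 / a N)) \<longlonglongrightarrow> sqrt 0"
    using jo unfolding a_def by (rule tendsto_real_sqrt)
  hence jl: "(\<lambda>N. real (jN N) / sqrt (a N)) \<longlonglongrightarrow> 0" by (simp add: real_sqrt_divide)
  have apos: "\<forall>\<^sub>F N in sequentially. a N > 0"
    using a unfolding a_def by (rule filterlim_at_top_dense[THEN iffD1, rule_format])
  have bl: "(\<lambda>N. real (b N) / sqrt (a N)) \<longlonglongrightarrow> 0"
  proof (rule Lim_null_comparison[OF _ jl])
    show "\<forall>\<^sub>F N in sequentially. norm (real (b N) / sqrt (a N)) \<le> real (jN N) / sqrt (a N)"
      using apos by eventually_elim (use b_le in \<open>auto simp: divide_right_mono\<close>)
  qed
  have "(\<lambda>N. of_real (sqrt (a N) / sqrt (2 * pi)) *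
      (\<integral>t. indicator {- pi..pi} t *\<^sub>R (exp (E N t) * cis (real (b N) * t)) \<partial>lborel)) \<longlonglongrightarrow> 1"
  proof (rule gaussian_local_limit[OF _ _ _ _ c _ bl])
    show "E N \<in> borel_measurable borel" for N unfolding E_def by measurable
    show "filterlim a at_top sequentially" using a by (simp add: a_def[abs_def])
    show "(\<lambda>N. moment 2 (w N) (r N) / (a N * sqrt (a N))) \<longlonglongrightarrow> 0" using \<kappa> by (simp add: a_def)
    show "\<forall>\<^sub>F N in sequentially. \<forall>t\<in>{- pi..pi}. norm (E N t + of_real (a N * t\<^sup>2 / 2)) \<le> moment 2 (w N) (r N) * \<bar>t\<bar> ^ 3 / 6"
      using r w
    proof eventually_elim
      case (elim N)
      then obtain B where B: "\<And>j. 0 \<le> w N (Suc j)" "\<And>j. w N (Suc j) \<le> B" by blast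
      show ?case
        using psi_taylor[of "w N" B "r N", OF B] elim(1) by (auto simp: E_def a_def)
    qed
    show "\<forall>\<^sub>F N in sequentially. \<forall>t\<in>{- pi..pi}. Re (E N t) \<le> C - c * sqrt (sqrt (a N) * \<bar>t\<bar>)"
      using r w decay
    proof eventually_elim
      case (elim N)
      then obtain B where B: "\<And>j. 0 \<le> w N (Suc j)" "\<And>j. w N (Suc j) \<le> B" by blast
      have "Re (E N t) = - osc (w N) (r N) t" for t
        using Re_psi[of "w N" B "r N" t, OF B] elim(1) by (simp add: E_def)
      thus ?case using elim(3) by (fastforce simp: a_def)
    qed
  qed
  moreover have "\<forall>\<^sub>F N in sequentially. of_real (sqrt (a N) / sqrt (2 * pi)) *
      (\<integral>t. indicator {- pi..pi} t *\<^sub>R (exp (E N t) * cis (real (b N) * t)) \<partial>lborel) = of_real (X N (b N))"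
    using r w jN apos
  proof eventually_elim
    case (elim N)
    then obtain B where B: "\<And>j. 0 \<le> w N (Suc j)" "\<And>j. w N (Suc j) \<le> B" by blast
    have bN: "b N \<le> N" using b_le[of N] elim(3) by linarith
    define n where "n = N - b N"
    have "exp (E N t) * cis (real (b N) * t) = exp (psi (w N) (r N) t) * cis (- (real n * t))" for t
    proof -
      have "exp (E N t) = exp (psi (w N) (r N) t) * cis (- (real N * t))"
        by (simp add: E_def exp_diff cis_conv_exp exp_minus divide_inverse)
      thus ?thesis using bN by (simp add: n_def mult.assoc cis_mult of_nat_diff algebra_simps)
    qed
    hence "(\<integral>t. indicator {- pi..pi} t *\<^sub>R (exp (E N t) * cis (real (b N) * t)) \<partial>lborel)
       = of_real (2 * pi * (exp_coeff (w N) n * r N ^ n * exp (- log_gen (w N) (r N))))"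
      using exp_coeff_eq_integral[of "w N" B "r N" n, OF B] elim(1) by simp
    moreover have "sqrt (a N) / sqrt (2 * pi) * (2 * pi * (exp_coeff (w N) n * r N ^ n * exp (- log_gen (w N) (r N)))) = X N (b N)"
    proof -
      have "2 * pi = sqrt (2 * pi) * sqrt (2 * pi)" by (simp del: real_sqrt_mult)
      hence "sqrt (a N) / sqrt (2 * pi) * (2 * pi * y) = sqrt (2 * pi * a N) * y" for y
        by (simp add: real_sqrt_mult)
      moreover have "X N (b N) = sqrt (2 * pi * a N) * (exp_coeff (w N) n * r N ^ n * exp (- log_gen (w N) (r N)))"
        unfolding X_def n_def[symmetric] by (simp add: exp_minus divide_inverse mult_ac)
      ultimately show ?thesis by metis
    qed
    ultimately show ?case by (simp only: of_real_mult[symmetric])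
  qed
  ultimately have "(\<lambda>N. complex_of_real (X N (b N))) \<longlonglongrightarrow> of_real 1"
    using Lim_transform_eventually by fastforce
  hence "(\<lambda>N. X N (b N)) \<longlonglongrightarrow> 1" by (simp only: tendsto_of_real_iff)
  hence "\<forall>\<^sub>F N in sequentially. dist (X N (b N)) 1 < \<epsilon>" using eps by (rule tendstoD)
  thus ?thesis
  proof eventually_elim
    case (elim N)
    hence "\<not> bad N (b N)" by (simp add: bad_def dist_real_def)
    hence "\<not> bad N j" for j using b_bad by blast
    thus ?case by (auto simp: bad_def X_def a_def)
  qed
qed

section \<open>Moments and the saddle point\<close>

lemma partial_sum_le_moment_osc:
  fixes w :: "nat \<Rightarrow> real"
  assumes w: "\<And>j. 0 \<le> w (Suc j)" "\<And>j. w (Suc j) \<le> B" and r: "0 < r" "r < 1"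
    and A: "finite A" "0 \<notin> A"
  shows "moment k w r \<ge> (\<Sum>j\<in>A. real j ^ k * (w j * r ^ j))"
    and "osc w r t \<ge> (\<Sum>j\<in>A. w j * r ^ j / real j * (1 - cos (real j * t)))"
proof -
  define A' where "A' = (\<lambda>j. j - 1) ` A"
  have "Suc ` A' = (\<lambda>j. Suc (j - 1)) ` A" by (simp add: A'_def image_image)
  also have "\<dots> = (\<lambda>j. j) ` A"
  proof (rule image_cong[OF refl])
    fix j assume "j \<in> A"
    thus "Suc (j - 1) = j" using A(2) by (cases j) auto
  qed
  finally have A': "finite A'" "A = Suc ` A'" using A(1) by (simp_all add: A'_def)
  show "moment k w r \<ge> (\<Sum>j\<in>A. real j ^ k * (w j * r ^ j))"
    unfolding moment_def A'(2)
    by (subst sum.reindex, simp, unfold o_def, rule sum_le_suminf[OF summable_moment[of w B r, OF w r] A'(1)])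
       (use w(1) r in auto)
  show "osc w r t \<ge> (\<Sum>j\<in>A. w j * r ^ j / real j * (1 - cos (real j * t)))"
    unfolding A'(2)
    by (subst sum.reindex, simp, unfold o_def, rule osc_ge_sum[of w B r, OF w r A'(1)])
qed

lemma moment_le:
  fixes w :: "nat \<Rightarrow> real"
  assumes w: "\<And>j. 0 \<le> w (Suc j)" "\<And>j. w (Suc j) \<le> B" and r: "0 < r" "r < 1"
    and le: "\<And>j. real (Suc j) ^ k * (w (Suc j) * r ^ Suc j) \<le> u j" and u: "summable u"
  shows "moment k w r \<le> suminf u"
  unfolding moment_def by (rule suminf_le[OF le summable_moment[of w B r, OF w r] u])

lemma moment_0_le_moment_1:
  fixes w :: "nat \<Rightarrow> real"
  assumes w: "\<And>j. 0 \<le> w (Suc j)" "\<And>j. w (Suc j) \<le> B" and r: "0 < r" "r < 1"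
  shows "moment 0 w r \<le> moment 1 w r"
  unfolding moment_def
proof (rule suminf_le[OF _ summable_moment[of w B r, OF w r] summable_moment[of w B r, OF w r]])
  fix j
  have "1 * (w (Suc j) * r ^ Suc j) \<le> real (Suc j) * (w (Suc j) * r ^ Suc j)"
    using w(1)[of j] r by (intro mult_right_mono) auto
  thus "real (Suc j) ^ 0 * (w (Suc j) * r ^ Suc j) \<le> real (Suc j) ^ 1 * (w (Suc j) * r ^ Suc j)" by simp
qed

text \<open>Multiplication by 1 - r replaces j^k by its difference (summation by parts) and so
  lowers the degree. For k = 2 the difference (j + 2)^2 - (j + 1)^2 is bounded by 2 (j + 2).\<close>

lemma geometric_moments:
  fixes r :: real
  assumes r: "0 < r" "r < 1"
  shows "(\<Sum>j. real (Suc j) ^ 0 * r ^ Suc j) \<le> 1 / (1 - r)"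
    and "(\<Sum>j. real (Suc j) ^ 1 * r ^ Suc j) \<le> (1 / (1 - r))\<^sup>2"
    and "(\<Sum>j. real (Suc j) ^ 2 * r ^ Suc j) \<le> 2 * (1 / (1 - r)) ^ 3"
proof -
  define s where "s k = (\<Sum>j. real (Suc j) ^ k * r ^ Suc j)" for k
  have sm: "summable (\<lambda>j. real (Suc j) ^ k * r ^ Suc j)" for k
    by (rule summable_poly_geometric[OF r])
  have step: "s k * (1 - r) = r + (\<Sum>j. (real (Suc (Suc j)) ^ k - real (Suc j) ^ k) * r ^ Suc (Suc j))" for k
  proof -
    have "s k - r = (\<Sum>j. real (Suc (Suc j)) ^ k * r ^ Suc (Suc j))"
      unfolding s_def using suminf_split_head[OF sm[of k]] by simp
    moreover have "r * s k = (\<Sum>j. real (Suc j) ^ k * r ^ Suc (Suc j))"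
      unfolding s_def using suminf_mult[OF sm[of k], of r] by (simp add: mult_ac)
    moreover have "summable (\<lambda>j. real (Suc (Suc j)) ^ k * r ^ Suc (Suc j))"
      using sm[of k] by (subst summable_Suc_iff[where f = "\<lambda>j. real (Suc j) ^ k * r ^ Suc j"])
    moreover have "summable (\<lambda>j. real (Suc j) ^ k * r ^ Suc (Suc j))"
      using summable_mult[OF sm[of k], of r] by (simp add: mult_ac)
    ultimately have "s k - r - r * s k = (\<Sum>j. real (Suc (Suc j)) ^ k * r ^ Suc (Suc j) - real (Suc j) ^ k * r ^ Suc (Suc j))"
      by (simp add: suminf_diff)
    thus ?thesis by (simp add: algebra_simps)
  qed
  have 0: "s 0 = r / (1 - r)" using step[of 0] r by (simp add: field_simps)
  have sh: "(\<Sum>j. real (Suc (Suc j)) ^ k * r ^ Suc (Suc j)) = s k - r" for k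
    unfolding s_def using suminf_split_head[OF sm[of k]] by simp
  have 1: "s 1 = r / (1 - r)\<^sup>2"
  proof -
    have "s 1 * (1 - r) = r + (s 0 - r)" unfolding step[of 1] sh[of 0, symmetric] by simp
    hence "s 1 * (1 - r) = r / (1 - r)" using 0 by simp
    hence "s 1 = r / (1 - r) / (1 - r)" using r by (subst nonzero_eq_divide_eq) auto
    thus ?thesis by (simp add: power2_eq_square)
  qed
  have 2: "s 2 * (1 - r) \<le> 2 * s 1"
  proof -
    have "(\<Sum>j. (real (Suc (Suc j)) ^ 2 - real (Suc j) ^ 2) * r ^ Suc (Suc j)) \<le> (\<Sum>j. 2 * (real (Suc (Suc j)) ^ 1 * r ^ Suc (Suc j)))"
    proof (rule suminf_le)
      have s1: "summable (\<lambda>j. real (Suc (Suc j)) ^ 1 * r ^ Suc (Suc j))"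
        using sm[of 1] by (subst summable_Suc_iff[where f = "\<lambda>j. real (Suc j) ^ 1 * r ^ Suc j"])
      thus s2: "summable (\<lambda>j. 2 * (real (Suc (Suc j)) ^ 1 * r ^ Suc (Suc j)))" by (rule summable_mult)
      show le: "(real (Suc (Suc j)) ^ 2 - real (Suc j) ^ 2) * r ^ Suc (Suc j) \<le> 2 * (real (Suc (Suc j)) ^ 1 * r ^ Suc (Suc j))" for j
      proof -
        have "(real (Suc (Suc j)) ^ 2 - real (Suc j) ^ 2) \<le> 2 * real (Suc (Suc j))"
          by (simp add: power2_eq_square algebra_simps)
        hence "(real (Suc (Suc j)) ^ 2 - real (Suc j) ^ 2) * r ^ Suc (Suc j) \<le> (2 * real (Suc (Suc j))) * r ^ Suc (Suc j)"
          using r by (intro mult_right_mono) auto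
        thus ?thesis by (simp only: power_one_right mult.assoc)
      qed
      show "summable (\<lambda>j. (real (Suc (Suc j)) ^ 2 - real (Suc j) ^ 2) * r ^ Suc (Suc j))"
        by (rule summable_comparison_test'[OF s2]) (use le r in \<open>auto simp: abs_mult power2_eq_square algebra_simps\<close>)
    qed
    also have "\<dots> = 2 * (s 1 - r)"
      unfolding sh[of 1, symmetric]
    proof (rule suminf_mult)
      show "summable (\<lambda>j. real (Suc (Suc j)) ^ 1 * r ^ Suc (Suc j))"
        using sm[of 1] by (subst summable_Suc_iff[where f = "\<lambda>j. real (Suc j) ^ 1 * r ^ Suc j"])
    qed
    finally show ?thesis using step[of 2] r by simp
  qed
  show "(\<Sum>j. real (Suc j) ^ 0 * r ^ Suc j) \<le> 1 / (1 - r)"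
    using 0 r unfolding s_def[symmetric] by (simp add: divide_right_mono)
  show "(\<Sum>j. real (Suc j) ^ 1 * r ^ Suc j) \<le> (1 / (1 - r))\<^sup>2"
    using 1 r unfolding s_def[symmetric] by (simp add: power_divide divide_right_mono)
  have "s 2 \<le> 2 * s 1 / (1 - r)" using 2 r by (simp add: pos_le_divide_eq)
  also have "\<dots> \<le> 2 * (1 / (1 - r)\<^sup>2) / (1 - r)"
    unfolding 1 using r by (intro divide_right_mono mult_left_mono) auto
  also have "\<dots> = 2 * (1 / (1 - r)) ^ 3" using r by (simp add: power2_eq_square power3_eq_cube)
  finally show "(\<Sum>j. real (Suc j) ^ 2 * r ^ Suc j) \<le> 2 * (1 / (1 - r)) ^ 3"
    unfolding s_def .
qed

text \<open>\<open>moment 0\<close> is a power series with nonnegative coefficients, hence strictly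
  increasing unless it vanishes, and it starts from 0. The intermediate value theorem on [0, R] also
  locates the solution below R, which is how r is later kept away from 1.\<close>

lemma saddle_point_ex1:
  fixes w :: "nat \<Rightarrow> real"
  assumes w: "\<And>j. 0 \<le> w (Suc j)" "\<And>j. w (Suc j) \<le> B"
    and R: "0 < R" "R < 1" "moment 0 w R \<ge> y" and y: "y > 0"
  shows "\<exists>!r. 0 < r \<and> r < 1 \<and> moment 0 w r = y" and "\<exists>r. 0 < r \<and> r \<le> R \<and> moment 0 w r = y"
proof -
  have strict: "moment 0 w r < moment 0 w r'" if "0 < r" "r < r'" "r' < 1" "moment 0 w r' > 0" for r r'
  proof -
    have "\<exists>j. w (Suc j) > 0"
    proof (rule ccontr)
      assume "\<nexists>j. w (Suc j) > 0"
      hence "w (Suc j) = 0" for j using w(1)[of j] by (meson antisym not_le)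
      with that show False by (simp add: moment_def)
    qed
    then obtain i where i: "w (Suc i) > 0" ..
    have "0 < (\<Sum>j. w (Suc j) * r' ^ Suc j - w (Suc j) * r ^ Suc j)"
    proof (rule suminf_pos2)
      show "summable (\<lambda>j. w (Suc j) * r' ^ Suc j - w (Suc j) * r ^ Suc j)"
        using summable_moment[of w B r 0, OF w] summable_moment[of w B r' 0, OF w] that by (intro summable_diff) auto
      show "0 \<le> w (Suc j) * r' ^ Suc j - w (Suc j) * r ^ Suc j" for j
        using w(1)[of j] that power_mono[of r r' "Suc j"] by (simp add: mult_left_mono del: power_Suc)
      have "r ^ Suc i < r' ^ Suc i" using that by (intro power_strict_mono) auto
      thus "0 < w (Suc i) * r' ^ Suc i - w (Suc i) * r ^ Suc i" using i by (simp del: power_Suc)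
    qed
    also have "\<dots> = moment 0 w r' - moment 0 w r"
      unfolding moment_def using summable_moment[of w B r 0, OF w] summable_moment[of w B r' 0, OF w] that
      by (subst suminf_diff[symmetric]) auto
    finally show ?thesis by simp
  qed
  define f where "f r = (\<Sum>n. (if n = 0 then 0 else w n) * r ^ n)" for r :: real
  have sumf: "summable (\<lambda>n. (if n = 0 then 0 else w n) * r ^ n)" if "\<bar>r\<bar> < 1" for r :: real
  proof -
    have "summable (\<lambda>n. w (Suc n) * r ^ Suc n)"
    proof (rule summable_comparison_test')
      show "summable (\<lambda>n. B * \<bar>r\<bar> ^ Suc n)" using that by (intro summable_mult) (simp add: summable_geometric)
      show "norm (w (Suc n) * r ^ Suc n) \<le> B * \<bar>r\<bar> ^ Suc n" if "n \<ge> 0" for n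
        using w[of n] by (simp add: abs_mult power_abs mult_right_mono del: power_Suc)
    qed
    thus ?thesis by (subst summable_Suc_iff[symmetric]) simp
  qed
  have f_eq: "f r = moment 0 w r" if "\<bar>r\<bar> < 1" for r
    unfolding f_def moment_def using suminf_split_head[OF sumf[OF that]] by simp
  have cont: "continuous_on {0..R} f"
  proof (intro continuous_at_imp_continuous_on ballI)
    fix x assume x: "x \<in> {0..R}"
    show "isCont f x" unfolding f_def
    proof (rule isCont_powser)
      show "summable (\<lambda>n. (if n = 0 then 0 else w n) * ((1 + R) / 2) ^ n)" by (rule sumf) (use R in auto)
      show "norm x < norm ((1 + R) / 2)" using x R by auto
    qed
  qed
  have f0: "f 0 = 0" unfolding f_def by (subst powser_zero) simp
  have "\<exists>r\<ge>0. r \<le> R \<and> f r = y"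
    by (rule IVT'[OF _ _ _ cont]) (use R y f0 f_eq[of R] in auto)
  then obtain r where r: "r \<ge> 0" "r \<le> R" "f r = y" by blast
  have "r \<noteq> 0" using r y f0 by auto
  hence r': "0 < r" "r \<le> R" "moment 0 w r = y" using r f_eq[of r] R by auto
  thus "\<exists>r. 0 < r \<and> r \<le> R \<and> moment 0 w r = y" by blast
  show "\<exists>!r. 0 < r \<and> r < 1 \<and> moment 0 w r = y"
  proof (rule ex1I[of _ r])
    show "0 < r \<and> r < 1 \<and> moment 0 w r = y" using r' R by auto
    fix x assume "0 < x \<and> x < 1 \<and> moment 0 w x = y"
    thus "x = r" using strict[of x r] strict[of r x] r' R y by (cases x r rule: linorder_cases) auto
  qed
qed

text \<open>Termwise differentiation of power series links the quantities of the theorem, stated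
  with \<open>deriv\<close>, to the moments. The first derivative is established on the whole unit
  ball because \<open>deriv\<close> is iterated.\<close>

lemma deriv_log_gen:
  fixes w :: "nat \<Rightarrow> real"
  assumes w: "\<And>j. 0 \<le> w (Suc j)" "\<And>j. w (Suc j) \<le> B" and r: "0 < r" "r < 1"
  shows "r * deriv (log_gen w) r = moment 0 w r"
    and "r * deriv (log_gen w) r + r\<^sup>2 * deriv (deriv (log_gen w)) r = moment 1 w r"
proof -
  define c where "c n = (if n = 0 then 0 else w n / real n)" for n
  have sumw: "summable (\<lambda>n. w (Suc n) * z ^ n)" if "\<bar>z\<bar> < 1" for z
  proof (rule summable_comparison_test')
    show "summable (\<lambda>n. B * \<bar>z\<bar> ^ n)" using that by (intro summable_mult) (simp add: summable_geometric)
    show "norm (w (Suc n) * z ^ n) \<le> B * \<bar>z\<bar> ^ n" if "n \<ge> 0" for n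
      using w[of n] by (simp add: abs_mult power_abs mult_right_mono)
  qed
  have sumc: "summable (\<lambda>n. c n * z ^ n)" if "norm z < 1" for z
  proof -
    have "summable (\<lambda>n. c (Suc n) * z ^ Suc n)"
    proof (rule summable_comparison_test')
      show "summable (\<lambda>n. B * \<bar>z\<bar> ^ Suc n)" using that by (intro summable_mult) (simp add: summable_geometric)
      show "norm (c (Suc n) * z ^ Suc n) \<le> B * \<bar>z\<bar> ^ Suc n" if "n \<ge> 0" for n
      proof -
        have "w (Suc n) / real (Suc n) \<le> B / 1" using w[of n] order_trans[OF w(1)[of n] w(2)[of n]] by (intro frac_le) auto
        hence "c (Suc n) * \<bar>z\<bar> ^ Suc n \<le> B * \<bar>z\<bar> ^ Suc n" by (intro mult_right_mono) (auto simp: c_def)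
        moreover have "c (Suc n) \<ge> 0" using w(1)[of n] by (simp add: c_def)
        ultimately show ?thesis by (simp add: abs_mult power_abs del: power_Suc)
      qed
    qed
    thus ?thesis by (subst summable_Suc_iff[symmetric])
  qed
  have G: "log_gen w z = (\<Sum>n. c n * z ^ n)" if "norm z < 1" for z
    unfolding log_gen_def using suminf_split_head[OF sumc[OF that]] by (simp add: c_def)
  have dc: "diffs c n = w (Suc n)" for n by (simp add: diffs_def c_def del: of_nat_Suc)
  have op: "open (ball (0::real) 1)" by simp
  have D1: "(log_gen w has_field_derivative (\<Sum>n. w (Suc n) * z ^ n)) (at z)" if "norm z < 1" for z
  proof (rule has_field_derivative_transform_within_open[OF _ op])
    show "((\<lambda>z. \<Sum>n. c n * z ^ n) has_field_derivative (\<Sum>n. w (Suc n) * z ^ n)) (at z)"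
      using termdiffs_strong'[of 1 c z, OF sumc that] by (simp only: dc)
  qed (use that G in auto)
  have D1': "deriv (log_gen w) z = (\<Sum>n. w (Suc n) * z ^ n)" if "norm z < 1" for z
    by (rule DERIV_imp_deriv[OF D1[OF that]])
  have "((\<lambda>z. \<Sum>n. w (Suc n) * z ^ n) has_field_derivative (\<Sum>n. diffs (\<lambda>n. w (Suc n)) n * z ^ n)) (at z)"
    if "norm z < 1" for z
    using termdiffs_strong'[of 1 "\<lambda>n. w (Suc n)" z] sumw that by auto
  hence D2: "(deriv (log_gen w) has_field_derivative (\<Sum>n. diffs (\<lambda>n. w (Suc n)) n * z ^ n)) (at z)" if "norm z < 1" for z
    by (rule has_field_derivative_transform_within_open[OF _ op]) (use that D1' in auto)
  have nr: "norm r < 1" using r by simp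
  note sm = summable_moment[of w B r, OF w r]
  show m0: "r * deriv (log_gen w) r = moment 0 w r"
  proof -
    have "r * (\<Sum>n. w (Suc n) * r ^ n) = (\<Sum>n. r * (w (Suc n) * r ^ n))"
      by (rule suminf_mult[symmetric]) (rule sumw, use r in simp)
    thus ?thesis unfolding D1'[OF nr] by (simp add: moment_def mult_ac)
  qed
  have "r\<^sup>2 * deriv (deriv (log_gen w)) r = (\<Sum>n. real n * (w (Suc n) * r ^ Suc n))"
  proof -
    have s1: "summable (\<lambda>n. real n * (w (Suc n) * r ^ Suc n))"
      using summable_diff[OF sm[of 1] sm[of 0]] by (simp add: algebra_simps)
    have s2: "summable (\<lambda>n. diffs (\<lambda>n. w (Suc n)) n * r ^ n)"
      by (rule termdiff_converges[of r 1]) (use sumw r in auto)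
    have "(\<Sum>n. real n * (w (Suc n) * r ^ Suc n)) = (\<Sum>n. real (Suc n) * (w (Suc (Suc n)) * r ^ Suc (Suc n)))"
      using suminf_split_head[OF s1] by simp
    also have "\<dots> = (\<Sum>n. r\<^sup>2 * (diffs (\<lambda>n. w (Suc n)) n * r ^ n))"
      by (simp add: diffs_def power2_eq_square mult_ac)
    also have "\<dots> = r\<^sup>2 * (\<Sum>n. diffs (\<lambda>n. w (Suc n)) n * r ^ n)" by (rule suminf_mult[OF s2])
    finally show ?thesis using DERIV_imp_deriv[OF D2[OF nr]] by simp
  qed
  also have "\<dots> = moment 1 w r - moment 0 w r"
    unfolding moment_def suminf_diff[OF sm sm] by (simp add: algebra_simps)
  finally show "r * deriv (log_gen w) r + r\<^sup>2 * deriv (deriv (log_gen w)) r = moment 1 w r"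
    using m0 by simp
qed

section \<open>Weights of lattice type\<close>

text \<open>Past |t| = 2 the left side is at least 1 - cos 2 \<ge> 4/3, while pi^2 < 10 keeps the
  right side at most 1.\<close>

lemma one_minus_cos_ge_pi:
  fixes t :: real
  assumes "\<bar>t\<bar> \<le> pi"
  shows "1 - cos t \<ge> t\<^sup>2 / 10"
proof (cases "\<bar>t\<bar> \<le> 2")
  case True
  from one_minus_cos_ge[OF this] show ?thesis using zero_le_power2[of t] by linarith
next
  case False
  have "cos \<bar>t\<bar> \<le> cos 2" using False assms by (intro cos_monotone_0_pi_le) auto
  moreover have "1 - cos 2 \<ge> (4/3 :: real)" using one_minus_cos_ge[of 2] by simp
  moreover have "t\<^sup>2 \<le> 10"
  proof -
    have "\<bar>t\<bar>\<^sup>2 \<le> 3.15\<^sup>2" using assms pi_approx by (intro power_mono) auto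
    thus ?thesis by (simp add: power2_eq_square)
  qed
  ultimately show ?thesis by simp
qed

text \<open>With x = sqrt a |t| this weakens a quadratic lower bound a t^2 to the shape of condition
  (2), at the price of an additive constant.\<close>

lemma sqrt_le_square_plus_1: "sqrt x \<le> x\<^sup>2 + 1" if "x \<ge> 0" for x :: real
proof (cases "x \<le> 1")
  case True
  hence "sqrt x \<le> 1" by simp
  thus ?thesis using zero_le_power2[of x] by linarith
next
  case False
  hence "sqrt x \<le> x\<^sup>2" by (intro real_le_lsqrt) (auto simp: power2_eq_square mult_ge1_I intro: order_trans[of _ "x * x"])
  thus ?thesis by simp
qed

text \<open>The interface between the analytic limit and the regimes: the saddle-point equation
  together with conditions (1) and (2) of the overview. Divergence of \<open>moment 1\<close>
  follows, since it is at least \<open>moment 0\<close> = N.\<close>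

definition good_saddle :: "(nat \<Rightarrow> nat \<Rightarrow> real) \<Rightarrow> (nat \<Rightarrow> real) \<Rightarrow> bool" where
  "good_saddle w r \<longleftrightarrow>
    (\<forall>\<^sub>F N in sequentially. 0 < r N \<and> r N < 1 \<and> moment 0 (w N) (r N) = real N) \<and>
    (\<lambda>N. moment 2 (w N) (r N) / (moment 1 (w N) (r N) * sqrt (moment 1 (w N) (r N)))) \<longlonglongrightarrow> 0 \<and>
    (\<exists>c>0. \<exists>C. \<forall>\<^sub>F N in sequentially. \<forall>t\<in>{- pi..pi}. osc (w N) (r N) t \<ge> c * sqrt (sqrt (moment 1 (w N) (r N)) * \<bar>t\<bar>) - C)"

text \<open>\<open>p j\<close> stands for the value at 0 of the j-fold convolution, the k = 0 term
  of the lattice sum, and \<open>lam\<close> for the constant of the local limit theorem. What the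
  regimes need to know about the weights is deduced from these bounds.\<close>

locale lattice_weights =
  fixes Wf :: "real \<Rightarrow> nat \<Rightarrow> real" and p :: "nat \<Rightarrow> real" and \<theta> C lam :: real and d :: nat
  assumes \<theta>: "\<theta> > 0" and C: "C > 0" and d: "d \<ge> 1" and lam: "lam > 0"
    and W_nonneg: "L \<ge> 2 \<Longrightarrow> j \<ge> 1 \<Longrightarrow> 0 \<le> Wf L j"
    and W_upper: "L \<ge> 2 \<Longrightarrow> j \<ge> 1 \<Longrightarrow> Wf L j \<le> C * (1 + L / sqrt (real j)) ^ d"
    and W_lower: "L \<ge> 2 \<Longrightarrow> j \<ge> 1 \<Longrightarrow> \<theta> * L ^ d * p j \<le> Wf L j"
    and p_nonneg: "j \<ge> 1 \<Longrightarrow> 0 \<le> p j"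
    and p_limit: "(\<lambda>j. sqrt (real j) ^ d * p j) \<longlonglongrightarrow> lam"
begin

lemma W_crude:
  assumes "L \<ge> 2"
  shows "0 \<le> Wf L (Suc j)" "Wf L (Suc j) \<le> C * 2 ^ d * L ^ d"
proof -
  show "0 \<le> Wf L (Suc j)" by (rule W_nonneg[OF assms]) simp
  have "Wf L (Suc j) \<le> C * (1 + L / sqrt (real (Suc j))) ^ d" by (rule W_upper[OF assms]) simp
  also have "\<dots> \<le> C * (2 * L) ^ d"
  proof (intro mult_left_mono power_mono)
    have "L / sqrt (real (Suc j)) \<le> L / 1" using assms by (intro divide_left_mono) auto
    thus "1 + L / sqrt (real (Suc j)) \<le> 2 * L" using assms by simp
  qed (use C assms in auto)
  finally show "Wf L (Suc j) \<le> C * 2 ^ d * L ^ d" by (simp add: power_mult_distrib)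
qed

lemma p_lower:
  obtains j0 where "j0 \<ge> 1" "\<And>j. j \<ge> j0 \<Longrightarrow> p j \<ge> (lam / 2) / sqrt (real j) ^ d"
proof -
  have "\<forall>\<^sub>F j in sequentially. sqrt (real j) ^ d * p j > lam / 2"
    using p_limit lam by (intro order_tendstoD(1)) auto
  then obtain j1 where j1: "\<And>j. j \<ge> j1 \<Longrightarrow> sqrt (real j) ^ d * p j > lam / 2"
    by (auto simp: eventually_sequentially)
  show ?thesis
  proof (rule that[of "max j1 1"])
    fix j assume j: "j \<ge> max j1 1"
    hence "sqrt (real j) ^ d > 0" by simp
    thus "p j \<ge> (lam / 2) / sqrt (real j) ^ d" using j1[of j] j by (simp add: pos_divide_le_eq mult.commute)
  qed simp
qed

section \<open>Saddle points bounded away from 1\<close>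

lemma moment_ge_partial_sum:
  assumes L: "L \<ge> 2" and R: "0 < R" "R < 1"
  shows "moment 0 (Wf L) R \<ge> L ^ d * (\<theta> * (\<Sum>j\<in>{1..J}. p j * R ^ j))"
proof -
  have "L ^ d * (\<theta> * (\<Sum>j\<in>{1..J}. p j * R ^ j)) = (\<Sum>j\<in>{1..J}. (\<theta> * L ^ d * p j) * R ^ j)"
    by (simp add: sum_distrib_left mult_ac)
  also have "\<dots> \<le> (\<Sum>j\<in>{1..J}. real j ^ 0 * (Wf L j * R ^ j))"
  proof (rule sum_mono)
    fix j assume "j \<in> {1..J}"
    hence "\<theta> * L ^ d * p j * R ^ j \<le> Wf L j * R ^ j" using R by (intro mult_right_mono W_lower[OF L]) auto
    thus "\<theta> * L ^ d * p j * R ^ j \<le> real j ^ 0 * (Wf L j * R ^ j)" by (simp only: power_0 mult_1_left)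
  qed
  also have "\<dots> \<le> moment 0 (Wf L) R"
    by (rule partial_sum_le_moment_osc(1)[where B = "C * 2 ^ d * L ^ d"]) (use W_crude[OF L] R in auto)
  finally show ?thesis .
qed

text \<open>A finite partial sum is a polynomial in R, so a strict inequality at R = 1 persists
  slightly below 1. Truncation treats convergent and divergent series alike.\<close>

lemma ex_radius:
  assumes "\<theta> * (\<Sum>j\<in>{1..J}. p j) > x"
  shows "\<exists>R. 0 < R \<and> R < 1 \<and> \<theta> * (\<Sum>j\<in>{1..J}. p j * R ^ j) > x"
proof -
  have "((\<lambda>R. \<theta> * (\<Sum>j\<in>{1..J}. p j * R ^ j)) \<longlongrightarrow> \<theta> * (\<Sum>j\<in>{1..J}. p j * 1 ^ j)) (at_left 1)"
    by (intro tendsto_intros)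
  hence "\<forall>\<^sub>F R in at_left 1. \<theta> * (\<Sum>j\<in>{1..J}. p j * R ^ j) > x"
    using assms by (intro order_tendstoD(1)) auto
  moreover have "\<forall>\<^sub>F R in at_left (1::real). R \<in> {0<..<1}"
    by (rule eventually_at_left_real) simp
  ultimately have "\<forall>\<^sub>F R in at_left 1. 0 < R \<and> R < 1 \<and> \<theta> * (\<Sum>j\<in>{1..J}. p j * R ^ j) > x"
    by eventually_elim auto
  thus ?thesis using eventually_happens[of _ "at_left (1::real)"] by (auto simp: trivial_limit_at_left_real)
qed

text \<open>A single frequency m loses sight of t near nonzero multiples of 2 pi / m. Two
  consecutive frequencies together dominate 1 - cos t, by
  \<open>one_minus_cos_diff_le\<close>.\<close>

lemma osc_two_terms:
  assumes L: "L \<ge> 2" and r: "0 < r0" "r0 \<le> r" "r < 1" and m: "m \<ge> 1" and \<eta>: "\<eta> \<ge> 0" "p m \<ge> \<eta>" "p (Suc m) \<ge> \<eta>"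
  shows "osc (Wf L) r t \<ge> \<theta> * \<eta> * r0 ^ Suc m / real (Suc m) * L ^ d * ((1 - cos t) / 2)"
proof -
  define K where "K = \<theta> * \<eta> * r0 ^ Suc m / real (Suc m) * L ^ d"
  have K: "K \<ge> 0" using \<theta> \<eta> r L by (simp add: K_def)
  have tm: "K * (1 - cos (real j * t)) \<le> Wf L j * r ^ j / real j * (1 - cos (real j * t))" if j: "j \<in> {m, Suc m}" for j
  proof (intro mult_right_mono)
    have j1: "j \<ge> 1" "j \<le> Suc m" using j m by auto
    have "r0 ^ Suc m \<le> r ^ Suc m" using r by (intro power_mono) auto
    also have "\<dots> \<le> r ^ j" using r j1 by (intro power_decreasing) auto
    finally have rr: "r0 ^ Suc m \<le> r ^ j" .
    have "\<theta> * L ^ d * \<eta> \<le> \<theta> * L ^ d * p j" using \<theta> L \<eta> j by (intro mult_left_mono) auto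
    also have "\<dots> \<le> Wf L j" by (rule W_lower[OF L j1(1)])
    finally have "\<theta> * L ^ d * \<eta> \<le> Wf L j" .
    hence "(\<theta> * L ^ d * \<eta>) * r0 ^ Suc m / real (Suc m) \<le> Wf L j * r ^ j / real j"
      using j1 rr r \<theta> L \<eta> W_nonneg[OF L j1(1)] by (intro frac_le mult_mono) auto
    thus "K \<le> Wf L j * r ^ j / real j" by (simp add: K_def mult_ac)
  qed auto
  have "(1 - cos t) / 2 \<le> (1 - cos (real m * t)) + (1 - cos (real (Suc m) * t))"
    using one_minus_cos_diff_le[of t "real m * t"] by (simp add: distrib_right add.commute)
  hence "K * ((1 - cos t) / 2) \<le> K * ((1 - cos (real m * t)) + (1 - cos (real (Suc m) * t)))"
    using K by (rule mult_left_mono)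
  also have "\<dots> = (\<Sum>j\<in>{m, Suc m}. K * (1 - cos (real j * t)))"
    by (simp add: algebra_simps)
  also have "\<dots> \<le> (\<Sum>j\<in>{m, Suc m}. Wf L j * r ^ j / real j * (1 - cos (real j * t)))"
    by (rule sum_mono) (rule tm)
  also have "\<dots> \<le> osc (Wf L) r t"
    by (rule partial_sum_le_moment_osc(2)[where B = "C * 2 ^ d * L ^ d"]) (use W_crude[OF L] r m in auto)
  finally show ?thesis by (simp add: K_def)
qed

text \<open>With r confined to a compact part of (0, 1), a is comparable to L^d. Hence
  \<open>moment 2\<close> / a^(3/2) is O(1 / sqrt N), and two fixed terms already give an
  oscillation of at least c a t^2.\<close>

lemma good_saddle_bounded:
  assumes R0: "0 < R0" "R0 < 1" and x: "x > 0"
    and ev: "\<forall>\<^sub>F N in sequentially. L N \<ge> 2 \<and> 0 < r N \<and> r N \<le> R0 \<and> moment 0 (Wf (L N)) (r N) = real N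
               \<and> x * L N ^ d \<le> real N"
  shows "good_saddle (\<lambda>N. Wf (L N)) r"
proof -
  obtain m where m: "m \<ge> 1" "\<And>j. j \<ge> m \<Longrightarrow> p j \<ge> (lam / 2) / sqrt (real j) ^ d" using p_lower by blast
  define \<eta> where "\<eta> = (lam / 2) / sqrt (real (Suc m)) ^ d"
  have \<eta>: "\<eta> > 0" using lam by (simp add: \<eta>_def)
  have pm: "p m \<ge> \<eta>"
  proof -
    have "\<eta> \<le> (lam / 2) / sqrt (real m) ^ d"
      unfolding \<eta>_def using lam m(1) by (intro divide_left_mono power_mono) auto
    thus ?thesis using m(2)[of m] by simp
  qed
  have pm': "p (Suc m) \<ge> \<eta>" using m(2)[of "Suc m"] by (simp add: \<eta>_def)
  define C' where "C' = C * 2 ^ d"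
  have C': "C' > 0" using C by (simp add: C'_def)
  define S where "S k = (\<Sum>j. real (Suc j) ^ k * R0 ^ Suc j)" for k
  have sS: "summable (\<lambda>j. real (Suc j) ^ k * R0 ^ Suc j)" for k by (rule summable_poly_geometric[OF R0])
  have Spos: "S k > 0" for k
    unfolding S_def by (rule suminf_pos[OF sS]) (use R0 in auto)
  have mom: "moment k (Wf l) s \<le> C' * l ^ d * S k" if l: "l \<ge> 2" and s: "0 < s" "s \<le> R0" for l s k
  proof -
    have "moment k (Wf l) s \<le> (\<Sum>j. C' * l ^ d * (real (Suc j) ^ k * R0 ^ Suc j))"
    proof (rule moment_le[where B = "C' * l ^ d"])
      fix j
      have "Wf l (Suc j) * (real (Suc j) ^ k * s ^ Suc j) \<le> C' * l ^ d * (real (Suc j) ^ k * R0 ^ Suc j)"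
        using W_crude[OF l, of j] s C' l by (intro mult_mono power_mono) (auto simp: C'_def)
      thus "real (Suc j) ^ k * (Wf l (Suc j) * s ^ Suc j) \<le> C' * l ^ d * (real (Suc j) ^ k * R0 ^ Suc j)"
        by (simp only: mult_ac)
    qed (use W_crude[OF l] s R0 sS in \<open>auto simp: C'_def intro!: summable_mult\<close>)
    also have "\<dots> = C' * l ^ d * S k" unfolding S_def by (rule suminf_mult[OF sS])
    finally show ?thesis .
  qed
  \<comment> \<open>The lower end of the range: x l^d \<le> \<open>moment 0\<close> \<le> C' l^d s /
    (1 - R0) forces s \<ge> \<open>r0\<close>.\<close>
  define r0 where "r0 = x * (1 - R0) / C'"
  have r0: "r0 > 0" using x R0 C' by (simp add: r0_def)
  have r0_le: "r0 \<le> s" if l: "l \<ge> 2" and s: "0 < s" "s \<le> R0" and le: "x * l ^ d \<le> moment 0 (Wf l) s" for l s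
  proof -
    have s1: "s < 1" using s R0 by simp
    have "moment 0 (Wf l) s \<le> (\<Sum>j. C' * l ^ d * s ^ Suc j)"
    proof (rule moment_le[where B = "C' * l ^ d"])
      show "summable (\<lambda>j. C' * l ^ d * s ^ Suc j)"
        using s s1 by (intro summable_mult) (simp add: summable_geometric)
      show "real (Suc j) ^ 0 * (Wf l (Suc j) * s ^ Suc j) \<le> C' * l ^ d * s ^ Suc j" for j
        using W_crude[OF l, of j] s by (simp add: C'_def mult_right_mono)
    qed (use W_crude[OF l] s s1 in \<open>auto simp: C'_def\<close>)
    also have "\<dots> = C' * l ^ d * (s / (1 - s))"
    proof -
      have "(\<lambda>j. C' * l ^ d * (s * s ^ j)) sums (C' * l ^ d * (s * (1 / (1 - s))))"
        using s s1 by (intro sums_mult geometric_sums) auto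
      thus ?thesis by (simp add: sums_iff)
    qed
    also have "\<dots> \<le> C' * l ^ d * (s / (1 - R0))"
      using s R0 C' l by (intro mult_left_mono divide_left_mono) auto
    finally have "x * l ^ d \<le> C' * l ^ d * (s / (1 - R0))" using le by simp
    hence "l ^ d * x \<le> l ^ d * (C' * (s / (1 - R0)))" by (simp add: mult_ac)
    hence "x \<le> C' * (s / (1 - R0))" by (rule mult_left_le_imp_le) (use l in simp)
    thus ?thesis using C' R0 by (simp add: r0_def field_simps)
  qed
  \<comment> \<open>The 20 combines 1 - cos t \<ge> t^2 / 10 with the half in
    \<open>osc_two_terms\<close>. Dividing by C' \<open>S 1\<close>, the upper bound for a / L^d,
    then turns L^d into a.\<close>
  define K where "K = \<theta> * \<eta> * r0 ^ Suc m / real (Suc m) / 20"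
  have K: "K > 0" using \<theta> \<eta> r0 by (simp add: K_def)
  define c where "c = K / (C' * S 1)"
  have c: "c > 0" using K C' Spos by (simp add: c_def)
  have bounds: "\<forall>\<^sub>F N in sequentially.
       moment 2 (Wf (L N)) (r N) \<ge> 0 \<and> moment 1 (Wf (L N)) (r N) \<ge> real N \<and> moment 2 (Wf (L N)) (r N) \<le> C' * S 2 / x * moment 1 (Wf (L N)) (r N) \<and>
       (\<forall>t\<in>{- pi..pi}. osc (Wf (L N)) (r N) t \<ge> c * sqrt (sqrt (moment 1 (Wf (L N)) (r N)) * \<bar>t\<bar>) - c)"
    using ev
  proof eventually_elim
    case (elim N)
    define l s where "l = L N" and "s = r N"
    have l: "l \<ge> 2" and s: "0 < s" "s \<le> R0" "s < 1" and m0: "moment 0 (Wf l) s = real N" and xl: "x * l ^ d \<le> real N"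
      using elim R0 by (auto simp: l_def s_def)
    define a where "a = moment 1 (Wf l) s"
    have aN: "a \<ge> real N" unfolding a_def m0[symmetric]
      by (rule moment_0_le_moment_1[where B = "C' * l ^ d"]) (use W_crude[OF l] s in \<open>auto simp: C'_def\<close>)
    have a0: "a \<ge> 0" using aN by simp
    have "moment 2 (Wf l) s \<le> C' * l ^ d * S 2" by (rule mom[OF l s(1,2)])
    also have "\<dots> = C' * S 2 / x * (x * l ^ d)" using x by simp
    also have "\<dots> \<le> C' * S 2 / x * a"
      using xl aN C' Spos[of 2] x by (intro mult_left_mono) (auto intro: less_imp_le)
    finally have k: "moment 2 (Wf l) s \<le> C' * S 2 / x * a" .
    have k0: "moment 2 (Wf l) s \<ge> 0"
      by (rule moment_nonneg[where B = "C' * l ^ d"]) (use W_crude[OF l] s in \<open>auto simp: C'_def\<close>)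
    have osc: "osc (Wf l) s t \<ge> c * sqrt (sqrt a * \<bar>t\<bar>) - c" if t: "t \<in> {- pi..pi}" for t
    proof -
      have "c * a * t\<^sup>2 \<le> c * (C' * l ^ d * S 1) * t\<^sup>2"
        using mom[OF l s(1,2), of 1] c unfolding a_def by (intro mult_right_mono mult_left_mono) auto
      also have "\<dots> = \<theta> * \<eta> * r0 ^ Suc m / real (Suc m) * l ^ d * (t\<^sup>2 / 10 / 2)"
        using C' Spos[of 1] by (simp add: c_def K_def)
      also have "\<dots> \<le> \<theta> * \<eta> * r0 ^ Suc m / real (Suc m) * l ^ d * ((1 - cos t) / 2)"
        using one_minus_cos_ge_pi[of t] t \<theta> \<eta> r0 l by (intro mult_left_mono divide_right_mono) auto
      also have "\<dots> \<le> osc (Wf l) s t"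
        by (rule osc_two_terms) (use l s r0 r0_le[OF l s(1,2)] xl m0 m \<eta> pm pm' in auto)
      finally have 1: "c * a * t\<^sup>2 \<le> osc (Wf l) s t" .
      have "sqrt (sqrt a * \<bar>t\<bar>) \<le> (sqrt a * \<bar>t\<bar>)\<^sup>2 + 1" using a0 by (intro sqrt_le_square_plus_1) auto
      also have "(sqrt a * \<bar>t\<bar>)\<^sup>2 = a * t\<^sup>2" using a0 by (simp add: power_mult_distrib)
      finally have "c * sqrt (sqrt a * \<bar>t\<bar>) \<le> c * (a * t\<^sup>2 + 1)" using c by (intro mult_left_mono) auto
      thus ?thesis using 1 by (simp add: distrib_left mult.assoc)
    qed
    show ?case using k0 k aN osc unfolding a_def l_def s_def by blast
  qed
  have kl: "(\<lambda>N. moment 2 (Wf (L N)) (r N) / (moment 1 (Wf (L N)) (r N) * sqrt (moment 1 (Wf (L N)) (r N)))) \<longlonglongrightarrow> 0"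
  proof (rule Lim_null_comparison)
    show "\<forall>\<^sub>F N in sequentially. norm (moment 2 (Wf (L N)) (r N) / (moment 1 (Wf (L N)) (r N) * sqrt (moment 1 (Wf (L N)) (r N)))) \<le> C' * S 2 / x * (1 / sqrt (real N))"
      using bounds eventually_gt_at_top[of 0]
    proof eventually_elim
      case (elim N)
      define a where "a = moment 1 (Wf (L N)) (r N)"
      have a: "a \<ge> real N" "a > 0" using elim by (auto simp: a_def)
      have "moment 2 (Wf (L N)) (r N) / (a * sqrt a) \<le> (C' * S 2 / x * a) / (a * sqrt a)"
        using elim a by (intro divide_right_mono) (auto simp: a_def)
      also have "\<dots> = C' * S 2 / x * (1 / sqrt a)" using a by simp
      also have "\<dots> \<le> C' * S 2 / x * (1 / sqrt (real N))"
        using a elim C' Spos[of 2] x by (intro mult_left_mono divide_left_mono) (auto intro: less_imp_le)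
      finally show ?case using elim a by (simp add: a_def)
    qed
    show "(\<lambda>N. C' * S 2 / x * (1 / sqrt (real N))) \<longlonglongrightarrow> 0" by real_asymp
  qed
  show ?thesis
    unfolding good_saddle_def
  proof (intro conjI kl exI[of _ c] exI[of _ c] c)
    show "\<forall>\<^sub>F N in sequentially. 0 < r N \<and> r N < 1 \<and> moment 0 (Wf (L N)) (r N) = real N"
      using ev by eventually_elim (use R0 in auto)
    show "\<forall>\<^sub>F N in sequentially. \<forall>t\<in>{- pi..pi}. c * sqrt (sqrt (moment 1 (Wf (L N)) (r N)) * \<bar>t\<bar>) - c \<le> osc (Wf (L N)) (r N) t"
      using bounds by eventually_elim auto
  qed
qed

section \<open>Block estimates and saddle points tending to 1\<close>

lemma block_lower:
  assumes L: "L \<ge> 2" and r: "1 / 2 \<le> r" "r < 1" and n: "n \<ge> 1" "real n * (1 - r) \<le> 1"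
    and p: "\<And>j. j \<ge> n \<Longrightarrow> p j \<ge> (lam / 2) / sqrt (real j) ^ d" and j: "j \<in> {n..2 * n}"
  shows "Wf L j * r ^ j \<ge> \<theta> * (lam / 2) * exp (- 4) * (L / sqrt (2 * real n)) ^ d"
proof -
  have j1: "j \<ge> 1" "real j \<le> 2 * real n" using j n by auto
  define x where "x = 1 - r"
  have x: "0 \<le> x" "x \<le> 1 / 2" using r by (auto simp: x_def)
  \<comment> \<open>For r \<ge> 1/2 the logarithm satisfies ln r \<ge> -2 (1 - r), and j (1 - r)
    \<le> 2 throughout the block: up to length of order 1/(1 - r) the weights are essentially
    undamped.\<close>
  have "exp (- 4) \<le> r ^ j"
  proof -
    have "- x - 2 * x\<^sup>2 \<le> ln (1 - x)" by (rule ln_one_minus_pos_lower_bound[OF x])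
    moreover have "2 * x\<^sup>2 \<le> x" using mult_left_mono[of "2 * x" 1 x] x by (simp add: power2_eq_square)
    ultimately have "- 2 * x \<le> ln r" by (simp add: x_def)
    hence "real j * (- 2 * x) \<le> real j * ln r" by (intro mult_left_mono) auto
    moreover have "real j * x \<le> 2 * real n * x" using j1 x by (intro mult_right_mono) auto
    moreover have "real n * x \<le> 1" using n by (simp add: x_def)
    ultimately have "- 4 \<le> real j * ln r" by (simp add: mult_ac)
    hence "exp (- 4) \<le> exp (real j * ln r)" by simp
    also have "\<dots> = r ^ j" using r by (simp add: exp_of_nat_mult)
    finally show ?thesis .
  qed
  moreover have "\<theta> * (lam / 2) * (L / sqrt (2 * real n)) ^ d \<le> Wf L j"
  proof -
    have "(lam / 2) / sqrt (2 * real n) ^ d \<le> (lam / 2) / sqrt (real j) ^ d"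
      using j1 lam n by (intro divide_left_mono power_mono mult_pos_pos zero_less_power) auto
    also have "\<dots> \<le> p j" using j by (intro p) auto
    finally have "\<theta> * L ^ d * ((lam / 2) / sqrt (2 * real n) ^ d) \<le> \<theta> * L ^ d * p j"
      using \<theta> L by (intro mult_left_mono) auto
    also have "\<dots> \<le> Wf L j" by (rule W_lower[OF L j1(1)])
    finally show ?thesis by (simp add: power_divide mult_ac)
  qed
  moreover have "0 \<le> \<theta> * (lam / 2) * (L / sqrt (2 * real n)) ^ d" using \<theta> lam L by simp
  ultimately have "(\<theta> * (lam / 2) * (L / sqrt (2 * real n)) ^ d) * exp (- 4) \<le> Wf L j * r ^ j"
    using W_nonneg[OF L j1(1)] by (intro mult_mono) auto
  thus ?thesis by (simp add: mult_ac)
qed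

lemma block_square_lower:
  assumes L: "L \<ge> 2" and r: "1 / 2 \<le> r" "r < 1" and n: "n \<ge> 1" "real n * (1 - r) \<le> 1"
    and p: "\<And>j. j \<ge> n \<Longrightarrow> p j \<ge> (lam / 2) / sqrt (real j) ^ d"
  shows "(\<Sum>j\<in>{n..2 * n}. real j * (Wf L j * r ^ j))
           \<ge> (real n)\<^sup>2 * (\<theta> * (lam / 2) * exp (- 4) * (L / sqrt (2 * real n)) ^ d)" (is "_ \<ge> _ * ?E")
proof -
  have E: "?E \<ge> 0" using \<theta> lam L by simp
  have "(real n)\<^sup>2 * ?E \<le> real (card {n..2 * n}) * (real n * ?E)"
  proof -
    have "real n * (real n * ?E) \<le> real (card {n..2 * n}) * (real n * ?E)"
      using E by (intro mult_right_mono) auto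
    thus ?thesis by (simp add: power2_eq_square mult.assoc)
  qed
  also have "\<dots> = (\<Sum>j\<in>{n..2 * n}. real n * ?E)" by simp
  also have "\<dots> \<le> (\<Sum>j\<in>{n..2 * n}. real j * (Wf L j * r ^ j))"
  proof (rule sum_mono)
    fix j assume j: "j \<in> {n..2 * n}"
    show "real n * ?E \<le> real j * (Wf L j * r ^ j)"
      by (rule mult_mono[OF _ block_lower[OF L r n p j] _ E]) (use j in auto)
  qed
  finally show ?thesis .
qed

text \<open>In the block j |t| \<le> 2, so 1 - cos (j t) is at least a third of (j t)^2 and every
  term is quadratic in t.\<close>

lemma osc_block_lower:
  assumes L: "L \<ge> 2" and r: "1 / 2 \<le> r" "r < 1" and n: "n \<ge> 1" "real n * (1 - r) \<le> 1"
    and t: "real n * \<bar>t\<bar> \<le> 1"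
  shows "osc (Wf L) r t \<ge> t\<^sup>2 / 3 * (\<Sum>j\<in>{n..2 * n}. real j * (Wf L j * r ^ j))"
proof -
  have "t\<^sup>2 / 3 * (\<Sum>j\<in>{n..2 * n}. real j * (Wf L j * r ^ j)) = (\<Sum>j\<in>{n..2 * n}. t\<^sup>2 / 3 * (real j * (Wf L j * r ^ j)))"
    by (rule sum_distrib_left)
  also have "\<dots> \<le> (\<Sum>j\<in>{n..2 * n}. Wf L j * r ^ j / real j * (1 - cos (real j * t)))"
  proof (rule sum_mono)
    fix j assume j: "j \<in> {n..2 * n}"
    have j1: "j \<ge> 1" using j n by auto
    have "\<bar>real j * t\<bar> = real j * \<bar>t\<bar>" by (simp add: abs_mult)
    also have "\<dots> \<le> 2 * real n * \<bar>t\<bar>" using j by (intro mult_right_mono) auto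
    finally have "(real j * t)\<^sup>2 / 3 \<le> 1 - cos (real j * t)" using t by (intro one_minus_cos_ge) auto
    hence le: "Wf L j * r ^ j / real j * ((real j * t)\<^sup>2 / 3) \<le> Wf L j * r ^ j / real j * (1 - cos (real j * t))"
      using W_nonneg[OF L j1] r by (intro mult_left_mono) auto
    have eq: "Wf L j * r ^ j / real j * ((real j * t)\<^sup>2 / 3) = t\<^sup>2 / 3 * (real j * (Wf L j * r ^ j))"
      using j1 by (simp add: power2_eq_square)
    show "t\<^sup>2 / 3 * (real j * (Wf L j * r ^ j)) \<le> Wf L j * r ^ j / real j * (1 - cos (real j * t))"
      using le unfolding eq .
  qed
  also have "\<dots> \<le> osc (Wf L) r t"
    by (rule partial_sum_le_moment_osc(2)[where B = "C * 2 ^ d * L ^ d"]) (use W_crude[OF L] r n in auto)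
  finally show ?thesis .
qed

text \<open>Because L \<ge> sqrt M, the factor 1 + L / sqrt j is at most (L / sqrt M) (1 + y) with y
  = sqrt (M/j). For d \<le> 2, (1 + y)^d \<le> 2 (1 + y^2), so W_j \<le> 2 C V (1 + M/j) and each
  moment reduces to two geometric moments of adjacent order.\<close>

lemma critical_upper:
  assumes d2: "d \<le> 2" and L: "L \<ge> 2" and r: "0 < r" "r < 1"
  defines "M \<equiv> 1 / (1 - r)"
  assumes LM: "M \<le> L\<^sup>2"
  shows "moment 1 (Wf L) r \<le> 4 * C * (L / sqrt M) ^ d * M\<^sup>2"
    and "moment 2 (Wf L) r \<le> 6 * C * (L / sqrt M) ^ d * M ^ 3"
proof -
  define V where "V = (L / sqrt M) ^ d"
  have M: "M > 0" using r by (simp add: M_def)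
  have x1: "L / sqrt M \<ge> 1"
  proof -
    have "sqrt M \<le> L" using LM L by (intro real_le_lsqrt) auto
    thus ?thesis using M by simp
  qed
  have V: "V \<ge> 0" using x1 by (simp add: V_def)
  have up: "Wf L j \<le> 2 * C * V * (1 + M / real j)" if j: "j \<ge> 1" for j
  proof -
    define y where "y = sqrt (M / real j)"
    have y: "y \<ge> 0" "y\<^sup>2 = M / real j" using M by (auto simp: y_def)
    have "1 + L / sqrt (real j) = 1 + (L / sqrt M) * y"
      using M j by (simp add: y_def real_sqrt_divide)
    also have "\<dots> \<le> (L / sqrt M) * (1 + y)" using x1 by (simp add: distrib_left)
    finally have "(1 + L / sqrt (real j)) ^ d \<le> ((L / sqrt M) * (1 + y)) ^ d"
      using L by (intro power_mono) auto
    also have "\<dots> = V * (1 + y) ^ d" by (simp only: V_def power_mult_distrib)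
    also have "\<dots> \<le> V * (1 + y) ^ 2" using d2 y V by (intro mult_left_mono power_increasing) auto
    also have "\<dots> \<le> V * (2 * (1 + y\<^sup>2))"
    proof (intro mult_left_mono V)
      show "(1 + y)\<^sup>2 \<le> 2 * (1 + y\<^sup>2)"
        using zero_le_power2[of "1 - y"] by (simp add: power2_eq_square algebra_simps)
    qed
    finally have "C * (1 + L / sqrt (real j)) ^ d \<le> C * (V * (2 * (1 + M / real j)))"
      using C by (intro mult_left_mono) (auto simp: y)
    with W_upper[OF L j] show ?thesis by (simp add: mult_ac)
  qed
  have sm: "summable (\<lambda>j. real (Suc j) ^ k * r ^ Suc j)" for k by (rule summable_poly_geometric[OF r])
  have mom: "moment (Suc k) (Wf L) r \<le> 2 * C * V * ((\<Sum>j. real (Suc j) ^ Suc k * r ^ Suc j) + M * (\<Sum>j. real (Suc j) ^ k * r ^ Suc j))" for k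
  proof -
    have "moment (Suc k) (Wf L) r \<le> (\<Sum>j. 2 * C * V * (real (Suc j) ^ Suc k * r ^ Suc j + M * (real (Suc j) ^ k * r ^ Suc j)))"
    proof (rule moment_le[where B = "C * 2 ^ d * L ^ d"])
      fix j
      have "real (Suc j) ^ Suc k * (Wf L (Suc j) * r ^ Suc j) = Wf L (Suc j) * (real (Suc j) ^ Suc k * r ^ Suc j)" by simp
      also have "\<dots> \<le> 2 * C * V * (1 + M / real (Suc j)) * (real (Suc j) ^ Suc k * r ^ Suc j)"
        using up[of "Suc j"] r by (intro mult_right_mono) auto
      also have "\<dots> = 2 * C * V * (real (Suc j) ^ Suc k * r ^ Suc j + M * (real (Suc j) ^ k * r ^ Suc j))"
      proof -
        define J where "J = real (Suc j)"
        have J: "J \<noteq> 0" by (simp add: J_def)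
        have "(1 + M / J) * (J ^ Suc k * r ^ Suc j) = J ^ Suc k * r ^ Suc j + M * (J ^ k * r ^ Suc j)"
          using J by (simp add: field_simps)
        thus ?thesis by (simp only: J_def mult.assoc)
      qed
      finally show "real (Suc j) ^ Suc k * (Wf L (Suc j) * r ^ Suc j) \<le> 2 * C * V * (real (Suc j) ^ Suc k * r ^ Suc j + M * (real (Suc j) ^ k * r ^ Suc j))" .
    qed (use W_crude[OF L] r in \<open>auto intro!: summable_mult summable_add sm simp del: power_Suc of_nat_Suc\<close>)
    also have "\<dots> = 2 * C * V * (\<Sum>j. real (Suc j) ^ Suc k * r ^ Suc j + M * (real (Suc j) ^ k * r ^ Suc j))"
      by (rule suminf_mult) (intro summable_add summable_mult sm)
    also have "(\<Sum>j. real (Suc j) ^ Suc k * r ^ Suc j + M * (real (Suc j) ^ k * r ^ Suc j))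
        = (\<Sum>j. real (Suc j) ^ Suc k * r ^ Suc j) + (\<Sum>j. M * (real (Suc j) ^ k * r ^ Suc j))"
      by (rule suminf_add[symmetric]) (intro summable_mult sm)+
    also have "(\<Sum>j. M * (real (Suc j) ^ k * r ^ Suc j)) = M * (\<Sum>j. real (Suc j) ^ k * r ^ Suc j)"
      by (rule suminf_mult[OF sm])
    finally show ?thesis .
  qed
  note gm = geometric_moments[OF r, folded M_def]
  have "moment 1 (Wf L) r \<le> 2 * C * V * ((\<Sum>j. real (Suc j) ^ 1 * r ^ Suc j) + M * (\<Sum>j. real (Suc j) ^ 0 * r ^ Suc j))"
    using mom[of 0] by simp
  also have "\<dots> \<le> 2 * C * V * (M\<^sup>2 + M * M)"
    using C V M gm by (intro mult_left_mono add_mono) auto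
  finally show "moment 1 (Wf L) r \<le> 4 * C * (L / sqrt M) ^ d * M\<^sup>2"
    by (simp add: V_def power2_eq_square algebra_simps)
  have "moment 2 (Wf L) r \<le> 2 * C * V * ((\<Sum>j. real (Suc j) ^ 2 * r ^ Suc j) + M * (\<Sum>j. real (Suc j) ^ 1 * r ^ Suc j))"
    using mom[of 1] by (simp add: numeral_2_eq_2 del: power_Suc of_nat_Suc)
  also have "\<dots> \<le> 2 * C * V * (2 * M ^ 3 + M * M\<^sup>2)"
    using C V M gm by (intro mult_left_mono add_mono) auto
  finally show "moment 2 (Wf L) r \<le> 6 * C * (L / sqrt M) ^ d * M ^ 3"
    by (simp add: V_def power2_eq_square power3_eq_cube algebra_simps)
qed

lemma floor_half_bounds:
  fixes y :: real
  assumes "y \<ge> 1"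
  shows "y / 2 \<le> real (nat \<lfloor>y\<rfloor>)" and "real (nat \<lfloor>y\<rfloor>) \<le> y"
proof -
  have eq: "real (nat \<lfloor>y\<rfloor>) = of_int \<lfloor>y\<rfloor>" and 1: "1 \<le> real_of_int \<lfloor>y\<rfloor>" using assms by auto
  show "y / 2 \<le> real (nat \<lfloor>y\<rfloor>)" using 1 floor_correct[of y] unfolding eq by linarith
  show "real (nat \<lfloor>y\<rfloor>) \<le> y" unfolding eq by simp
qed

lemma sqrt_scale_power_ge:
  fixes y :: real
  assumes "0 \<le> y" and "d \<le> 2"
  shows "(y / sqrt 2) ^ d \<ge> y ^ d / 2"
proof -
  have "sqrt 2 ^ d \<le> (sqrt 2 :: real) ^ 2" using assms by (intro power_increasing) auto
  hence "sqrt 2 ^ d \<le> (2 :: real)" by simp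
  hence "y ^ d / 2 \<le> y ^ d / sqrt 2 ^ d" using assms by (intro divide_left_mono) auto
  thus ?thesis by (simp add: power_divide)
qed

text \<open>Three ranges of t. For |t| \<le> 1/M the block starting near M carries a fixed share of
  a and gives a quadratic bound. For 1/M < |t| \<le> 1/j0 the block starting near 1/|t| gives at
  least a multiple of (L sqrt |t|)^d = V (M |t|)^(d/2). For larger |t| the two terms j0 and j0 + 1
  give a multiple of L^d = V M^(d/2). In the last two ranges the target is at most a multiple of V
  sqrt (M |t|), because a \<le> 4 C V M^2 and V \<ge> 1.\<close>

lemma critical_lower:
  assumes d2: "d \<le> 2"
  obtains c1 c2 c3 M0 where "c1 > 0" "c2 > 0" "M0 \<ge> 2"
    and "\<And>L r. L \<ge> 2 \<Longrightarrow> 0 < r \<Longrightarrow> r < 1 \<Longrightarrow> 1 / (1 - r) \<ge> M0 \<Longrightarrow> 1 / (1 - r) \<le> L\<^sup>2 \<Longrightarrow>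
           moment 1 (Wf L) r \<ge> c1 * (L / sqrt (1 / (1 - r))) ^ d * (1 / (1 - r))\<^sup>2"
    and "\<And>L r t. L \<ge> 2 \<Longrightarrow> 0 < r \<Longrightarrow> r < 1 \<Longrightarrow> 1 / (1 - r) \<ge> M0 \<Longrightarrow> 1 / (1 - r) \<le> L\<^sup>2 \<Longrightarrow> \<bar>t\<bar> \<le> pi \<Longrightarrow>
           osc (Wf L) r t \<ge> c2 * sqrt (sqrt (moment 1 (Wf L) r) * \<bar>t\<bar>) - c3"
proof -
  obtain j0 where j0: "j0 \<ge> 1" "\<And>j. j \<ge> j0 \<Longrightarrow> p j \<ge> (lam / 2) / sqrt (real j) ^ d" using p_lower by blast
  define E0 where "E0 = \<theta> * (lam / 2) * exp (- 4)"
  have E0: "E0 > 0" using \<theta> lam by (simp add: E0_def)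
  \<comment> \<open>1/8 is (1/2)^2 from n \<ge> M/2, times 1/2 from
    \<open>sqrt_scale_power_ge\<close>.\<close>
  define c1 where "c1 = E0 / 8"
  have c1: "c1 > 0" using E0 by (simp add: c1_def)
  define \<eta> where "\<eta> = (lam / 2) / sqrt (real (Suc j0)) ^ d"
  have \<eta>: "\<eta> > 0" using lam by (simp add: \<eta>_def)
  have pj: "p j0 \<ge> \<eta>" "p (Suc j0) \<ge> \<eta>"
  proof -
    have "\<eta> \<le> (lam / 2) / sqrt (real j0) ^ d"
      unfolding \<eta>_def using lam j0(1) by (intro divide_left_mono power_mono) auto
    thus "p j0 \<ge> \<eta>" using j0(2)[of j0] by simp
    show "p (Suc j0) \<ge> \<eta>" using j0(2)[of "Suc j0"] by (simp add: \<eta>_def)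
  qed
  \<comment> \<open>The constant of \<open>osc_two_terms\<close> at m = j0 with r \<ge> 1/2, where
    |t| > 1/j0 gives (1 - cos t)/2 \<ge> 1/(20 j0^2).\<close>
  define K3 where "K3 = \<theta> * \<eta> * (1 / 2) ^ Suc j0 / real (Suc j0) * (1 / (20 * (real j0)\<^sup>2))"
  have K3: "K3 > 0" using \<theta> \<eta> j0(1) by (simp add: K3_def)
  \<comment> \<open>24 = 3 * 4 * 2: the third from \<open>osc_block_lower\<close>, (k t)^2 \<ge>
    1/4, and the half from \<open>sqrt_scale_power_ge\<close>. The half of \<open>K3\<close> pays
    for sqrt |t| \<le> 2.\<close>
  define K where "K = min (E0 / 24) (K3 / 2)"
  have K: "K > 0" using E0 K3 by (simp add: K_def)
  \<comment> \<open>The first entry serves |t| \<le> 1/M, where 12 = 3 * 4 comes from t^2/3 and a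
    \<le> 4 C V M^2. The second serves larger |t|, where sqrt a \<le> 2 sqrt C V^2 M.\<close>
  define c2 where "c2 = min (c1 / (12 * C)) (K / sqrt (2 * sqrt C))"
  have c2: "c2 > 0" using c1 C K by (simp add: c2_def)
  \<comment> \<open>M \<ge> 2 gives r \<ge> 1/2, and M \<ge> 2 j0 + 2 puts n \<ge> M/2 above j0,
    where the lower bound on \<open>p\<close> holds.\<close>
  define M0 where "M0 = max 2 (2 * real j0 + 2)"
  have blk: "moment 1 (Wf L) r \<ge> S \<and> S \<ge> c1 * (L / sqrt M) ^ d * M\<^sup>2 \<and> n \<ge> j0 \<and> n \<ge> 1 \<and> real n * (1 - r) \<le> 1 \<and> 1 / 2 \<le> r"
    if L: "L \<ge> 2" and r: "0 < r" "r < 1" and M: "M = 1 / (1 - r)" "M \<ge> M0"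
      and n: "n = nat \<lfloor>M\<rfloor>" and S: "S = (\<Sum>j\<in>{n..2 * n}. real j * (Wf L j * r ^ j))" for L r M n S
  proof -
    have M2: "M \<ge> 2" "M \<ge> 2 * real j0 + 2" using M(2) by (auto simp: M0_def)
    have nb: "M / 2 \<le> real n" "real n \<le> M" unfolding n by (rule floor_half_bounds, use M2 in simp)+
    have nj: "n \<ge> j0" "n \<ge> 1" using nb M2 by linarith+
    have Mr: "M * (1 - r) = 1" using r M(1) by simp
    have "real n * (1 - r) \<le> M * (1 - r)" using nb r by (intro mult_right_mono) auto
    hence nr: "real n * (1 - r) \<le> 1" using Mr by simp
    have "2 * (1 - r) \<le> M * (1 - r)" using M2 r by (intro mult_right_mono) auto
    hence r2: "1 / 2 \<le> r" using Mr by simp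
    have s1: "S \<ge> (real n)\<^sup>2 * (E0 * (L / sqrt (2 * real n)) ^ d)"
      unfolding S E0_def by (rule block_square_lower[OF L r2 r(2) nj(2) nr]) (use j0(2) nj in auto)
    have s2: "(real n)\<^sup>2 * (E0 * (L / sqrt (2 * real n)) ^ d) \<ge> (M / 2)\<^sup>2 * (E0 * ((L / sqrt M) ^ d / 2))"
    proof (intro mult_mono power_mono)
      have "(L / sqrt M) ^ d / 2 \<le> (L / sqrt M / sqrt 2) ^ d" using L M2 d2 by (intro sqrt_scale_power_ge) auto
      also have "L / sqrt M / sqrt 2 = L / sqrt (2 * M)" by (simp add: real_sqrt_mult)
      also have "(L / sqrt (2 * M)) ^ d \<le> (L / sqrt (2 * real n)) ^ d"
        using L nb nj M2 by (intro power_mono divide_left_mono) auto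
      finally show "(L / sqrt M) ^ d / 2 \<le> (L / sqrt (2 * real n)) ^ d" .
    qed (use nb M2 E0 L in auto)
    have s3: "(M / 2)\<^sup>2 * (E0 * ((L / sqrt M) ^ d / 2)) = c1 * (L / sqrt M) ^ d * M\<^sup>2"
      by (simp add: c1_def power2_eq_square)
    have s4: "moment 1 (Wf L) r \<ge> S"
    proof -
      have "(\<Sum>j\<in>{n..2 * n}. real j ^ 1 * (Wf L j * r ^ j)) \<le> moment 1 (Wf L) r"
        by (rule partial_sum_le_moment_osc(1)[where B = "C * 2 ^ d * L ^ d"]) (use W_crude[OF L] r nj in auto)
      thus ?thesis by (simp add: S)
    qed
    have "S \<ge> c1 * (L / sqrt M) ^ d * M\<^sup>2" using s1 s2 unfolding s3 by linarith
    with s4 nj nr r2 show ?thesis by blast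
  qed
  show ?thesis
  proof (rule that[of c1 c2 M0 "c1 / (12 * C)"])
    fix L r :: real assume L: "L \<ge> 2" and r: "0 < r" "r < 1" and M0: "1 / (1 - r) \<ge> M0" and LM: "1 / (1 - r) \<le> L\<^sup>2"
    define M where "M = 1 / (1 - r)"
    define n where "n = nat \<lfloor>M\<rfloor>"
    define S where "S = (\<Sum>j\<in>{n..2 * n}. real j * (Wf L j * r ^ j))"
    define V where "V = (L / sqrt M) ^ d"
    define a where "a = moment 1 (Wf L) r"
    have M2: "M \<ge> 2" "M \<ge> 2 * real j0 + 2" "M > 0" using M0 r by (auto simp: M0_def M_def)
    have b: "a \<ge> S" "S \<ge> c1 * V * M\<^sup>2" "n \<ge> j0" "n \<ge> 1" "real n * (1 - r) \<le> 1" "1 / 2 \<le> r"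
      using blk[OF L r M_def _ n_def S_def] M0 by (auto simp: M_def V_def a_def)
    show "moment 1 (Wf L) r \<ge> c1 * (L / sqrt (1 / (1 - r))) ^ d * (1 / (1 - r))\<^sup>2"
      using b(1,2) by (simp add: a_def V_def M_def)
    have x1: "L / sqrt M \<ge> 1"
    proof -
      have "sqrt M \<le> L" using LM L by (intro real_le_lsqrt) (auto simp: M_def)
      thus ?thesis using M2 by simp
    qed
    have V1: "V \<ge> 1" unfolding V_def using x1 by (rule one_le_power)
    have aup: "a \<le> 4 * C * V * M\<^sup>2"
      using critical_upper(1)[OF d2 L r LM] by (simp add: a_def V_def M_def)
    have apos: "a \<ge> 0" using b(1,2) c1 V1 M2 by (smt (verit) mult_nonneg_nonneg zero_le_power2)
    fix t :: real assume t: "\<bar>t\<bar> \<le> pi"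
    have "osc (Wf L) r t \<ge> c2 * sqrt (sqrt a * \<bar>t\<bar>) - c1 / (12 * C)"
    proof (cases "M * \<bar>t\<bar> \<le> 1")
      case True
      have nt: "real n * \<bar>t\<bar> \<le> 1"
      proof -
        have "real n \<le> M" unfolding n_def by (rule floor_half_bounds) (use M2 in simp)
        hence "real n * \<bar>t\<bar> \<le> M * \<bar>t\<bar>" by (intro mult_right_mono) auto
        thus ?thesis using True by simp
      qed
      have "c1 / (12 * C) * (a * t\<^sup>2) \<le> c1 / (12 * C) * ((4 * C * V * M\<^sup>2) * t\<^sup>2)"
        using aup c1 C by (intro mult_left_mono mult_right_mono) auto
      also have "\<dots> = t\<^sup>2 / 3 * (c1 * V * M\<^sup>2)" using C by simp
      also have "\<dots> \<le> t\<^sup>2 / 3 * S" using b(2) by (intro mult_left_mono) auto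
      also have "\<dots> \<le> osc (Wf L) r t"
        unfolding S_def by (rule osc_block_lower[OF L b(6) r(2) b(4,5) nt])
      finally have 1: "c1 / (12 * C) * (a * t\<^sup>2) \<le> osc (Wf L) r t" .
      have "sqrt (sqrt a * \<bar>t\<bar>) \<le> (sqrt a * \<bar>t\<bar>)\<^sup>2 + 1" using apos by (intro sqrt_le_square_plus_1) auto
      also have "(sqrt a * \<bar>t\<bar>)\<^sup>2 = a * t\<^sup>2" using apos by (simp add: power_mult_distrib)
      finally have "c1 / (12 * C) * sqrt (sqrt a * \<bar>t\<bar>) \<le> c1 / (12 * C) * (a * t\<^sup>2 + 1)"
        using c1 C by (intro mult_left_mono) auto
      moreover have "c2 * sqrt (sqrt a * \<bar>t\<bar>) \<le> c1 / (12 * C) * sqrt (sqrt a * \<bar>t\<bar>)"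
        using apos by (intro mult_right_mono) (auto simp: c2_def)
      ultimately show ?thesis using 1 unfolding distrib_left by linarith
    next
      case False
      hence Mt: "M * \<bar>t\<bar> > 1" by simp
      have t0: "\<bar>t\<bar> > 0" using Mt by (cases "t = 0") auto
      have Ld: "L ^ d = V * sqrt M ^ d" using M2 by (simp add: V_def power_divide)
      have main: "osc (Wf L) r t \<ge> K * (V * sqrt (M * \<bar>t\<bar>))"
      proof (cases "real j0 * \<bar>t\<bar> \<le> 1")
        case True
        \<comment> \<open>The largest k with k |t| \<le> 1. Since 1/|t| < M the block from k to 2k
          is undamped, and since 1/|t| \<ge> j0 the lower bound on \<open>p\<close> applies to
          it.\<close>
        define k where "k = nat \<lfloor>1 / \<bar>t\<bar>\<rfloor>"
        have t1: "1 / \<bar>t\<bar> \<ge> 1" "1 / \<bar>t\<bar> \<ge> real j0"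
        proof -
          show j: "1 / \<bar>t\<bar> \<ge> real j0" using True t0 by (simp add: pos_le_divide_eq)
          show "1 / \<bar>t\<bar> \<ge> 1" using j j0(1) by linarith
        qed
        have kb: "1 / \<bar>t\<bar> / 2 \<le> real k" "real k \<le> 1 / \<bar>t\<bar>"
          unfolding k_def by (rule floor_half_bounds[OF t1(1)])+
        have kj: "k \<ge> j0" unfolding k_def using t1(2) by (simp add: le_nat_floor)
        have k1: "k \<ge> 1" using kj j0(1) by simp
        have kt: "real k * \<bar>t\<bar> \<le> 1" using kb(2) t0 by (simp add: pos_le_divide_eq)
        have "1 / \<bar>t\<bar> \<le> M" using Mt t0 by (simp add: pos_divide_le_eq)
        hence "real k * (1 - r) \<le> M * (1 - r)" using kb r by (intro mult_right_mono) auto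
        hence kr: "real k * (1 - r) \<le> 1" using r by (simp add: M_def)
        have "t\<^sup>2 / 3 * ((real k)\<^sup>2 * (E0 * (L / sqrt (2 * real k)) ^ d)) \<le> t\<^sup>2 / 3 * (\<Sum>j\<in>{k..2 * k}. real j * (Wf L j * r ^ j))"
          unfolding E0_def
          by (intro mult_left_mono block_square_lower[OF L b(6) r(2) k1 kr]) (use j0(2) kj in auto)
        also have "\<dots> \<le> osc (Wf L) r t"
          by (rule osc_block_lower[OF L b(6) r(2) k1 kr kt])
        finally have 1: "t\<^sup>2 / 3 * ((real k)\<^sup>2 * (E0 * (L / sqrt (2 * real k)) ^ d)) \<le> osc (Wf L) r t" .
        have kt2: "1 / 4 \<le> (real k)\<^sup>2 * t\<^sup>2"
        proof -
          have "1 / 2 \<le> real k * \<bar>t\<bar>" using kb(1) t0 by (simp add: field_simps)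
          hence "(1 / 2)\<^sup>2 \<le> (real k * \<bar>t\<bar>)\<^sup>2" by (intro power_mono) auto
          moreover have "(real k * \<bar>t\<bar>)\<^sup>2 = (real k)\<^sup>2 * t\<^sup>2" by (simp add: power_mult_distrib)
          moreover have "(1 / 2 :: real)\<^sup>2 = 1 / 4" by (simp add: power2_eq_square)
          ultimately show ?thesis by simp
        qed
        have p2: "(L * sqrt \<bar>t\<bar>) ^ d / 2 \<le> (L / sqrt (2 * real k)) ^ d"
        proof -
          have "(L * sqrt \<bar>t\<bar>) ^ d / 2 \<le> (L * sqrt \<bar>t\<bar> / sqrt 2) ^ d" using L d2 by (intro sqrt_scale_power_ge) auto
          also have "\<dots> \<le> (L / sqrt (2 * real k)) ^ d"
          proof (intro power_mono)
            have "L * sqrt \<bar>t\<bar> / sqrt 2 = L / sqrt (2 * (1 / \<bar>t\<bar>))" using t0 by (simp add: real_sqrt_mult real_sqrt_divide)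
            also have "\<dots> \<le> L / sqrt (2 * real k)" using L kb k1 t0 by (intro divide_left_mono) auto
            finally show "L * sqrt \<bar>t\<bar> / sqrt 2 \<le> L / sqrt (2 * real k)" .
          qed (use L in auto)
          finally show ?thesis .
        qed
        have "K * (V * sqrt (M * \<bar>t\<bar>)) \<le> E0 / 24 * (V * sqrt (M * \<bar>t\<bar>) ^ d)"
        proof (intro mult_mono mult_left_mono)
          have "1 \<le> sqrt (M * \<bar>t\<bar>)" using Mt by simp
          thus "sqrt (M * \<bar>t\<bar>) \<le> sqrt (M * \<bar>t\<bar>) ^ d" using d power_increasing[of 1 d "sqrt (M * \<bar>t\<bar>)"] by simp
        qed (use V1 E0 M2 in \<open>auto simp: K_def\<close>)
        also have "V * sqrt (M * \<bar>t\<bar>) ^ d = (L * sqrt \<bar>t\<bar>) ^ d"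
          by (simp add: Ld power_mult_distrib real_sqrt_mult)
        also have "E0 / 24 * (L * sqrt \<bar>t\<bar>) ^ d = 1 / 3 * (E0 * (1 / 4 * ((L * sqrt \<bar>t\<bar>) ^ d / 2)))" by simp
        also have "\<dots> \<le> 1 / 3 * (E0 * ((real k)\<^sup>2 * t\<^sup>2 * (L / sqrt (2 * real k)) ^ d))"
          using E0 kt2 p2 L t0 by (intro mult_left_mono mult_mono) auto
        also have "\<dots> = t\<^sup>2 / 3 * ((real k)\<^sup>2 * (E0 * (L / sqrt (2 * real k)) ^ d))" by (simp add: mult_ac)
        finally show ?thesis using 1 by simp
      next
        case False
        have "1 / (real j0)\<^sup>2 \<le> t\<^sup>2"
        proof -
          have "1 / real j0 \<le> \<bar>t\<bar>" using False j0(1) by (simp add: pos_divide_le_eq mult.commute)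
          hence "(1 / real j0)\<^sup>2 \<le> \<bar>t\<bar>\<^sup>2" by (intro power_mono) auto
          thus ?thesis by (simp add: power_divide)
        qed
        hence "1 / (real j0)\<^sup>2 / 10 \<le> t\<^sup>2 / 10" by (rule divide_right_mono) simp
        also have "\<dots> \<le> 1 - cos t" by (rule one_minus_cos_ge_pi[OF t])
        finally have "1 / (real j0)\<^sup>2 / 10 \<le> 1 - cos t" .
        hence "\<theta> * \<eta> * (1 / 2) ^ Suc j0 / real (Suc j0) * L ^ d * (1 / (real j0)\<^sup>2 / 10 / 2) \<le>
               \<theta> * \<eta> * (1 / 2) ^ Suc j0 / real (Suc j0) * L ^ d * ((1 - cos t) / 2)"
          using \<theta> \<eta> L by (intro mult_left_mono divide_right_mono) auto
        also have "\<dots> \<le> osc (Wf L) r t"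
          by (rule osc_two_terms) (use L b(6) r j0(1) \<eta> pj in auto)
        finally have "\<theta> * \<eta> * (1 / 2) ^ Suc j0 / real (Suc j0) * L ^ d * (1 / (real j0)\<^sup>2 / 10 / 2) \<le> osc (Wf L) r t" .
        moreover have "\<theta> * \<eta> * (1 / 2) ^ Suc j0 / real (Suc j0) * L ^ d * (1 / (real j0)\<^sup>2 / 10 / 2) = K3 * L ^ d"
          by (simp add: K3_def)
        ultimately have 1: "K3 * L ^ d \<le> osc (Wf L) r t" by simp
        have "K * (V * sqrt (M * \<bar>t\<bar>)) \<le> K3 / 2 * (V * (2 * sqrt M ^ d))"
        proof (intro mult_mono mult_left_mono)
          have "sqrt (M * \<bar>t\<bar>) = sqrt \<bar>t\<bar> * sqrt M" by (simp add: real_sqrt_mult)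
          also have "\<dots> \<le> 2 * sqrt M ^ d"
          proof (intro mult_mono)
            show "sqrt \<bar>t\<bar> \<le> 2" using t pi_less_4 by (intro real_le_lsqrt) auto
            show "sqrt M \<le> sqrt M ^ d" using d power_increasing[of 1 d "sqrt M"] M2 by simp
          qed (use M2 in auto)
          finally show "sqrt (M * \<bar>t\<bar>) \<le> 2 * sqrt M ^ d" .
        qed (use V1 K3 M2 in \<open>auto simp: K_def\<close>)
        also have "\<dots> = K3 * L ^ d" by (simp add: Ld)
        finally show ?thesis using 1 by simp
      qed
      \<comment> \<open>V \<le> V^4 is a deliberate loss: it makes the second square root produce
        exactly the factor V sqrt (M |t|) available from \<open>main\<close>.\<close>
      have "sqrt a \<le> 2 * sqrt C * (V\<^sup>2 * M)"
      proof (rule real_le_lsqrt)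
        have "V ^ 1 \<le> V ^ 4" using V1 by (intro power_increasing) auto
        hence "4 * C * V * M\<^sup>2 \<le> 4 * C * V ^ 4 * M\<^sup>2" using C by (intro mult_right_mono mult_left_mono) auto
        also have "\<dots> = (2 * sqrt C * (V\<^sup>2 * M))\<^sup>2" using C by (simp add: power_mult_distrib flip: power_mult)
        finally show "a \<le> (2 * sqrt C * (V\<^sup>2 * M))\<^sup>2" using aup by simp
      qed (use C M2 in auto)
      hence "sqrt a * \<bar>t\<bar> \<le> 2 * sqrt C * (V\<^sup>2 * M) * \<bar>t\<bar>" by (intro mult_right_mono) auto
      hence "sqrt (sqrt a * \<bar>t\<bar>) \<le> sqrt (2 * sqrt C * V\<^sup>2 * (M * \<bar>t\<bar>))" by (simp add: mult_ac)
      also have "\<dots> = sqrt (2 * sqrt C) * V * sqrt (M * \<bar>t\<bar>)"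
        using V1 by (simp add: real_sqrt_mult)
      finally have s: "sqrt (sqrt a * \<bar>t\<bar>) \<le> sqrt (2 * sqrt C) * (V * sqrt (M * \<bar>t\<bar>))" by simp
      have "c2 * sqrt (sqrt a * \<bar>t\<bar>) \<le> K / sqrt (2 * sqrt C) * (sqrt (2 * sqrt C) * (V * sqrt (M * \<bar>t\<bar>)))"
        using s K C apos by (intro mult_mono) (auto simp: c2_def)
      also have "\<dots> = K * (V * sqrt (M * \<bar>t\<bar>))" using C by simp
      finally have "c2 * sqrt (sqrt a * \<bar>t\<bar>) \<le> osc (Wf L) r t" using main by simp
      moreover have "c1 / (12 * C) \<ge> 0" using c1 C by simp
      ultimately show ?thesis by linarith
    qed
    thus "osc (Wf L) r t \<ge> c2 * sqrt (sqrt (moment 1 (Wf L) r) * \<bar>t\<bar>) - c1 / (12 * C)" by (simp add: a_def)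
  qed (use c1 c2 in \<open>auto simp: M0_def\<close>)
qed

text \<open>The ratio of \<open>moment 2\<close> to a^(3/2) is at most a constant times V M^3 / (V
  M^2)^(3/2) = 1 / sqrt V. Since L / sqrt M \<ge> 1 and d \<ge> 1, V is at least L / sqrt M, so M =
  o(L^2) sends it to 0.\<close>

lemma good_saddle_critical:
  assumes d2: "d \<le> 2"
    and ev: "\<forall>\<^sub>F N in sequentially. L N \<ge> 2 \<and> 0 < r N \<and> r N < 1 \<and> moment 0 (Wf (L N)) (r N) = real N"
    and M: "filterlim (\<lambda>N. 1 / (1 - r N)) at_top sequentially"
    and Mlim: "(\<lambda>N. 1 / (1 - r N) / (L N)\<^sup>2) \<longlonglongrightarrow> 0"
  shows "good_saddle (\<lambda>N. Wf (L N)) r"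
proof -
  obtain c1 c2 c3 M0 where c: "c1 > 0" "c2 > 0" "M0 \<ge> 2"
    "\<And>L r. L \<ge> 2 \<Longrightarrow> 0 < r \<Longrightarrow> r < 1 \<Longrightarrow> 1 / (1 - r) \<ge> M0 \<Longrightarrow> 1 / (1 - r) \<le> L\<^sup>2 \<Longrightarrow>
           moment 1 (Wf L) r \<ge> c1 * (L / sqrt (1 / (1 - r))) ^ d * (1 / (1 - r))\<^sup>2"
    "\<And>L r t. L \<ge> 2 \<Longrightarrow> 0 < r \<Longrightarrow> r < 1 \<Longrightarrow> 1 / (1 - r) \<ge> M0 \<Longrightarrow> 1 / (1 - r) \<le> L\<^sup>2 \<Longrightarrow> \<bar>t\<bar> \<le> pi \<Longrightarrow>
           osc (Wf L) r t \<ge> c2 * sqrt (sqrt (moment 1 (Wf L) r) * \<bar>t\<bar>) - c3"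
    using critical_lower[OF d2] by metis
  have "\<forall>\<^sub>F N in sequentially. 1 / (1 - r N) \<ge> M0"
    using M by (simp add: filterlim_at_top)
  moreover have "\<forall>\<^sub>F N in sequentially. 1 / (1 - r N) / (L N)\<^sup>2 < 1"
    using Mlim by (rule order_tendstoD) simp
  ultimately have ev2: "\<forall>\<^sub>F N in sequentially. L N \<ge> 2 \<and> 0 < r N \<and> r N < 1 \<and> 1 / (1 - r N) \<ge> M0 \<and> 1 / (1 - r N) \<le> (L N)\<^sup>2"
    using ev
  proof eventually_elim
    case (elim N)
    hence pos: "(L N)\<^sup>2 > 0" by simp
    have "1 / (1 - r N) < 1 * (L N)\<^sup>2" using elim(2) unfolding pos_divide_less_eq[OF pos] .
    hence "1 / (1 - r N) \<le> (L N)\<^sup>2" by linarith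
    with elim show ?case by blast
  qed
  have kl: "(\<lambda>N. moment 2 (Wf (L N)) (r N) / (moment 1 (Wf (L N)) (r N) * sqrt (moment 1 (Wf (L N)) (r N)))) \<longlonglongrightarrow> 0"
  proof (rule Lim_null_comparison)
    show "\<forall>\<^sub>F N in sequentially. norm (moment 2 (Wf (L N)) (r N) / (moment 1 (Wf (L N)) (r N) * sqrt (moment 1 (Wf (L N)) (r N))))
       \<le> 6 * C / (c1 * sqrt c1) * sqrt (sqrt (1 / (1 - r N) / (L N)\<^sup>2))"
      using ev2
    proof eventually_elim
      case (elim N)
      define l s where "l = L N" and "s = r N"
      define m where "m = 1 / (1 - s)"
      have l: "l \<ge> 2" and s: "0 < s" "s < 1" and m0: "m \<ge> M0" and ml: "m \<le> l\<^sup>2"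
        using elim by (auto simp: l_def s_def m_def)
      define V where "V = (l / sqrt m) ^ d"
      have m: "m > 0" using m0 c(3) by linarith
      have x1: "l / sqrt m \<ge> 1"
      proof -
        have "sqrt m \<le> l" using ml l by (intro real_le_lsqrt) auto
        thus ?thesis using m by simp
      qed
      have V: "V \<ge> l / sqrt m" unfolding V_def using power_increasing[OF d x1] by simp
      have V0: "V > 0" using V x1 by linarith
      define a where "a = moment 1 (Wf l) s"
      define \<kappa> where "\<kappa> = moment 2 (Wf l) s"
      have a: "a \<ge> c1 * V * m\<^sup>2" unfolding a_def V_def m_def by (rule c(4)) (use l s m0 ml in \<open>auto simp: m_def\<close>)
      have k_le: "\<kappa> \<le> 6 * C * V * m ^ 3" unfolding \<kappa>_def V_def m_def
        by (rule critical_upper(2)[OF d2 l s]) (use ml in \<open>auto simp: m_def\<close>)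
      have k_nonneg: "\<kappa> \<ge> 0" unfolding \<kappa>_def
        by (rule moment_nonneg[where B = "C * 2 ^ d * l ^ d"]) (use W_crude[OF l] s in auto)
      have pos: "c1 * V * m\<^sup>2 > 0" using c(1) V0 m by simp
      have sq: "sqrt (c1 * V * m\<^sup>2) = sqrt c1 * sqrt V * m" using m by (simp add: real_sqrt_mult)
      have "\<kappa> / (a * sqrt a) \<le> (6 * C * V * m ^ 3) / ((c1 * V * m\<^sup>2) * sqrt (c1 * V * m\<^sup>2))"
      proof -
        have "\<kappa> / (a * sqrt a) \<le> (6 * C * V * m ^ 3) / (P * sqrt P)" if "P > 0" "a \<ge> P" for P
          using k_le k_nonneg that by (intro frac_le mult_mono) auto
        thus ?thesis using pos a by blast
      qed
      also have "\<dots> = 6 * C / (c1 * sqrt c1) * (1 / sqrt V)"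
        unfolding sq using V0 m c(1) by (simp add: power2_eq_square power3_eq_cube field_simps)
      also have "\<dots> \<le> 6 * C / (c1 * sqrt c1) * sqrt (sqrt (m / l\<^sup>2))"
      proof (intro mult_left_mono)
        have "1 / V \<le> 1 / (l / sqrt m)" using V V0 l m by (intro divide_left_mono mult_pos_pos divide_pos_pos) auto
        also have "\<dots> = sqrt (m / l\<^sup>2)" using l by (simp add: real_sqrt_divide)
        finally have "sqrt (1 / V) \<le> sqrt (sqrt (m / l\<^sup>2))" by simp
        thus "1 / sqrt V \<le> sqrt (sqrt (m / l\<^sup>2))" by (simp add: real_sqrt_divide)
      qed (use C c(1) in auto)
      finally show ?case using k_nonneg a pos by (simp add: \<kappa>_def a_def l_def s_def m_def)
    qed
    have "(\<lambda>N. 6 * C / (c1 * sqrt c1) * sqrt (sqrt (1 / (1 - r N) / (L N)\<^sup>2))) \<longlonglongrightarrow> 6 * C / (c1 * sqrt c1) * sqrt (sqrt 0)"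
      by (intro tendsto_intros Mlim)
    thus "(\<lambda>N. 6 * C / (c1 * sqrt c1) * sqrt (sqrt (1 / (1 - r N) / (L N)\<^sup>2))) \<longlonglongrightarrow> 0" by simp
  qed
  show ?thesis
    unfolding good_saddle_def
  proof (intro conjI kl)
    show "\<forall>\<^sub>F N in sequentially. 0 < r N \<and> r N < 1 \<and> moment 0 (Wf (L N)) (r N) = real N"
      using ev by eventually_elim auto
    have "\<forall>\<^sub>F N in sequentially. \<forall>t\<in>{- pi..pi}. c2 * sqrt (sqrt (moment 1 (Wf (L N)) (r N)) * \<bar>t\<bar>) - c3 \<le> osc (Wf (L N)) (r N) t"
      using ev2 by eventually_elim (use c(5) in auto)
    with c(2) show "\<exists>c>0. \<exists>C. \<forall>\<^sub>F N in sequentially. \<forall>t\<in>{- pi..pi}.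
        c * sqrt (sqrt (moment 1 (Wf (L N)) (r N)) * \<bar>t\<bar>) - C \<le> osc (Wf (L N)) (r N) t"
      by blast
  qed
qed

section \<open>The density regimes\<close>

text \<open>The hypothesis \<open>saddle\<close> is conditional: \<open>r N\<close> is known to
  solve the saddle-point equation once some radius R with \<open>moment 0\<close> at least N is
  exhibited, and then \<open>r N\<close> lies below R. The regimes find R from truncated
  series.\<close>

context
  fixes \<rho> L r :: "nat \<Rightarrow> real"
  assumes L_limit: "filterlim L at_top sequentially"
    and L_power: "\<forall>\<^sub>F N in sequentially. L N ^ d * \<rho> N = real N"
    and saddle: "\<And>N R. L N \<ge> 2 \<Longrightarrow> N > 0 \<Longrightarrow> 0 < R \<Longrightarrow> R < 1 \<Longrightarrow> moment 0 (Wf (L N)) R \<ge> real N \<Longrightarrow>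
         0 < r N \<and> r N \<le> R \<and> moment 0 (Wf (L N)) (r N) = real N"
begin

lemma L_ge_2: "\<forall>\<^sub>F N in sequentially. L N \<ge> 2"
  using L_limit by (simp add: filterlim_at_top)

text \<open>A truncated series strictly above the limiting density stays above it at some R < 1, and
  this single R bounds \<open>r N\<close> for all large N.\<close>

lemma good_saddle_const:
  assumes \<rho>: "\<rho> \<longlonglongrightarrow> \<rho>s" "\<rho>s > 0" and J: "\<theta> * (\<Sum>j\<in>{1..J}. p j) > \<rho>s"
  shows "good_saddle (\<lambda>N. Wf (L N)) r"
proof -
  obtain R where R: "0 < R" "R < 1" "\<theta> * (\<Sum>j\<in>{1..J}. p j * R ^ j) > \<rho>s"
    using ex_radius[OF J] by blast
  have "\<forall>\<^sub>F N in sequentially. \<rho> N < \<theta> * (\<Sum>j\<in>{1..J}. p j * R ^ j)"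
    by (rule order_tendstoD(2)[OF \<rho>(1) R(3)])
  moreover have "\<forall>\<^sub>F N in sequentially. \<rho> N > \<rho>s / 2"
    by (rule order_tendstoD(1)[OF \<rho>(1)]) (use \<rho>(2) in simp)
  ultimately have "\<forall>\<^sub>F N in sequentially. L N \<ge> 2 \<and> 0 < r N \<and> r N \<le> R \<and> moment 0 (Wf (L N)) (r N) = real N
               \<and> \<rho>s / 2 * L N ^ d \<le> real N"
    using L_ge_2 L_power eventually_gt_at_top[of 0]
  proof eventually_elim
    case (elim N)
    have "real N = L N ^ d * \<rho> N" using elim by simp
    also have "\<dots> \<le> L N ^ d * (\<theta> * (\<Sum>j\<in>{1..J}. p j * R ^ j))" using elim by (intro mult_left_mono) auto
    also have "\<dots> \<le> moment 0 (Wf (L N)) R" by (rule moment_ge_partial_sum) (use elim R in auto)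
    finally have "0 < r N \<and> r N \<le> R \<and> moment 0 (Wf (L N)) (r N) = real N"
      using elim R by (intro saddle) auto
    moreover have "\<rho>s / 2 * L N ^ d \<le> real N"
    proof -
      have "\<rho>s / 2 * L N ^ d \<le> \<rho> N * L N ^ d" using elim by (intro mult_right_mono) auto
      thus ?thesis using elim by (simp only: mult.commute[of "\<rho> N"])
    qed
    ultimately show ?case using elim by blast
  qed
  thus ?thesis using \<rho>(2) by (intro good_saddle_bounded[OF R(1,2), where x = "\<rho>s / 2"]) auto
qed

text \<open>For d \<le> 2 the terms are eventually at least a multiple of 1/j, and the harmonic
  series diverges. This is the recurrence of the walk: no density is supercritical.\<close>

lemma partial_sums_unbounded:
  assumes "d \<le> 2"
  shows "\<exists>J. \<theta> * (\<Sum>j\<in>{1..J}. p j) > y"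
proof (rule ccontr)
  assume "\<nexists>J. \<theta> * (\<Sum>j\<in>{1..J}. p j) > y"
  hence le: "(\<Sum>j\<in>{1..J}. p j) \<le> y / \<theta>" for J
    using \<theta> by (simp add: pos_le_divide_eq not_less mult.commute)
  have "summable (\<lambda>j. p (Suc j))"
  proof (rule summableI_nonneg_bounded)
    show "0 \<le> p (Suc j)" for j by (rule p_nonneg) simp
    have "(\<Sum>j<n. p (Suc j)) = (\<Sum>j\<in>{1..n}. p j)" for n
      by (rule sum.reindex_bij_witness[of _ "\<lambda>j. j - 1" Suc]) auto
    thus "(\<Sum>j<n. p (Suc j)) \<le> y / \<theta>" for n using le[of n] by simp
  qed
  hence sp: "summable p" by (simp only: summable_Suc_iff)
  obtain j0 where j0: "j0 \<ge> 1" "\<And>j. j \<ge> j0 \<Longrightarrow> p j \<ge> (lam / 2) / sqrt (real j) ^ d" using p_lower by blast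
  have "summable (\<lambda>j. (lam / 2) * inverse (real j))"
  proof (rule summable_comparison_test'[OF sp, of j0])
    fix j assume j: "j \<ge> j0"
    have "sqrt (real j) ^ d \<le> sqrt (real j) ^ 2" using assms j j0(1) by (intro power_increasing) auto
    also have "\<dots> = real j" by simp
    finally have "(lam / 2) / real j \<le> (lam / 2) / sqrt (real j) ^ d"
      using lam j j0(1) by (intro divide_left_mono) auto
    with j0(2)[OF j] have "(lam / 2) / real j \<le> p j" by linarith
    moreover have "lam / 2 / real j \<ge> 0" using lam by simp
    ultimately show "norm ((lam / 2) * inverse (real j)) \<le> p j"
      unfolding divide_inverse[symmetric] real_norm_def by (simp only: abs_of_nonneg)
  qed
  hence "summable (\<lambda>j. inverse (real j))" using lam by (subst (asm) summable_cmult_iff) auto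
  thus False using not_summable_harmonic[where 'a = real] by (simp add: inverse_eq_divide)
qed

section \<open>Diverging densities in dimensions one and two\<close>

lemma saddle_eventually:
  assumes d2: "d \<le> 2"
  shows "\<forall>\<^sub>F N in sequentially. L N \<ge> 2 \<and> 0 < r N \<and> r N < 1 \<and> moment 0 (Wf (L N)) (r N) = real N"
  using L_ge_2 L_power eventually_gt_at_top[of 0]
proof eventually_elim
  case (elim N)
  obtain J where "\<theta> * (\<Sum>j\<in>{1..J}. p j) > \<rho> N" using partial_sums_unbounded[OF d2] by blast
  then obtain R where R: "0 < R" "R < 1" "\<theta> * (\<Sum>j\<in>{1..J}. p j * R ^ j) > \<rho> N"
    using ex_radius by blast
  have "real N = L N ^ d * \<rho> N" using elim by simp
  also have "\<dots> \<le> L N ^ d * (\<theta> * (\<Sum>j\<in>{1..J}. p j * R ^ j))" using elim R by (intro mult_left_mono) auto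
  also have "\<dots> \<le> moment 0 (Wf (L N)) R" by (rule moment_ge_partial_sum) (use elim R in auto)
  finally have "0 < r N \<and> r N \<le> R \<and> moment 0 (Wf (L N)) (r N) = real N"
    using elim R by (intro saddle) auto
  thus ?case using elim R by auto
qed

text \<open>All weights are at most C' L^d, so L^d \<rho> = N \<le> C' L^d / (1 - r), and 1 / (1 -
  r) is at least \<rho> / C'.\<close>

lemma saddle_at_top:
  assumes d2: "d \<le> 2" and \<rho>: "filterlim \<rho> at_top sequentially"
  shows "filterlim (\<lambda>N. 1 / (1 - r N)) at_top sequentially"
proof -
  define C' where "C' = C * 2 ^ d"
  have C': "C' > 0" using C by (simp add: C'_def)
  have lim: "filterlim (\<lambda>N. 1 / C' * \<rho> N) at_top sequentially"
    using C' by (intro filterlim_tendsto_pos_mult_at_top[OF tendsto_const _ \<rho>]) auto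
  show ?thesis
  proof (rule filterlim_at_top_mono[OF lim])
    show "\<forall>\<^sub>F N in sequentially. 1 / C' * \<rho> N \<le> 1 / (1 - r N)"
      using saddle_eventually[OF d2] L_power
    proof eventually_elim
      case (elim N)
      have L: "L N \<ge> 2" and r: "0 < r N" "r N < 1" using elim by auto
      have "L N ^ d * \<rho> N = moment 0 (Wf (L N)) (r N)" using elim by simp
      also have "\<dots> \<le> (\<Sum>j. C' * L N ^ d * (real (Suc j) ^ 0 * r N ^ Suc j))"
      proof (rule moment_le[where B = "C' * L N ^ d"])
        show "summable (\<lambda>j. C' * L N ^ d * (real (Suc j) ^ 0 * r N ^ Suc j))"
          by (intro summable_mult summable_poly_geometric r)
        show "real (Suc j) ^ 0 * (Wf (L N) (Suc j) * r N ^ Suc j) \<le> C' * L N ^ d * (real (Suc j) ^ 0 * r N ^ Suc j)" for j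
          using W_crude[OF L, of j] r by (simp add: C'_def mult_right_mono)
      qed (use W_crude[OF L] r in \<open>auto simp: C'_def\<close>)
      also have "\<dots> = C' * L N ^ d * (\<Sum>j. real (Suc j) ^ 0 * r N ^ Suc j)"
        by (rule suminf_mult) (rule summable_poly_geometric[OF r])
      also have "\<dots> \<le> C' * L N ^ d * (1 / (1 - r N))"
        using C' L by (intro mult_left_mono geometric_moments r) auto
      finally have "L N ^ d * \<rho> N \<le> L N ^ d * (C' * (1 / (1 - r N)))" by (simp add: mult_ac)
      hence "\<rho> N \<le> C' * (1 / (1 - r N))" by (rule mult_left_le_imp_le) (use L in simp)
      hence "1 / C' * \<rho> N \<le> 1 / C' * (C' * (1 / (1 - r N)))" using C' by (intro mult_left_mono) auto
      thus ?case using C' by simp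
    qed
  qed
qed

text \<open>The block starting near M contributes at least a multiple of M L / sqrt M = L sqrt M to
  N = L \<rho>, so sqrt M is at most a multiple of \<rho>. With L = N / \<rho> this makes M / L^2 at
  most a multiple of (\<rho>^2 / N)^2, which is where \<rho> = o(sqrt N) enters.\<close>

lemma good_saddle_dim1:
  assumes d1: "d = 1" and \<rho>: "filterlim \<rho> at_top sequentially" and small: "(\<lambda>N. (\<rho> N)\<^sup>2 / real N) \<longlonglongrightarrow> 0"
  shows "good_saddle (\<lambda>N. Wf (L N)) r"
proof -
  have d2: "d \<le> 2" using d1 by simp
  note M_top = saddle_at_top[OF d2 \<rho>]
  obtain j0 where j0: "j0 \<ge> 1" "\<And>j. j \<ge> j0 \<Longrightarrow> p j \<ge> (lam / 2) / sqrt (real j) ^ d" using p_lower by blast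
  define E0 where "E0 = \<theta> * (lam / 2) * exp (- 4)"
  have E0: "E0 > 0" using \<theta> lam by (simp add: E0_def)
  have "\<forall>\<^sub>F N in sequentially. 1 / (1 - r N) \<ge> 2 * real j0 + 2" using M_top by (simp add: filterlim_at_top)
  moreover have "\<forall>\<^sub>F N in sequentially. \<rho> N > 0"
    using \<rho> by (rule filterlim_at_top_dense[THEN iffD1, rule_format])
  ultimately have bnd: "\<forall>\<^sub>F N in sequentially. norm (1 / (1 - r N) / (L N)\<^sup>2) \<le> (3 / E0)\<^sup>2 * ((\<rho> N)\<^sup>2 / real N)\<^sup>2"
    using saddle_eventually[OF d2] L_power eventually_gt_at_top[of 0]
  proof eventually_elim
    case (elim N)
    define M where "M = 1 / (1 - r N)"
    define n where "n = nat \<lfloor>M\<rfloor>"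
    have L: "L N \<ge> 2" and r: "0 < r N" "r N < 1" using elim by auto
    have M2: "M \<ge> 2" "M \<ge> 2 * real j0 + 2" using elim(1) by (auto simp: M_def)
    have nb: "M / 2 \<le> real n" "real n \<le> M" unfolding n_def by (rule floor_half_bounds, use M2 in simp)+
    have nj: "n \<ge> j0" "n \<ge> 1" using nb M2 by linarith+
    have Mr: "M * (1 - r N) = 1" using r by (simp add: M_def)
    have "real n * (1 - r N) \<le> M * (1 - r N)" using nb r by (intro mult_right_mono) auto
    hence nr: "real n * (1 - r N) \<le> 1" using Mr by simp
    have "2 * (1 - r N) \<le> M * (1 - r N)" using M2 r by (intro mult_right_mono) auto
    hence r2: "1 / 2 \<le> r N" using Mr by simp
    have "M / 2 * (E0 * (L N / sqrt (2 * M))) \<le> real (card {n..2 * n}) * (E0 * (L N / sqrt (2 * real n)))"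
      using nb nj M2 E0 L by (intro mult_mono mult_left_mono divide_left_mono) auto
    also have "\<dots> = (\<Sum>j\<in>{n..2 * n}. E0 * (L N / sqrt (2 * real n)))" by simp
    also have "\<dots> \<le> (\<Sum>j\<in>{n..2 * n}. real j ^ 0 * (Wf (L N) j * r N ^ j))"
    proof (rule sum_mono)
      fix j assume "j \<in> {n..2 * n}"
      from block_lower[OF L r2 r(2) nj(2) nr j0(2) this] nj
      show "E0 * (L N / sqrt (2 * real n)) \<le> real j ^ 0 * (Wf (L N) j * r N ^ j)"
        by (simp add: E0_def d1)
    qed
    also have "\<dots> \<le> moment 0 (Wf (L N)) (r N)"
      by (rule partial_sum_le_moment_osc(1)[where B = "C * 2 ^ d * L N ^ d"]) (use W_crude[OF L] r nj in auto)
    also have "\<dots> = L N * \<rho> N" using elim by (simp add: d1)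
    finally have "M / 2 * (E0 * (L N / sqrt (2 * M))) \<le> L N * \<rho> N" .
    moreover have "M / 2 * (E0 * (L N / sqrt (2 * M))) = L N * (E0 * sqrt M / (2 * sqrt 2))"
    proof -
      have "M / 2 * (E0 * (L N / sqrt (2 * M))) = L N * (E0 * (M / sqrt M) / (2 * sqrt 2))"
        by (simp add: real_sqrt_mult mult_ac)
      also have "M / sqrt M = sqrt M" using M2 by (intro real_div_sqrt) simp
      finally show ?thesis .
    qed
    ultimately have "L N * (E0 * sqrt M / (2 * sqrt 2)) \<le> L N * \<rho> N" by simp
    hence "E0 * sqrt M / (2 * sqrt 2) \<le> \<rho> N" by (rule mult_left_le_imp_le) (use L in simp)
    moreover have "E0 * sqrt M / 3 \<le> E0 * sqrt M / (2 * sqrt 2)"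
    proof (rule divide_left_mono)
      have "sqrt 2 \<le> 3 / 2" by (rule real_le_lsqrt) (auto simp: power2_eq_square)
      thus "2 * sqrt 2 \<le> (3 :: real)" by simp
    qed (use E0 M2 in auto)
    ultimately have "E0 * sqrt M / 3 \<le> \<rho> N" by linarith
    hence "sqrt M \<le> 3 / E0 * \<rho> N" using E0 by (simp add: field_simps)
    hence "(sqrt M)\<^sup>2 \<le> (3 / E0 * \<rho> N)\<^sup>2" using M2 by (intro power_mono) auto
    hence Mle: "M \<le> (3 / E0)\<^sup>2 * (\<rho> N)\<^sup>2" unfolding power_mult_distrib using M2 by simp
    have LN: "L N = real N / \<rho> N" using elim by (simp add: d1 field_simps)
    have "M / (L N)\<^sup>2 \<le> (3 / E0)\<^sup>2 * (\<rho> N)\<^sup>2 / (L N)\<^sup>2" using Mle by (rule divide_right_mono) simp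
    also have "\<dots> = (3 / E0)\<^sup>2 * ((\<rho> N)\<^sup>2 / real N)\<^sup>2"
      unfolding LN using elim by (simp add: power_divide power2_eq_square)
    finally have "M / (L N)\<^sup>2 \<le> (3 / E0)\<^sup>2 * ((\<rho> N)\<^sup>2 / real N)\<^sup>2" .
    moreover have "M / (L N)\<^sup>2 \<ge> 0" using M2 by simp
    ultimately show ?case unfolding M_def[symmetric] real_norm_def by (simp only: abs_of_nonneg)
  qed
  have "(\<lambda>N. (3 / E0)\<^sup>2 * ((\<rho> N)\<^sup>2 / real N)\<^sup>2) \<longlonglongrightarrow> (3 / E0)\<^sup>2 * 0\<^sup>2"
    by (intro tendsto_intros small)
  hence "(\<lambda>N. 1 / (1 - r N) / (L N)\<^sup>2) \<longlonglongrightarrow> 0"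
    by (intro Lim_null_comparison[OF bnd]) simp
  thus ?thesis by (rule good_saddle_critical[OF d2 saddle_eventually[OF d2] M_top])
qed

text \<open>For q < \<theta> \<open>lam\<close> the terms satisfy \<theta> p_j \<ge> q/j from some
  index on. Comparison with the series of -ln (1 - r) gives N \<ge> q L^2 (ln M - H), hence ln M
  \<le> \<rho>/q + H, while L^2 = N / \<rho>.\<close>

lemma good_saddle_dim2:
  assumes dd: "d = 2" and \<rho>: "filterlim \<rho> at_top sequentially"
    and \<alpha>: "0 \<le> \<alpha>" "\<alpha> < \<theta> * lam" "(\<lambda>N. \<rho> N / ln (real N)) \<longlonglongrightarrow> \<alpha>"
  shows "good_saddle (\<lambda>N. Wf (L N)) r"
proof -
  have d2: "d \<le> 2" using dd by simp
  note M_top = saddle_at_top[OF d2 \<rho>]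
  (* alpha < alpha' < q < theta lam, so that M <= e^H N^(alpha' / q) with exponent below 1 *)
  define q where "q = (\<alpha> + \<theta> * lam) / 2"
  define \<alpha>' where "\<alpha>' = (\<alpha> + q) / 2"
  have "(\<alpha> + (\<alpha> + T) / 2) / 2 < (\<alpha> + T) / 2 \<and> (\<alpha> + T) / 2 < T \<and> 0 < (\<alpha> + T) / 2
      \<and> \<alpha> < (\<alpha> + (\<alpha> + T) / 2) / 2 \<and> 0 < (\<alpha> + (\<alpha> + T) / 2) / 2" if "\<alpha> < T" for T
    using that \<alpha>(1) by (auto simp: field_simps)
  from this[OF \<alpha>(2)] have q: "\<alpha>' < q" "q < \<theta> * lam" "q > 0" "\<alpha> < \<alpha>'" "\<alpha>' > 0"
    unfolding q_def \<alpha>'_def by blast+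
  define \<delta> where "\<delta> = 1 - \<alpha>' / q"
  have \<delta>: "\<delta> > 0" using q by (simp add: \<delta>_def)
  have "(\<lambda>j. \<theta> * (sqrt (real j) ^ d * p j)) \<longlonglongrightarrow> \<theta> * lam" by (intro tendsto_intros p_limit)
  hence "\<forall>\<^sub>F j in sequentially. \<theta> * (sqrt (real j) ^ d * p j) > q" using q(2) by (rule order_tendstoD)
  then obtain j1 where j1: "\<And>j. j \<ge> j1 \<Longrightarrow> \<theta> * (real j * p j) > q"
    by (auto simp: eventually_sequentially dd)
  \<comment> \<open>The harmonic sum up to \<open>j1\<close>. Subtracting it makes the comparison
    series nonpositive at the small indices, where the asymptotic lower bound need not hold yet and
    only nonnegativity of the weights is used.\<close>
  define H where "H = (\<Sum>j\<in>{..<j1}. 1 / real (Suc j))"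
  have lnM: "q * (ln (1 / (1 - s)) - H) * l\<^sup>2 \<le> moment 0 (Wf l) s" if l: "l \<ge> 2" and s: "0 < s" "s < 1" for l s
  proof -
    have slog: "summable (\<lambda>j. s ^ Suc j / real (Suc j))"
      using summable_log_gen[of "\<lambda>_. 1" 1 s] s by simp
    have "ln (1 - s) = (\<Sum>n. - (s ^ Suc n / real (Suc n)))"
    proof -
      have "ln (1 - s) = (\<Sum>n. (- 1) ^ n * (1 / real (n + 1)) * (1 - s - 1) ^ Suc n)"
        by (rule ln_series) (use s in auto)
      also have "(\<lambda>n. (- 1) ^ n * (1 / real (n + 1)) * (1 - s - 1) ^ Suc n) = (\<lambda>n. - (s ^ Suc n / real (Suc n)))"
      proof
        fix n
        have "(- 1) ^ n * (- s) ^ n = s ^ n" by (simp flip: power_mult_distrib)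
        thus "(- 1) ^ n * (1 / real (n + 1)) * (1 - s - 1) ^ Suc n = - (s ^ Suc n / real (Suc n))"
          by simp
      qed
      finally show ?thesis .
    qed
    hence "ln (1 / (1 - s)) = (\<Sum>n. s ^ Suc n / real (Suc n))"
      using s suminf_minus[OF slog] by (simp add: ln_div)
    hence s1: "(\<lambda>n. s ^ Suc n / real (Suc n)) sums ln (1 / (1 - s))" using slog by (simp add: sums_iff)
    have s2: "(\<lambda>n. if n \<in> {..<j1} then 1 / real (Suc n) else 0) sums H"
      unfolding H_def by (rule sums_If_finite_set) simp
    have s3: "(\<lambda>n. q * l\<^sup>2 * (s ^ Suc n / real (Suc n) - (if n \<in> {..<j1} then 1 / real (Suc n) else 0))) sums (q * l\<^sup>2 * (ln (1 / (1 - s)) - H))"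
      by (intro sums_mult sums_diff s1 s2)
    have s4: "(\<lambda>j. real (Suc j) ^ 0 * (Wf l (Suc j) * s ^ Suc j)) sums moment 0 (Wf l) s"
      unfolding moment_def by (rule summable_sums, rule summable_moment[where B = "C * 2 ^ d * l ^ d"]) (use W_crude[OF l] s in auto)
    have "q * l\<^sup>2 * (ln (1 / (1 - s)) - H) \<le> moment 0 (Wf l) s"
    proof (rule sums_le[OF _ s3 s4])
      fix n
      show "q * l\<^sup>2 * (s ^ Suc n / real (Suc n) - (if n \<in> {..<j1} then 1 / real (Suc n) else 0)) \<le> real (Suc n) ^ 0 * (Wf l (Suc n) * s ^ Suc n)"
      proof (cases "n < j1")
        case True
        have "s ^ Suc n \<le> 1" using s by (intro power_le_one) auto
        hence "s ^ Suc n / real (Suc n) - 1 / real (Suc n) \<le> 0" by (simp add: divide_right_mono del: power_Suc of_nat_Suc)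
        hence "q * l\<^sup>2 * (s ^ Suc n / real (Suc n) - 1 / real (Suc n)) \<le> 0" using q(3) by (intro mult_nonneg_nonpos) auto
        moreover have "0 \<le> Wf l (Suc n) * s ^ Suc n" using W_crude(1)[OF l, of n] s by simp
        ultimately show ?thesis using True by simp
      next
        case False
        define k where "k = Suc n"
        have k: "k \<ge> j1" "k \<ge> 1" using False by (auto simp: k_def)
        have "q / real k \<le> \<theta> * p k" using j1[OF k(1)] k(2) by (simp add: pos_divide_le_eq mult_ac)
        hence "l\<^sup>2 * (q / real k) \<le> l\<^sup>2 * (\<theta> * p k)" by (intro mult_left_mono) auto
        also have "\<dots> \<le> Wf l k" using W_lower[OF l k(2)] by (simp add: dd mult_ac)
        finally have "l\<^sup>2 * (q / real k) * s ^ k \<le> Wf l k * s ^ k" using s by (intro mult_right_mono) auto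
        thus ?thesis using False by (simp add: k_def mult_ac del: power_Suc of_nat_Suc)
      qed
    qed
    thus ?thesis by (simp add: mult_ac)
  qed
  have "\<forall>\<^sub>F N in sequentially. \<rho> N / ln (real N) < \<alpha>'" using \<alpha>(3) q(4) by (rule order_tendstoD)
  moreover have "\<forall>\<^sub>F N in sequentially. \<rho> N > 0"
    using \<rho> by (rule filterlim_at_top_dense[THEN iffD1, rule_format])
  ultimately have bnd: "\<forall>\<^sub>F N in sequentially. norm (1 / (1 - r N) / (L N)\<^sup>2) \<le> exp H * \<alpha>' * (real N powr (- \<delta>) * ln (real N))"
    using saddle_eventually[OF d2] L_power eventually_gt_at_top[of 1]
  proof eventually_elim
    case (elim N)
    define M where "M = 1 / (1 - r N)"
    have L: "L N \<ge> 2" and r: "0 < r N" "r N < 1" using elim by auto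
    have M: "M > 0" using r by (simp add: M_def)
    have lnN: "ln (real N) > 0" using elim by simp
    have \<rho>le: "\<rho> N \<le> \<alpha>' * ln (real N)" using elim(1) lnN by (simp add: pos_divide_less_eq)
    have LN: "(L N)\<^sup>2 * \<rho> N = real N" using elim by (simp add: dd)
    have L2: "(L N)\<^sup>2 > 0" using L by simp
    have "q * (ln M - H) * (L N)\<^sup>2 \<le> (L N)\<^sup>2 * \<rho> N"
      using lnM[OF L r] elim(3) LN by (simp add: M_def)
    hence "(L N)\<^sup>2 * (q * (ln M - H)) \<le> (L N)\<^sup>2 * \<rho> N" by (simp add: mult_ac)
    hence "q * (ln M - H) \<le> \<rho> N" using L2 by (rule mult_left_le_imp_le)
    hence "q * (ln M - H) \<le> \<alpha>' * ln (real N)" using \<rho>le by linarith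
    hence "ln M \<le> (1 - \<delta>) * ln (real N) + H" using q(3) by (simp add: \<delta>_def field_simps)
    hence "exp (ln M) \<le> exp ((1 - \<delta>) * ln (real N) + H)" by (simp only: exp_le_cancel_iff)
    hence "M \<le> exp H * real N powr (1 - \<delta>)" using M elim by (simp add: exp_add powr_def mult.commute)
    moreover have "1 / (L N)\<^sup>2 = \<rho> N / real N" using LN L2 elim by (simp add: field_simps)
    ultimately have "M * (1 / (L N)\<^sup>2) \<le> exp H * real N powr (1 - \<delta>) * (\<alpha>' * ln (real N) / real N)"
      using \<rho>le elim by (intro mult_mono) (auto simp: divide_right_mono)
    also have "\<dots> = exp H * \<alpha>' * (real N powr (- \<delta>) * ln (real N))"
      using elim by (simp add: powr_diff powr_minus field_simps)
    finally have "M / (L N)\<^sup>2 \<le> exp H * \<alpha>' * (real N powr (- \<delta>) * ln (real N))" by simp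
    moreover have "M / (L N)\<^sup>2 \<ge> 0" using M by simp
    ultimately show ?case unfolding M_def[symmetric] real_norm_def by (simp only: abs_of_nonneg)
  qed
  have "(\<lambda>N. exp H * \<alpha>' * (real N powr (- \<delta>) * ln (real N))) \<longlonglongrightarrow> exp H * \<alpha>' * 0"
  proof (intro tendsto_mult tendsto_const)
    show "(\<lambda>N. real N powr (- \<delta>) * ln (real N)) \<longlonglongrightarrow> 0" using \<delta> by real_asymp
  qed
  hence "(\<lambda>N. 1 / (1 - r N) / (L N)\<^sup>2) \<longlonglongrightarrow> 0"
    by (intro Lim_null_comparison[OF bnd]) simp
  thus ?thesis by (rule good_saddle_critical[OF d2 saddle_eventually[OF d2] M_top])
qed

end

end

section \<open>The theorem\<close>

lemma zero_in_int_lattice: "0 \<in> int_lattice"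
  by (simp add: int_lattice_def)

text \<open>Assembles the lattice-sum bound and the local limit theorem into the locale. The
  constant \<open>lam\<close> is positive as the integral of a strictly positive function.\<close>

lemma lattice_weights_W:
  fixes \<phi> :: "real^'d \<Rightarrow> real"
  assumes \<theta>: "\<theta> > 0" and s: "schwartz \<phi>" and nn: "\<forall>x. \<phi> x \<ge> 0"
    and one: "(\<integral>x. \<phi> x \<partial>lborel) = 1" and mean: "mean_vec \<phi> = 0"
  obtains C where "lattice_weights (W \<theta> \<phi>) (\<lambda>j. conv_power \<phi> j 0) \<theta> C
    ((\<integral>u. exp (- quad_form \<phi> u / 2) \<partial>lborel) / (2 * pi) ^ CARD('d)) CARD('d)"
proof -
  note f = schwartz_density(1)[OF s nn one] and m3 = schwartz_density(2)[OF s nn one]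
  obtain C0 where C0: "C0 > 0" "\<And>x. norm x ^ 0 * \<phi> x \<le> C0 * (\<Prod>i\<in>UNIV. 1 / (1 + (x $ i)\<^sup>2))"
    using schwartz_decay[OF s nn, where k = 0] by blast
  have decay: "\<phi> x \<le> C0 * (\<Prod>i\<in>UNIV. 1 / (1 + (x $ i)\<^sup>2))" for x
    using C0(2)[of x] by simp
  obtain C where C: "C > 0"
    "\<And>L j. L \<ge> 2 \<Longrightarrow> j \<ge> 1 \<Longrightarrow> (\<lambda>k. conv_power \<phi> j (L *\<^sub>R k)) summable_on int_lattice"
    "\<And>L j. L \<ge> 2 \<Longrightarrow> j \<ge> 1 \<Longrightarrow> L ^ CARD('d) * infsum (\<lambda>k. conv_power \<phi> j (L *\<^sub>R k)) int_lattice
       \<le> C * (1 + L / sqrt (real j)) ^ CARD('d)"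
    using lattice_sum_conv_power_le[OF f C0(1) decay] by blast
  have cnn: "conv_power \<phi> j x \<ge> 0" if "j \<ge> 1" for j x
    using that nice_densityD(1)[OF nice_density_conv_power[OF f, of "j - 1"]] by simp
  define lam where "lam = (\<integral>u. exp (- quad_form \<phi> u / 2) \<partial>lborel) / (2 * pi) ^ CARD('d)"
  show ?thesis
  proof (rule that[of "\<theta> * C"], fold lam_def, unfold_locales)
    show "\<theta> * C > 0" using \<theta> C by simp
    show "1 \<le> CARD('d)" using zero_less_card_finite[where 'a = 'd] by linarith
    show "0 < lam"
    proof -
      have int: "integrable lborel (\<lambda>u. exp (- quad_form \<phi> u / 2))" by (rule conv_power_local_limit(1)[OF f m3 mean])
      have "(\<integral>u. exp (- quad_form \<phi> u / 2) \<partial>lborel) \<noteq> 0"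
      proof
        assume "(\<integral>u. exp (- quad_form \<phi> u / 2) \<partial>lborel) = 0"
        hence "AE u in (lborel :: (real^'d) measure). exp (- quad_form \<phi> u / 2) = 0"
          by (subst (asm) integral_nonneg_eq_0_iff_AE[OF int]) auto
        hence "AE u in (lborel :: (real^'d) measure). False" by simp
        thus False by (subst (asm) AE_iff_measurable[of UNIV]) auto
      qed
      moreover have "(\<integral>u. exp (- quad_form \<phi> u / 2) \<partial>lborel) \<ge> 0" by (rule Bochner_Integration.integral_nonneg) simp
      ultimately have "(\<integral>u. exp (- quad_form \<phi> u / 2) \<partial>lborel) > 0" by linarith
      thus ?thesis unfolding lam_def by (intro divide_pos_pos) auto
    qed
    show "(\<lambda>j. sqrt (real j) ^ CARD('d) * conv_power \<phi> j 0) \<longlonglongrightarrow> lam"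
      unfolding lam_def by (rule conv_power_local_limit(2)[OF f m3 mean])
    show "0 \<le> conv_power \<phi> j 0" if "1 \<le> j" for j by (rule cnn[OF that])
    fix L :: real and j :: nat assume L: "2 \<le> L" and j: "1 \<le> j"
    show "0 \<le> W \<theta> \<phi> L j"
      unfolding W_def using \<theta> L by (intro mult_nonneg_nonneg infsum_nonneg cnn[OF j]) auto
    have "\<theta> * (L ^ CARD('d) * infsum (\<lambda>k. conv_power \<phi> j (L *\<^sub>R k)) int_lattice) \<le> \<theta> * (C * (1 + L / sqrt (real j)) ^ CARD('d))"
      using \<theta> by (intro mult_left_mono C(3)[OF L j]) auto
    thus "W \<theta> \<phi> L j \<le> \<theta> * C * (1 + L / sqrt (real j)) ^ CARD('d)" by (simp add: W_def mult_ac)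
    have "(\<Sum>k\<in>{0}. conv_power \<phi> j (L *\<^sub>R k)) \<le> infsum (\<lambda>k. conv_power \<phi> j (L *\<^sub>R k)) int_lattice"
      by (rule finite_sum_le_infsum[OF C(2)[OF L j]]) (use zero_in_int_lattice cnn[OF j] in auto)
    hence "\<theta> * L ^ CARD('d) * conv_power \<phi> j 0 \<le> \<theta> * L ^ CARD('d) * infsum (\<lambda>k. conv_power \<phi> j (L *\<^sub>R k)) int_lattice"
      using \<theta> L by (intro mult_left_mono) auto
    thus "\<theta> * L ^ CARD('d) * conv_power \<phi> j 0 \<le> W \<theta> \<phi> L j" by (simp add: W_def)
  qed (rule \<theta>)
qed

section \<open>Identification of the abstract quantities with \<open>G\<close>, \<open>H\<close> and
  \<open>r_sol\<close>\<close>

lemma G_eq_log_gen: "G \<theta> \<phi> L = log_gen (W \<theta> \<phi> L)"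
  by (rule ext) (simp add: G_def log_gen_def)

lemma H_eq_exp_coeff: "H \<theta> \<phi> L = exp_coeff (W \<theta> \<phi> L)"
  by (rule ext) (simp add: H_def exp_coeff_def)

text \<open>Uniqueness of the saddle point is what gives the definite description in
  \<open>r_sol\<close> a meaning; the result is the \<open>saddle\<close> hypothesis of the regime
  lemmas.\<close>

lemma r_sol_saddle:
  fixes \<phi> :: "real^'d \<Rightarrow> real"
  assumes W: "\<And>j. 0 \<le> W \<theta> \<phi> L (Suc j)" "\<And>j. W \<theta> \<phi> L (Suc j) \<le> B"
    and R: "0 < R" "R < 1" "moment 0 (W \<theta> \<phi> L) R \<ge> real N" and N: "N > 0"
  shows "0 < r_sol \<theta> \<phi> L N \<and> r_sol \<theta> \<phi> L N \<le> R \<and> moment 0 (W \<theta> \<phi> L) (r_sol \<theta> \<phi> L N) = real N"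
proof -
  have N': "real N > 0" using N by simp
  note ex1 = saddle_point_ex1(1)[OF W R N']
  obtain r where r: "0 < r" "r \<le> R" "moment 0 (W \<theta> \<phi> L) r = real N"
    using saddle_point_ex1(2)[OF W R N'] by blast
  have iff: "(0 < x \<and> x < 1 \<and> x * deriv (G \<theta> \<phi> L) x = real N) \<longleftrightarrow> (0 < x \<and> x < 1 \<and> moment 0 (W \<theta> \<phi> L) x = real N)" for x
    using deriv_log_gen(1)[of "W \<theta> \<phi> L" B x, OF W] by (auto simp: G_eq_log_gen)
  have "r_sol \<theta> \<phi> L N = r"
    unfolding r_sol_def iff using ex1 r R by (intro the1_equality) auto
  with r show ?thesis by simp
qed

lemma quotient_at_top:
  assumes pos: "\<forall>\<^sub>F N in sequentially. \<rho> N > (0::real)" and lim: "(\<lambda>N. \<rho> N / real N) \<longlonglongrightarrow> 0"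
  shows "filterlim (\<lambda>N. real N / \<rho> N) at_top sequentially"
proof -
  have "filterlim (\<lambda>N. inverse (\<rho> N / real N)) at_top sequentially"
    by (rule filterlim_inverse_at_top[OF lim]) (use pos eventually_gt_at_top[of 0] in \<open>eventually_elim, simp\<close>)
  thus ?thesis by simp
qed

text \<open>Each regime makes \<rho> eventually positive and o(N), which is what L tending to
  infinity requires. With L^d \<rho> = N the regimes then reduce to three cases: a convergent
  density, and a diverging one in dimension 1 or 2.\<close>

lemma regime_good_saddle:
  fixes \<phi> :: "real^'d \<Rightarrow> real"
  assumes \<theta>: "\<theta> > 0" and s: "schwartz \<phi>" and nn: "\<forall>x. \<phi> x \<ge> 0"
    and one: "(\<integral>x. \<phi> x \<partial>lborel) = 1" and mean: "mean_vec \<phi> = 0" and reg: "regime \<theta> \<phi> \<rho>"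
  defines "L \<equiv> Lsize \<phi> \<rho>"
  shows "good_saddle (\<lambda>N. W \<theta> \<phi> (L N)) (\<lambda>N. r_sol \<theta> \<phi> (L N) N)"
    and "\<forall>\<^sub>F N in sequentially. \<exists>B. \<forall>j. 0 \<le> W \<theta> \<phi> (L N) (Suc j) \<and> W \<theta> \<phi> (L N) (Suc j) \<le> B"
proof -
  define lam where "lam = (\<integral>u. exp (- quad_form \<phi> u / 2) \<partial>lborel) / (2 * pi) ^ CARD('d)"
  obtain C where "lattice_weights (W \<theta> \<phi>) (\<lambda>j. conv_power \<phi> j 0) \<theta> C lam CARD('d)"
    using lattice_weights_W[OF \<theta> s nn one mean] unfolding lam_def by blast
  then interpret lattice_weights "W \<theta> \<phi>" "\<lambda>j. conv_power \<phi> j 0" \<theta> C lam "CARD('d)" .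
  have pos: "\<forall>\<^sub>F N in sequentially. \<rho> N > 0" and small: "(\<lambda>N. \<rho> N / real N) \<longlonglongrightarrow> 0"
  proof -
    have const: "(\<forall>\<^sub>F N in sequentially. \<rho> N > 0) \<and> (\<lambda>N. \<rho> N / real N) \<longlonglongrightarrow> 0" if "\<rho> \<longlonglongrightarrow> x" "x > 0" for x
      using that by (auto intro!: order_tendstoD(1) real_tendsto_divide_at_top filterlim_real_sequentially)
    have top: "\<forall>\<^sub>F N in sequentially. \<rho> N > 0" if "filterlim \<rho> at_top sequentially"
      using that by (rule filterlim_at_top_dense[THEN iffD1, rule_format])
    have sub1: "(\<lambda>N. \<rho> N / real N) \<longlonglongrightarrow> 0" if "\<rho> \<in> o(\<lambda>N. sqrt (real N))"
    proof -
      have "(\<lambda>N. \<rho> N / sqrt (real N) * (1 / sqrt (real N))) \<longlonglongrightarrow> 0 * 0"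
        by (intro tendsto_mult smalloD_tendsto[OF that]) real_asymp
      thus ?thesis by simp
    qed
    have sub2: "(\<lambda>N. \<rho> N / real N) \<longlonglongrightarrow> 0" if "(\<lambda>N. \<rho> N / ln (real N)) \<longlonglongrightarrow> x" for x
    proof -
      have "(\<lambda>N. \<rho> N / ln (real N) * (ln (real N) / real N)) \<longlonglongrightarrow> x * 0"
        by (intro tendsto_mult that) real_asymp
      moreover have "\<forall>\<^sub>F N in sequentially. \<rho> N / ln (real N) * (ln (real N) / real N) = \<rho> N / real N"
        using eventually_gt_at_top[of 1] by eventually_elim auto
      ultimately show ?thesis using Lim_transform_eventually by fastforce
    qed
    show "\<forall>\<^sub>F N in sequentially. \<rho> N > 0" "(\<lambda>N. \<rho> N / real N) \<longlonglongrightarrow> 0"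
      using reg const top sub1 sub2 unfolding regime_def by blast+
  qed
  have top: "filterlim (\<lambda>N. real N / \<rho> N) at_top sequentially" by (rule quotient_at_top[OF pos small])
  have L_limit: "filterlim L at_top sequentially"
  proof -
    define e where "e = 1 / real CARD('d)"
    have "e > 0" using zero_less_card_finite[where 'a = 'd] by (simp add: e_def)
    hence "filterlim (\<lambda>x::real. x powr e) at_top at_top" by real_asymp
    from filterlim_compose[OF this top] show ?thesis by (simp add: L_def Lsize_def[abs_def] e_def)
  qed
  have L_power: "\<forall>\<^sub>F N in sequentially. L N ^ CARD('d) * \<rho> N = real N"
    using pos eventually_gt_at_top[of 0]
  proof eventually_elim
    case (elim N)
    have x: "real N / \<rho> N > 0" using elim by simp
    have "L N ^ CARD('d) = L N powr real CARD('d)"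
      using x elim by (subst powr_realpow) (auto simp: L_def Lsize_def)
    also have "\<dots> = (real N / \<rho> N) powr 1" by (simp add: L_def Lsize_def powr_powr)
    also have "\<dots> = real N / \<rho> N" by (rule powr_one) (use x in simp)
    finally show ?case using elim by simp
  qed
  have saddle: "0 < r_sol \<theta> \<phi> (L N) N \<and> r_sol \<theta> \<phi> (L N) N \<le> R \<and> moment 0 (W \<theta> \<phi> (L N)) (r_sol \<theta> \<phi> (L N) N) = real N"
    if "L N \<ge> 2" "N > 0" "0 < R" "R < 1" "moment 0 (W \<theta> \<phi> (L N)) R \<ge> real N" for N R
    by (rule r_sol_saddle[where B = "C * 2 ^ CARD('d) * L N ^ CARD('d)"]) (use that W_crude[of "L N"] in auto)
  have const: "good_saddle (\<lambda>N. W \<theta> \<phi> (L N)) (\<lambda>N. r_sol \<theta> \<phi> (L N) N)"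
    if "\<rho> \<longlonglongrightarrow> x" "x > 0" "\<exists>J. \<theta> * (\<Sum>j\<in>{1..J}. conv_power \<phi> j 0) > x" for x
    using that good_saddle_const[OF L_limit L_power saddle] by blast
  from reg show "good_saddle (\<lambda>N. W \<theta> \<phi> (L N)) (\<lambda>N. r_sol \<theta> \<phi> (L N) N)"
    unfolding regime_def
  proof (elim disjE conjE exE)
    fix x assume *: "CARD('d) = 1" "0 < x" "\<rho> \<longlonglongrightarrow> x"
    show ?thesis by (rule const[of x]) (use * partial_sums_unbounded[OF L_limit L_power saddle] in auto)
  next
    assume *: "CARD('d) = 1" "filterlim \<rho> at_top sequentially" "\<rho> \<in> o(\<lambda>N. sqrt (real N))"
    have "(\<lambda>N. (\<rho> N / sqrt (real N))\<^sup>2) \<longlonglongrightarrow> 0\<^sup>2" by (intro tendsto_power smalloD_tendsto[OF *(3)])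
    hence "(\<lambda>N. (\<rho> N)\<^sup>2 / real N) \<longlonglongrightarrow> 0" by (simp add: power_divide)
    thus ?thesis by (intro good_saddle_dim1[OF L_limit L_power saddle *(1,2)])
  next
    fix x assume *: "CARD('d) = 2" "0 < x" "\<rho> \<longlonglongrightarrow> x"
    show ?thesis by (rule const[of x]) (use * partial_sums_unbounded[OF L_limit L_power saddle] in auto)
  next
    fix \<alpha> assume *: "CARD('d) = 2" "filterlim \<rho> at_top sequentially" "0 \<le> \<alpha>" "\<alpha> < alpha_c \<theta> \<phi>"
      "(\<lambda>N. \<rho> N / ln (real N)) \<longlonglongrightarrow> \<alpha>"
    \<comment> \<open>The Gaussian integral 2 pi / sqrt det, divided by the (2 pi)^2 of Fourier
      inversion, is 1 / (2 pi sqrt det).\<close>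
    have "\<theta> * lam = alpha_c \<theta> \<phi>"
      unfolding lam_def alpha_c_def
        integral_exp_quad_form_dim2[OF *(1) schwartz_density(1,2)[OF s nn one] mean] *(1)
      by (simp add: power2_eq_square)
    thus ?thesis using * by (intro good_saddle_dim2[OF L_limit L_power saddle *(1,2), of \<alpha>]) auto
  next
    fix x assume *: "3 \<le> CARD('d)" "0 < x" "x < rho_c \<theta> \<phi>" "\<rho> \<longlonglongrightarrow> x"
    show ?thesis
    proof (rule const[OF *(4,2)], rule ccontr)
      \<comment> \<open>Partial sums bounded by x / \<theta> would make the series converge, so that
        \<open>rho_c\<close> is its genuine value and at most x. A divergent series is covered as
        well, since some partial sum then exceeds the bound.\<close>
      assume "\<nexists>J. \<theta> * (\<Sum>j\<in>{1..J}. conv_power \<phi> j 0) > x"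
      hence le: "(\<Sum>j\<in>{1..J}. conv_power \<phi> j 0) \<le> x / \<theta>" for J
        using \<theta> by (simp add: pos_le_divide_eq not_less mult.commute)
      have le': "(\<Sum>j<n. conv_power \<phi> (Suc j) 0) \<le> x / \<theta>" for n
      proof -
        have "(\<Sum>j<n. conv_power \<phi> (Suc j) 0) = (\<Sum>j\<in>{1..n}. conv_power \<phi> j 0)"
          by (rule sum.reindex_bij_witness[of _ "\<lambda>j. j - 1" Suc]) auto
        thus ?thesis using le[of n] by simp
      qed
      have nn': "0 \<le> conv_power \<phi> (Suc j) 0" for j by (rule p_nonneg) simp
      have "summable (\<lambda>j. conv_power \<phi> (Suc j) 0)"
        by (rule summableI_nonneg_bounded[OF nn' le'])
      hence "(\<Sum>j. conv_power \<phi> (Suc j) 0) \<le> x / \<theta>" by (rule suminf_le_const) (rule le')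
      hence "rho_c \<theta> \<phi> \<le> x" using \<theta> by (simp add: rho_c_def pos_le_divide_eq mult.commute)
      with *(3) show False by simp
    qed
  qed
  have "\<forall>\<^sub>F N in sequentially. L N \<ge> 2" using L_limit by (simp add: filterlim_at_top)
  thus "\<forall>\<^sub>F N in sequentially. \<exists>B. \<forall>j. 0 \<le> W \<theta> \<phi> (L N) (Suc j) \<and> W \<theta> \<phi> (L N) (Suc j) \<le> B"
    by eventually_elim (use W_crude in blast)
qed

theorem mainTheorem13:
  fixes \<theta> :: real and \<phi> :: "real^'d \<Rightarrow> real"
    and \<rho> :: "nat \<Rightarrow> real" and jN :: "nat \<Rightarrow> nat"
  assumes "\<theta> > 0"
    and "schwartz \<phi>"
    and "\<forall>x. \<phi> x \<ge> 0"
    and "(\<integral>x. \<phi> x \<partial>lborel) = 1"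
    and "mean_vec \<phi> = 0"
    and "regime \<theta> \<phi> \<rho>"
    and "\<forall>N\<ge>1. 1 \<le> jN N \<and> jN N \<le> N"
    and "(\<lambda>N. (real (jN N))^2) \<in>
           o(\<lambda>N. a_var \<theta> \<phi> (Lsize \<phi> \<rho> N) (r_sol \<theta> \<phi> (Lsize \<phi> \<rho> N) N))"
  shows "\<forall>\<epsilon>>0. eventually (\<lambda>N. \<forall>j\<le>jN N.
           let L = Lsize \<phi> \<rho> N; r = r_sol \<theta> \<phi> L N; a = a_var \<theta> \<phi> L r in
           \<bar>H \<theta> \<phi> L (N - j) / (exp (G \<theta> \<phi> L r) / (r ^ (N - j) * sqrt (2 * pi * a))) - 1\<bar> < \<epsilon>)
         sequentially"
proof (intro allI impI)
  fix \<epsilon> :: real assume \<epsilon>: "\<epsilon> > 0"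
  define L where "L = Lsize \<phi> \<rho>"
  define r where "r N = r_sol \<theta> \<phi> (L N) N" for N
  define w where "w N = W \<theta> \<phi> (L N)" for N
  have good: "good_saddle w r"
    using regime_good_saddle(1)[OF assms(1-6)] unfolding w_def[abs_def] r_def[abs_def] L_def .
  have bdd: "\<forall>\<^sub>F N in sequentially. \<exists>B. \<forall>j. 0 \<le> w N (Suc j) \<and> w N (Suc j) \<le> B"
    using regime_good_saddle(2)[OF assms(1-6)] unfolding w_def L_def .
  have sad: "\<forall>\<^sub>F N in sequentially. 0 < r N \<and> r N < 1 \<and> moment 0 (w N) (r N) = real N"
    and third: "(\<lambda>N. moment 2 (w N) (r N) / (moment 1 (w N) (r N) * sqrt (moment 1 (w N) (r N)))) \<longlonglongrightarrow> 0"
    using good unfolding good_saddle_def by blast+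
  obtain c C where c: "c > 0" "\<forall>\<^sub>F N in sequentially. \<forall>t\<in>{- pi..pi}.
      osc (w N) (r N) t \<ge> c * sqrt (sqrt (moment 1 (w N) (r N)) * \<bar>t\<bar>) - C"
    using good unfolding good_saddle_def by blast
  have a_eq: "\<forall>\<^sub>F N in sequentially. a_var \<theta> \<phi> (L N) (r N) = moment 1 (w N) (r N)"
    using sad bdd
  proof eventually_elim
    case (elim N)
    then obtain B where "\<And>j. 0 \<le> w N (Suc j)" "\<And>j. w N (Suc j) \<le> B" by blast
    with elim show ?case
      unfolding a_var_def G_eq_log_gen w_def[symmetric] by (intro deriv_log_gen(2)) auto
  qed
  have a_top: "filterlim (\<lambda>N. moment 1 (w N) (r N)) at_top sequentially"
  proof (rule filterlim_at_top_mono[OF filterlim_real_sequentially])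
    show "\<forall>\<^sub>F N in sequentially. real N \<le> moment 1 (w N) (r N)"
      using sad bdd
    proof eventually_elim
      case (elim N)
      then obtain B where "\<And>j. 0 \<le> w N (Suc j)" "\<And>j. w N (Suc j) \<le> B" by blast
      with elim moment_0_le_moment_1[of "w N" B "r N"] show ?case by auto
    qed
  qed
  have jo: "(\<lambda>N. (real (jN N))\<^sup>2 / moment 1 (w N) (r N)) \<longlonglongrightarrow> 0"
  proof (rule Lim_transform_eventually)
    show "(\<lambda>N. (real (jN N))\<^sup>2 / a_var \<theta> \<phi> (L N) (r N)) \<longlonglongrightarrow> 0"
      using smalloD_tendsto[OF assms(8)] by (simp add: L_def r_def)
    show "\<forall>\<^sub>F N in sequentially. (real (jN N))\<^sup>2 / a_var \<theta> \<phi> (L N) (r N) = (real (jN N))\<^sup>2 / moment 1 (w N) (r N)"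
      using a_eq by eventually_elim simp
  qed
  have jN: "\<forall>\<^sub>F N in sequentially. jN N \<le> N"
    using eventually_ge_at_top[of 1] by eventually_elim (use assms(7) in auto)
  have "\<forall>\<^sub>F N in sequentially. \<forall>j\<le>jN N.
      \<bar>exp_coeff (w N) (N - j) / (exp (log_gen (w N) (r N)) / (r N ^ (N - j) * sqrt (2 * pi * moment 1 (w N) (r N)))) - 1\<bar> < \<epsilon>"
    by (rule exp_coeff_local_limit[OF sad bdd a_top third c jN jo \<epsilon>])
  thus "\<forall>\<^sub>F N in sequentially. \<forall>j\<le>jN N.
           let L = Lsize \<phi> \<rho> N; r = r_sol \<theta> \<phi> L N; a = a_var \<theta> \<phi> L r in
           \<bar>H \<theta> \<phi> L (N - j) / (exp (G \<theta> \<phi> L r) / (r ^ (N - j) * sqrt (2 * pi * a))) - 1\<bar> < \<epsilon>"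
    using a_eq
  proof eventually_elim
    case (elim N)
    show ?case
      unfolding Let_def L_def[symmetric] r_def[symmetric] H_eq_exp_coeff G_eq_log_gen w_def[symmetric] elim(2)
      by (rule elim(1))
  qed
qed

end
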